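(* Let $\mathcal{K}^{\langle\infty\rangle}$ be an unbounded simple nested fractal with the Good Labeling Property, and let $\alpha\in(0,1)$. For $M\in\mathbb{Z}_+$ let $p_S^M(t,x,y)$ be the transition density of the reflected $\alpha$-stable process on $\mathcal{K}^{\langle M\rangle}$, and let $p_S(t,x,y)$ be the transition density of the $\alpha$-stable process on $\mathcal{K}^{\langle\infty\rangle}$. Then there exist constants $B_1,B_2,B_3,B_4>0$, independent of $M$, such that for all $M\in\mathbb{Z}_+$ and all $x,y\in\mathcal{K}^{\langle M\rangle}$: $$B_1\,p_S(t,x,y)\le p_S^M(t,x,y)\le B_2\,p_S(t,x,y)\qquad\text{if } 0<t<L^{\alpha M d_w},$$ $$B_3\,L^{-Md}\le p_S^M(t,x,y)\le B_4\,L^{-Md}\qquad\text{if } t\ge L^{\alpha M d_w}.$$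
   Context: **Simple nested fractals.** Let $\Psi_i:\mathbb{R}^2\to\mathbb{R}^2$, $i=1,\dots,N$, be similitudes $\Psi_i(x)=\frac1L U(x)+\nu_i$ with common scaling factor $L>1$, common isometry part $U$, $\nu_i\in\mathbb{R}^2$, $\nu_1=0$. Let $\mathcal{K}^{\langle 0\rangle}$ be the unique nonempty compact set with $\mathcal{K}^{\langle 0\rangle}=\bigcup_{i=1}^N\Psi_i(\mathcal{K}^{\langle 0\rangle})$. Let $F$ be the set of the fixed points of the $\Psi_i$. A point $x\in F$ is an essential fixed point if there are another $y\in F$ and two different similitudes $\Psi_i,\Psi_j$ with $\Psi_i(x)=\Psi_j(y)$. Let $V_0^{\langle 0\rangle}$ be the set of essential fixed points and $K=\#V_0^{\langle 0\rangle}$. $\mathcal{K}^{\langle 0\rangle}$ is a simple nested fractal if: 1. $\#V_0^{\langle 0\rangle}\ge2$. 2. (Open set condition) There is an open set $O\subset\mathbb{R}^2$ with $\Psi_i(O)\cap\Psi_j(O)=\emptyset$ for $i\ne j$ and $\bigcup_i\Psi_i(O)\subseteq O$. 3. (Nesting) $\Psi_i(\mathcal{K}^{\langle 0\rangle})\cap\Psi_j(\mathcal{K}^{\langle 0\rangle})=\Psi_i(V_0^{\langle 0\rangle})\cap\Psi_j(V_0^{\langle 0\rangle})$ for $i\neq j$. 4. (Symmetry) For $x,y\in V_0^{\langle 0\rangle}$ let $S_{x,y}$ be the reflection in the line bisecting the segment $[x,y]$; then for every $i\in\{1,\dots,N\}$ and all $x,y\in V_0^{\langle 0\rangle}$ there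 is $j\in\{1,\dots,N\}$ with $S_{x,y}(\Psi_i(V_0^{\langle 0\rangle}))=\Psi_j(V_0^{\langle 0\rangle})$. 5. (Connectivity) The graph with vertex set $\bigcup_i\Psi_i(V_0^{\langle 0\rangle})$, in which $x,y$ are joined iff $x,y\in\Psi_i(\mathcal{K}^{\langle 0\rangle})$ for some $i$, is connected. For $M\in\mathbb{Z}$ put $\mathcal{K}^{\langle M\rangle}=L^M\mathcal{K}^{\langle 0\rangle}$, and let $\mathcal{K}^{\langle\infty\rangle}=\bigcup_{M\ge0}\mathcal{K}^{\langle M\rangle}$ be the unbounded simple nested fractal. Its Hausdorff dimension is $d=\log N/\log L$; $\mu$ is the $d$-dimensional Hausdorff measure on it normalized by $\mu(\mathcal{K}^{\langle 0\rangle})=1$. **Complexes, vertices.** An $M$-complex is a set $\Delta=\mathcal{K}^{\langle M\rangle}+\nu_\Delta\subset\mathcal{K}^{\langle\infty\rangle}$ with $\nu_\Delta=\sum_{j=M+1}^{J}L^j\nu_{i_j}$, $J\ge M+1$, $\nu_{i_j}\in\{\nu_1,\dots,\nu_N\}$. Put $V_M^{\langle M\rangle}=V(\mathcal{K}^{\langle M\rangle})=L^MV_0^{\langle 0\rangle}$, $V(\Delta)=V(\mathcal{K}^{\langle M\rangle})+\nu_\Delta$, and let $V_M^{\langle\infty\rangle}$ be the set of vertices of all $M$-complexes. **Good Labeling Property (GLP).** Let $\mathcal{A}=\{a_1,\dots,a_K\}$ be a set of $K$ labels and let $\mathcal{R}_M=\{R_1,\dots,R_K\}$ be the $K$ rotations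 about the barycenter of $\mathcal{K}^{\langle M\rangle}$ mapping $V(\mathcal{K}^{\langle M\rangle})$ onto itself. $\mathcal{K}^{\langle\infty\rangle}$ has the GLP if for some $M\in\mathbb{Z}$ (equivalently, by scaling, for every $M$) there is $\ell_M:V_M^{\langle\infty\rangle}\to\mathcal{A}$ such that (1) $\ell_M$ restricted to $V_M^{\langle M\rangle}$ is a bijection onto $\mathcal{A}$; (2) for every $M$-complex $\Delta=\mathcal{K}^{\langle M\rangle}+\nu_\Delta$ there is a rotation $R_\Delta\in\mathcal{R}_M$ with $\ell_M(v)=\ell_M(R_\Delta(v-\nu_\Delta))$ for all $v\in V(\Delta)$. Then the projection $\pi_M:\mathcal{K}^{\langle\infty\rangle}\to\mathcal{K}^{\langle M\rangle}$ is $\pi_M(x)=R_\Delta(x-\nu_\Delta)$, where $\Delta$ is an $M$-complex containing $x$. **Brownian motion.** $Z=(Z_t)_{t\ge0}$ is the Brownian motion on $\mathcal{K}^{\langle\infty\rangle}$: a strong Markov, Feller diffusion with transition density $g(t,x,y)$ with respect to $\mu$, jointly continuous on $(0,\infty)\times\mathcal{K}^{\langle\infty\rangle}\times\mathcal{K}^{\langle\infty\rangle}$, satisfying $g(t,x,y)=L^{d}g(L^{d_w}t,Lx,Ly)$ and, with absolute constants $K_1,\dots,K_4>0$, $$K_1t^{-d/d_w}e^{-K_2(|x-y|^{d_w}/t)^{1/(d_J-1)}}\le g(t,x,y)\le K_3t^{-d/d_w}e^{-K_4(|x-y|^{d_w}/t)^{1/(d_J-1)}}$$ for $t>0$, $x,y\in\mathcal{K}^{\langle\infty\rangle}$,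 where $d_w$ is the walk dimension and $d_J>1$ the chemical exponent of $\mathcal{K}^{\langle\infty\rangle}$. **Reflected Brownian motion.** $Z^M_t=\pi_M(Z_t)$ is the reflected Brownian motion on $\mathcal{K}^{\langle M\rangle}$. Its transition density is, for $t>0$, $x,y\in\mathcal{K}^{\langle M\rangle}$, $g_M(t,x,y)=\sum_{y'\in\pi_M^{-1}(y)}g(t,x,y')$ if $y\notin V_M^{\langle M\rangle}$, and $g_M(t,x,y)=\sum_{y'\in\pi_M^{-1}(y)}g(t,x,y')\,\mathrm{rank}(y')$ if $y\in V_M^{\langle M\rangle}$, where $\mathrm{rank}(y')$ is the number of $M$-complexes meeting at $y'$. **Subordination.** For $\alpha\in(0,1)$ let $\eta_t$ be the density on $(0,\infty)$ of the $\alpha$-stable subordinator at time $t>0$, i.e. $\int_0^\infty e^{-\lambda s}\eta_t(s)\,ds=e^{-t\lambda^\alpha}$ for $\lambda>0$. The $\alpha$-stable process on $\mathcal{K}^{\langle\infty\rangle}$ is $Z_{S_t}$ and the reflected $\alpha$-stable process on $\mathcal{K}^{\langle M\rangle}$ is $Z^M_{S_t}$, where $S$ is the $\alpha$-stable subordinator independent of $Z$. Their transition densities are $$p_S(t,x,y)=\int_0^\infty g(s,x,y)\eta_t(s)\,ds,\qquad p_S^M(t,x,y)=\int_0^\infty g_M(s,x,y)\eta_t(s)\,ds.$$ *)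

theory Defs
  imports "HOL-Probability.Probability"
begin

section \<open>Simple nested fractals\<close>

record similitudes =
  num_maps :: nat
  scaling :: real
  isom :: "real^2 \<Rightarrow> real^2"
  transl :: "nat \<Rightarrow> real^2"

definition simil :: "similitudes \<Rightarrow> nat \<Rightarrow> real^2 \<Rightarrow> real^2" where
  "simil F i x = (1 / scaling F) *\<^sub>R isom F x + transl F i"

definition fractal0 :: "similitudes \<Rightarrow> (real^2) set" where
  "fractal0 F = (THE K. compact K \<and> K \<noteq> {} \<and> K = (\<Union>i\<in>{1..num_maps F}. simil F i ` K))"

definition fixed_points :: "similitudes \<Rightarrow> (real^2) set" where
  "fixed_points F = {x. \<exists>i\<in>{1..num_maps F}. simil F i x = x}"

definition essential_fixed_points :: "similitudes \<Rightarrow> (real^2) set" where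
  "essential_fixed_points F =
     {x \<in> fixed_points F. \<exists>y\<in>fixed_points F. y \<noteq> x \<and>
        (\<exists>i\<in>{1..num_maps F}. \<exists>j\<in>{1..num_maps F}.
           simil F i \<noteq> simil F j \<and> simil F i x = simil F j y)}"

text \<open>Reflection in the perpendicular bisector of the segment from \<open>x\<close> to \<open>y\<close> (for \<open>x \<noteq> y\<close>).\<close>

definition bisector_reflection :: "real^2 \<Rightarrow> real^2 \<Rightarrow> real^2 \<Rightarrow> real^2" where
  "bisector_reflection x y z =
     z - (2 * ((z - midpoint x y) \<bullet> (y - x)) / (norm (y - x))\<^sup>2) *\<^sub>R (y - x)"

definition cell_vertices :: "similitudes \<Rightarrow> (real^2) set" where
  "cell_vertices F = (\<Union>i\<in>{1..num_maps F}. simil F i ` essential_fixed_points F)"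

definition cell_edges :: "similitudes \<Rightarrow> ((real^2) \<times> (real^2)) set" where
  "cell_edges F = {(x, y). x \<in> cell_vertices F \<and> y \<in> cell_vertices F \<and>
     (\<exists>i\<in>{1..num_maps F}. x \<in> simil F i ` fractal0 F \<and> y \<in> simil F i ` fractal0 F)}"

text \<open>The set in the open set condition has to be nonempty, otherwise the condition is void. The
  isometry part is linear; a translational part is absorbed in the vectors \<open>transl F i\<close>.\<close>

locale simple_nested_fractal =
  fixes F :: similitudes
  assumes scaling: "scaling F > 1"
    and isometry: "orthogonal_transformation (isom F)"
    and transl_1: "transl F 1 = 0"
    and card_essential: "card (essential_fixed_points F) \<ge> 2"
    and open_set_condition:
      "\<exists>U. open U \<and> U \<noteq> {} \<and>
         (\<forall>i\<in>{1..num_maps F}. \<forall>j\<in>{1..num_maps F}. i \<noteq> j \<longrightarrow>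
            simil F i ` U \<inter> simil F j ` U = {}) \<and>
         (\<Union>i\<in>{1..num_maps F}. simil F i ` U) \<subseteq> U"
    and nesting:
      "\<forall>i\<in>{1..num_maps F}. \<forall>j\<in>{1..num_maps F}. i \<noteq> j \<longrightarrow>
         simil F i ` fractal0 F \<inter> simil F j ` fractal0 F =
         simil F i ` essential_fixed_points F \<inter> simil F j ` essential_fixed_points F"
    and symmetry:
      "\<forall>i\<in>{1..num_maps F}. \<forall>x\<in>essential_fixed_points F. \<forall>y\<in>essential_fixed_points F. x \<noteq> y \<longrightarrow>
         (\<exists>j\<in>{1..num_maps F}.
            bisector_reflection x y ` simil F i ` essential_fixed_points F =
            simil F j ` essential_fixed_points F)"
    and connectivity:
      "\<forall>x\<in>cell_vertices F. \<forall>y\<in>cell_vertices F. (x, y) \<in> (cell_edges F)\<^sup>*"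

definition fractal :: "similitudes \<Rightarrow> int \<Rightarrow> (real^2) set" where
  "fractal F M = (\<lambda>x. (scaling F powi M) *\<^sub>R x) ` fractal0 F"

definition unbounded_fractal :: "similitudes \<Rightarrow> (real^2) set" where
  "unbounded_fractal F = (\<Union>M::nat. fractal F (int M))"

definition fractal_dim :: "similitudes \<Rightarrow> real" where
  "fractal_dim F = ln (real (num_maps F)) / ln (scaling F)"


section \<open>Hausdorff measure\<close>

definition hausdorff_premeasure ::
    "real \<Rightarrow> real \<Rightarrow> 'a::{metric_space, second_countable_topology} set \<Rightarrow> ennreal" where
  "hausdorff_premeasure s \<delta> A =
     (INF U\<in>{U :: nat \<Rightarrow> 'a set. A \<subseteq> (\<Union>n. U n) \<and> (\<forall>n. bounded (U n) \<and> diameter (U n) \<le> \<delta>)}.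
        \<Sum>n. ennreal (diameter (U n) powr s))"

definition hausdorff_outer ::
    "real \<Rightarrow> 'a::{metric_space, second_countable_topology} set \<Rightarrow> ennreal" where
  "hausdorff_outer s A = (SUP \<delta>\<in>{0<..}. hausdorff_premeasure s \<delta> A)"

text \<open>The \<open>s\<close>-dimensional Hausdorff measure on the Borel sets; note that \<open>0 powr s = 0\<close>, so this is
  the usual notion for \<open>s > 0\<close> only.\<close>

definition hausdorff_measure ::
    "real \<Rightarrow> 'a::{metric_space, second_countable_topology} measure" where
  "hausdorff_measure s = measure_of UNIV (sets borel) (hausdorff_outer s)"

definition fractal_measure :: "similitudes \<Rightarrow> (real^2) measure" where
  "fractal_measure F =
     scale_measure (1 / emeasure (hausdorff_measure (fractal_dim F)) (fractal0 F))
       (restrict_space (hausdorff_measure (fractal_dim F)) (unbounded_fractal F))"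


section \<open>Complexes, labelings and projections\<close>

text \<open>\<open>M\<close>-complexes are the sets \<open>K\<^sup>M + \<nu>\<close>, and \<open>complex_shifts F M\<close> is the set of the vectors \<open>\<nu>\<close>.
  As \<open>K\<^sup>M\<close> is bounded and nonempty, a complex determines its vector \<open>\<nu>\<close>.\<close>

definition complex_at :: "similitudes \<Rightarrow> int \<Rightarrow> real^2 \<Rightarrow> (real^2) set" where
  "complex_at F M \<nu> = (\<lambda>x. x + \<nu>) ` fractal F M"

definition complex_shifts :: "similitudes \<Rightarrow> int \<Rightarrow> (real^2) set" where
  "complex_shifts F M =
     {\<nu>. complex_at F M \<nu> \<subseteq> unbounded_fractal F \<and>
         (\<exists>J \<ge> M + 1. \<exists>i. (\<forall>j\<in>{M+1..J}. i j \<in> {1..num_maps F}) \<and>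
            \<nu> = (\<Sum>j = M+1..J. (scaling F powi j) *\<^sub>R transl F (i j)))}"

definition complexes :: "similitudes \<Rightarrow> int \<Rightarrow> (real^2) set set" where
  "complexes F M = complex_at F M ` complex_shifts F M"

definition vertices :: "similitudes \<Rightarrow> int \<Rightarrow> (real^2) set" where
  "vertices F M = (\<lambda>x. (scaling F powi M) *\<^sub>R x) ` essential_fixed_points F"

definition vertices_at :: "similitudes \<Rightarrow> int \<Rightarrow> real^2 \<Rightarrow> (real^2) set" where
  "vertices_at F M \<nu> = (\<lambda>x. x + \<nu>) ` vertices F M"

definition all_vertices :: "similitudes \<Rightarrow> int \<Rightarrow> (real^2) set" where
  "all_vertices F M = (\<Union>\<nu>\<in>complex_shifts F M. vertices_at F M \<nu>)"

definition complex_rank :: "similitudes \<Rightarrow> int \<Rightarrow> real^2 \<Rightarrow> nat" where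
  "complex_rank F M y = card {\<Delta> \<in> complexes F M. y \<in> \<Delta>}"

definition barycenter :: "similitudes \<Rightarrow> int \<Rightarrow> real^2" where
  "barycenter F M =
     (1 / measure (fractal_measure F) (fractal F M)) *\<^sub>R
       (LINT x:fractal F M|fractal_measure F. x)"

definition rotations :: "similitudes \<Rightarrow> int \<Rightarrow> (real^2 \<Rightarrow> real^2) set" where
  "rotations F M =
     {R. (\<exists>Q :: real^2^2. rotation_matrix Q \<and>
            R = (\<lambda>x. barycenter F M + Q *v (x - barycenter F M))) \<and>
         R ` vertices F M = vertices F M}"

definition rotation_fits ::
    "similitudes \<Rightarrow> int \<Rightarrow> (real^2 \<Rightarrow> nat) \<Rightarrow> real^2 \<Rightarrow> (real^2 \<Rightarrow> real^2) \<Rightarrow> bool" where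
  "rotation_fits F M l \<nu> R \<longleftrightarrow>
     R \<in> rotations F M \<and> (\<forall>v\<in>vertices_at F M \<nu>. l v = l (R (v - \<nu>)))"

definition good_labeling :: "similitudes \<Rightarrow> int \<Rightarrow> (real^2 \<Rightarrow> nat) \<Rightarrow> bool" where
  "good_labeling F M l \<longleftrightarrow>
     l \<in> all_vertices F M \<rightarrow> {1..card (essential_fixed_points F)} \<and>
     bij_betw l (vertices F M) {1..card (essential_fixed_points F)} \<and>
     (\<forall>\<nu>\<in>complex_shifts F M. \<exists>R. rotation_fits F M l \<nu> R)"

definition good_labeling_property :: "similitudes \<Rightarrow> bool" where
  "good_labeling_property F \<longleftrightarrow> (\<exists>M l. good_labeling F M l)"

text \<open>The projection does not depend on the labeling, the complex and the rotation that are picked: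
  a rotation in \<open>rotations F M\<close> is determined by the labels of the vertices of the complex, the
  labels on one complex determine those on all the others up to a permutation of the label set, and
  distinct complexes meet in common vertices only.\<close>

definition labeling :: "similitudes \<Rightarrow> int \<Rightarrow> real^2 \<Rightarrow> nat" where
  "labeling F M = (SOME l. good_labeling F M l)"

definition fractal_proj :: "similitudes \<Rightarrow> int \<Rightarrow> real^2 \<Rightarrow> real^2" where
  "fractal_proj F M x =
     (let \<nu> = (SOME \<nu>. \<nu> \<in> complex_shifts F M \<and> x \<in> complex_at F M \<nu>);
          R = (SOME R. rotation_fits F M (labeling F M) \<nu> R)
      in R (x - \<nu>))"

definition proj_fiber :: "similitudes \<Rightarrow> int \<Rightarrow> real^2 \<Rightarrow> (real^2) set" where
  "proj_fiber F M y = {y' \<in> unbounded_fractal F. fractal_proj F M y' = y}"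


section \<open>Brownian motion\<close>

text \<open>Stopping times take values in \<^typ>\<open>ennreal\<close>, so the filtration is indexed by \<^typ>\<open>ennreal\<close>.\<close>

definition natural_filtration ::
    "'w measure \<Rightarrow> (real \<Rightarrow> 'w \<Rightarrow> real^2) \<Rightarrow> ennreal \<Rightarrow> 'w measure" where
  "natural_filtration \<Omega> Z t =
     sigma (space \<Omega>) {Z s -` B \<inter> space \<Omega> | s B. 0 \<le> s \<and> ennreal s \<le> t \<and> B \<in> sets borel}"

definition strong_markov ::
    "(real^2) set \<Rightarrow> 'w measure \<Rightarrow> (real^2 \<Rightarrow> 'w measure) \<Rightarrow> (real \<Rightarrow> 'w \<Rightarrow> real^2) \<Rightarrow> bool" where
  "strong_markov E \<Omega> P Z \<longleftrightarrow>
     (\<forall>T. stopping_time (natural_filtration \<Omega> Z) T \<longrightarrow>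
       (\<forall>A \<in> sets (filtration.pre_sigma (space \<Omega>) (natural_filtration \<Omega> Z) T).
        \<forall>x\<in>E. \<forall>t\<ge>0. \<forall>B\<in>sets borel.
          emeasure (P x) {\<omega>\<in>A. T \<omega> < \<infinity> \<and> Z (enn2real (T \<omega>) + t) \<omega> \<in> B} =
          (\<integral>\<^sup>+\<omega>\<in>{\<omega>\<in>A. T \<omega> < \<infinity>}.
             emeasure (P (Z (enn2real (T \<omega>)) \<omega>)) {\<omega>'\<in>space \<Omega>. Z t \<omega>' \<in> B} \<partial>P x)))"

text \<open>Closed bounded subsets of the unbounded fractal are compact, so vanishing at infinity can be
  expressed through the norm.\<close>

definition C0 :: "(real^2) set \<Rightarrow> (real^2 \<Rightarrow> real) set" where
  "C0 E = {f. continuous_on E f \<and> (\<forall>\<epsilon>>0. \<exists>r. \<forall>x\<in>E. norm x > r \<longrightarrow> \<bar>f x\<bar> < \<epsilon>)}"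

definition feller ::
    "(real^2) set \<Rightarrow> (real^2) measure \<Rightarrow> (real \<Rightarrow> real^2 \<Rightarrow> real^2 \<Rightarrow> real) \<Rightarrow> bool" where
  "feller E \<mu> g \<longleftrightarrow>
     (\<forall>f\<in>C0 E.
        (\<forall>t>0. (\<lambda>x. LINT y|\<mu>. g t x y * f y) \<in> C0 E) \<and>
        uniform_limit E (\<lambda>t x. LINT y|\<mu>. g t x y * f y) f (at_right 0))"

text \<open>\<open>Z\<close> is the coordinate process on the measurable space \<open>\<Omega>\<close> (whose measure is irrelevant) and
  \<open>P x\<close> is its law when started at \<open>x\<close>. The parameter \<open>dw\<close> is the walk dimension and \<open>dJ\<close> the
  chemical exponent.\<close>

locale fractal_brownian_motion =
  fixes F :: similitudes
    and \<Omega> :: "'w measure"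
    and P :: "real^2 \<Rightarrow> 'w measure"
    and Z :: "real \<Rightarrow> 'w \<Rightarrow> real^2"
    and g :: "real \<Rightarrow> real^2 \<Rightarrow> real^2 \<Rightarrow> real"
    and dw dJ :: real
  assumes dw_pos: "dw > 0"
    and dJ_gt_1: "dJ > 1"
    and prob_space_P: "\<And>x. x \<in> unbounded_fractal F \<Longrightarrow> prob_space (P x)"
    and sets_P: "\<And>x. x \<in> unbounded_fractal F \<Longrightarrow> sets (P x) = sets \<Omega>"
    and measurable_Z:
      "\<And>t. t \<ge> 0 \<Longrightarrow> Z t \<in> \<Omega> \<rightarrow>\<^sub>M restrict_space borel (unbounded_fractal F)"
    and continuous_paths: "\<And>\<omega>. \<omega> \<in> space \<Omega> \<Longrightarrow> continuous_on {0..} (\<lambda>t. Z t \<omega>)"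
    and start: "\<And>x. x \<in> unbounded_fractal F \<Longrightarrow> AE \<omega> in P x. Z 0 \<omega> = x"
    and strong_markov: "strong_markov (unbounded_fractal F) \<Omega> P Z"
    and feller: "feller (unbounded_fractal F) (fractal_measure F) g"
    and transition_density:
      "\<And>t x B. t > 0 \<Longrightarrow> x \<in> unbounded_fractal F \<Longrightarrow> B \<in> sets borel \<Longrightarrow>
         emeasure (P x) {\<omega>\<in>space \<Omega>. Z t \<omega> \<in> B} =
         (\<integral>\<^sup>+y\<in>B. ennreal (g t x y) \<partial>fractal_measure F)"
    and continuous_density:
      "continuous_on ({0<..} \<times> unbounded_fractal F \<times> unbounded_fractal F) (\<lambda>(t, x, y). g t x y)"
    and density_scaling:
      "\<And>t x y. t > 0 \<Longrightarrow> x \<in> unbounded_fractal F \<Longrightarrow> y \<in> unbounded_fractal F \<Longrightarrow>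
         g t x y = scaling F powr fractal_dim F *
           g (scaling F powr dw * t) (scaling F *\<^sub>R x) (scaling F *\<^sub>R y)"
    and density_bounds:
      "\<exists>K1>0. \<exists>K2>0. \<exists>K3>0. \<exists>K4>0. \<forall>t>0. \<forall>x\<in>unbounded_fractal F. \<forall>y\<in>unbounded_fractal F.
         K1 * t powr (- fractal_dim F / dw) *
           exp (- K2 * (norm (x - y) powr dw / t) powr (1 / (dJ - 1))) \<le> g t x y \<and>
         g t x y \<le> K3 * t powr (- fractal_dim F / dw) *
           exp (- K4 * (norm (x - y) powr dw / t) powr (1 / (dJ - 1)))"

text \<open>Transition densities take values in \<^typ>\<open>ennreal\<close>: infinite sums and integrals of nonnegative
  terms then always have their true value.\<close>

definition reflected_density ::
    "similitudes \<Rightarrow> (real \<Rightarrow> real^2 \<Rightarrow> real^2 \<Rightarrow> real) \<Rightarrow> int \<Rightarrow> real \<Rightarrow> real^2 \<Rightarrow> real^2 \<Rightarrow> ennreal" where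
  "reflected_density F g M t x y =
     (if y \<notin> vertices F M
      then \<Sum>\<^sub>\<infinity>y'\<in>proj_fiber F M y. ennreal (g t x y')
      else \<Sum>\<^sub>\<infinity>y'\<in>proj_fiber F M y. ennreal (g t x y') * of_nat (complex_rank F M y'))"


section \<open>Subordination\<close>

definition stable_subordinator_density :: "real \<Rightarrow> real \<Rightarrow> (real \<Rightarrow> real) \<Rightarrow> bool" where
  "stable_subordinator_density \<alpha> t h \<longleftrightarrow>
     h \<in> borel_measurable borel \<and> (\<forall>s>0. h s \<ge> 0) \<and>
     (\<forall>u>0. (\<integral>\<^sup>+s\<in>{0<..}. ennreal (exp (- u * s) * h s) \<partial>lborel) = ennreal (exp (- t * u powr \<alpha>)))"

definition stable_density ::
    "(real \<Rightarrow> real^2 \<Rightarrow> real^2 \<Rightarrow> real) \<Rightarrow> (real \<Rightarrow> real \<Rightarrow> real) \<Rightarrow>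
     real \<Rightarrow> real^2 \<Rightarrow> real^2 \<Rightarrow> ennreal" where
  "stable_density g \<eta> t x y = (\<integral>\<^sup>+s\<in>{0<..}. ennreal (g s x y) * ennreal (\<eta> t s) \<partial>lborel)"

definition reflected_stable_density ::
    "similitudes \<Rightarrow> (real \<Rightarrow> real^2 \<Rightarrow> real^2 \<Rightarrow> real) \<Rightarrow> (real \<Rightarrow> real \<Rightarrow> real) \<Rightarrow> int \<Rightarrow>
     real \<Rightarrow> real^2 \<Rightarrow> real^2 \<Rightarrow> ennreal" where
  "reflected_stable_density F g \<eta> M t x y =
     (\<integral>\<^sup>+s\<in>{0<..}. reflected_density F g M s x y * ennreal (\<eta> t s) \<partial>lborel)"

end

theory Submission
  imports Defs
begin

text \<open>Write \<open>T = L powr (M * dw)\<close>, the time scale of \<open>fractal F M\<close>, and \<open>\<delta> = d / dw\<close>. The reflected heat kernel at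
\<open>(s, x, y)\<close> sums the free kernel over the copies of \<open>y\<close>, one in each complex of level \<open>M\<close>. For \<open>s \<le> T\<close>
the sub-Gaussian decay makes the sum converge, and no copy of \<open>y\<close> is much closer to \<open>x\<close> than \<open>y\<close> itself,
because the projection is Lipschitz (\<open>projection_dist_le\<close>); so the sum keeps a sub-Gaussian upper bound.
For \<open>s \<ge> T\<close> about \<open>(s / T)\<close> to the power \<open>\<delta>\<close> complexes are within the diffusion range of \<open>x\<close> and each
contributes about \<open>s\<close> to the power \<open>- \<delta>\<close>, so the sum is of the order of \<open>T\<close> to the power \<open>- \<delta>\<close>
(\<open>reflected_density_upper\<close>, \<open>reflected_density_lower\<close>).

These estimates are integrated against the law of the subordinator \<open>S\<close> at time \<open>t\<close>, about which only the
Laplace transform is known. It yields tails, negative moments and the mass of windows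
(\<open>emeasure_tail_le\<close>, \<open>nn_integral_neg_powr_le\<close>, \<open>emeasure_window_ge\<close>). With
\<open>\<sigma> = max (norm (x - y) powr dw) (t powr (1 / \<alpha>))\<close>, the free and the reflected stable density are both of
the order of \<open>t * \<sigma> powr (- \<delta> - \<alpha>)\<close> when \<open>t < T powr \<alpha>\<close>; when \<open>t \<ge> T powr \<alpha>\<close>, the
subordinator exceeds \<open>T\<close> with probability bounded below, and the reflected density is of the order of
\<open>T powr (- \<delta>)\<close>.

The geometry rests on the fact that the common linear part \<open>U\<close> of the similitudes fixes the attractor
pointwise (\<open>U_id_on_K\<close>); without it the vectors of the complexes, which are formed without \<open>U\<close>, would
not fit the cells. A reflection exchanging two essential fixed points exchanges the unique cells
containing them, and comparing the centroids shows that \<open>U\<close> multiplies all differences of essential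
fixed points by one sign. If the sign were negative, each essential fixed point would separate the
connected attractor, and this is impossible for all points of a finite set. Afterwards complexes are
addressed by words, nesting extends to words of any length, and two complexes either meet or have a
distance of the order of their size, because complexes whose parents meet occur in finitely many
relative positions only (\<open>separation_words\<close>, \<open>meeting_words\<close>). A good labeling is transported to every
level by scaling, for which the barycenter has to scale as well (\<open>barycenter_scale\<close>), and the rotations
preserve the attractor because they are products of the reflections in the symmetry condition, as far as
their action on the attractor is concerned (\<open>isometry_image_K\<close>).\<close>

section \<open>Packing, the attractor and the cells at an essential fixed point\<close>

text \<open>The disjoint balls of radius \<open>\<rho> / 2\<close> around the points lie in a ball of radius \<open>R + \<rho> / 2\<close>; compare
areas.\<close>

lemma packing_bound:
  fixes p :: "real^2"
  assumes fin: "finite S" and S: "S \<subseteq> cball p R" and \<rho>: "\<rho> > 0" and R: "R \<ge> 0"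
    and sep: "\<And>x y. x \<in> S \<Longrightarrow> y \<in> S \<Longrightarrow> x \<noteq> y \<Longrightarrow> dist x y \<ge> \<rho>"
  shows "real (card S) \<le> (1 + 2 * R / \<rho>)\<^sup>2"
proof -
  let ?b = "\<lambda>x::real^2. ball x (\<rho>/2)"
  let ?c = "measure lebesgue (ball (0::real^2) 1)"
  have c0: "?c > 0" by (simp add: content_ball_pos)
  have disj: "disjoint_family_on ?b S"
    unfolding disjoint_family_on_def
  proof (intro ballI impI)
    fix x y assume xy: "x \<in> S" "y \<in> S" "x \<noteq> y"
    show "?b x \<inter> ?b y = {}"
    proof (rule ccontr)
      assume "?b x \<inter> ?b y \<noteq> {}"
      then obtain z where "dist x z < \<rho>/2" "dist y z < \<rho>/2" by auto
      then have "dist x y < \<rho>" by (metis dist_commute dist_triangle_half_l)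
      with sep[OF xy] show False by simp
    qed
  qed
  have "real (card S) * ((\<rho>/2)^2 * ?c) = (\<Sum>x\<in>S. measure lebesgue (?b x))"
    using \<rho> by (simp add: content_ball_conv_unit_ball[of "\<rho>/2"])
  also have "\<dots> = measure lebesgue (\<Union>x\<in>S. ?b x)"
    by (rule measure_finite_Union[symmetric]) (use fin disj fmeasurableD2[OF lmeasurable_ball] in \<open>auto simp del: emeasure_completion\<close>)
  also have "\<dots> \<le> measure lebesgue (ball p (R + \<rho>/2))"
  proof (rule measure_mono_fmeasurable)
    show "(\<Union>x\<in>S. ?b x) \<subseteq> ball p (R + \<rho>/2)"
    proof
      fix z assume "z \<in> (\<Union>x\<in>S. ?b x)"
      then obtain x where "x \<in> S" "dist x z < \<rho>/2" by auto
      moreover have "dist p x \<le> R" using S \<open>x \<in> S\<close> by auto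
      ultimately show "z \<in> ball p (R + \<rho>/2)"
        using dist_triangle[of p z x] by auto
    qed
  qed (auto intro: fin)
  also have "\<dots> = (R + \<rho>/2)^2 * ?c"
    using \<rho> R by (simp add: content_ball_conv_unit_ball[of "R + \<rho>/2"])
  finally have "real (card S) * (\<rho>/2)^2 \<le> (R + \<rho>/2)^2"
    using c0 by (simp add: mult.assoc[symmetric])
  then have "real (card S) \<le> (R + \<rho>/2)^2 / (\<rho>/2)^2"
    using \<rho> by (simp add: field_simps)
  also have "\<dots> = (1 + 2 * R / \<rho>)\<^sup>2"
    proof -
    have "(R + \<rho>/2) / (\<rho>/2) = 1 + 2 * R / \<rho>" using \<rho> by (simp add: field_simps)
    then show ?thesis by (metis power_divide)
  qed
  finally show ?thesis .
qed

context simple_nested_fractal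
begin

abbreviation "L \<equiv> scaling F"
abbreviation "U \<equiv> isom F"
abbreviation "\<Psi> \<equiv> simil F"
abbreviation "V \<equiv> essential_fixed_points F"
abbreviation "K \<equiv> fractal0 F"

definition "I = {1..num_maps F}"

lemma finite_I: "finite I" by (simp add: I_def)

lemma nesting_I:
  "i \<in> I \<Longrightarrow> j \<in> I \<Longrightarrow> i \<noteq> j \<Longrightarrow> \<Psi> i ` K \<inter> \<Psi> j ` K = \<Psi> i ` V \<inter> \<Psi> j ` V"
  using nesting by (simp add: I_def)

lemma L_pos: "L > 0" "L \<noteq> 0" using scaling by auto

lemma linear_U: "linear U" using isometry orthogonal_transformation_linear by blast

lemma norm_U: "norm (U x) = norm x" using isometry orthogonal_transformation_norm by blast

lemma simil_diff: "\<Psi> i x - \<Psi> i y = (1/L) *\<^sub>R U (x - y)"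
  by (simp add: simil_def linear_diff[OF linear_U] scaleR_diff_right)

lemma dist_simil: "dist (\<Psi> i x) (\<Psi> i y) = dist x y / L"
  using L_pos by (simp add: dist_norm simil_diff norm_U)

lemma inj_simil: "inj (\<Psi> i)"
  by (rule injI) (metis dist_simil L_pos(2) dist_eq_0_iff divide_eq_0_iff)

lemma simil_eq_iff: "\<Psi> i x = \<Psi> i y \<longleftrightarrow> x = y"
  using inj_simil by (auto dest: injD)

lemma surj_simil: "surj (\<Psi> k)"
  unfolding surj_def
proof
  fix y
  have "surj U" using isometry orthogonal_transformation_surj by blast
  then obtain x where "U x = L *\<^sub>R (y - transl F k)" by (metis surjD)
  then show "\<exists>x. y = \<Psi> k x" using L_pos by (intro exI[of _ x]) (simp add: simil_def)
qed

lemma continuous_simil: "continuous_on A (\<Psi> i)"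
  unfolding simil_def
  using linear_continuous_on[OF linear_conv_bounded_linear[THEN iffD1, OF linear_U]]
  by (intro continuous_intros) auto

lemma finite_V: "finite V" and V_nonempty: "V \<noteq> {}"
  using card_essential card_gt_0_iff[of V] by auto

lemma V_fixed: assumes "p \<in> V" obtains a where "a \<in> I" "\<Psi> a p = p"
  using assms unfolding essential_fixed_points_def fixed_points_def I_def by auto

lemma I_nonempty: "I \<noteq> {}"
  using V_nonempty V_fixed by (metis all_not_in_conv)

lemma one_in_I: "1 \<in> I" using I_nonempty by (auto simp: I_def)

text \<open>Iterating the inclusion \<open>n\<close> times places every point of \<open>X\<close> within a constant times \<open>1 / L ^ n\<close> of \<open>K'\<close>.\<close>

lemma bounded_subinvariant_subset:
  assumes K: "compact K'" "K' \<noteq> {}" "(\<Union>i\<in>I. \<Psi> i ` K') \<subseteq> K'"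
    and X: "bounded X" "X \<subseteq> (\<Union>i\<in>I. \<Psi> i ` X)"
  shows "X \<subseteq> K'"
proof
  fix x0 assume x0: "x0 \<in> X"
  obtain k0 where k0: "k0 \<in> K'" using K by auto
  obtain B where B: "\<And>x. x \<in> X \<Longrightarrow> dist k0 x \<le> B"
    using X(1) by (metis bounded_any_center)
  have step: "\<exists>k\<in>K'. dist x k \<le> B / L ^ n" if "x \<in> X" for x n
    using that
  proof (induction n arbitrary: x)
    case 0 then show ?case using B k0 by (metis dist_commute div_by_1 power_0)
  next
    case (Suc n)
    then obtain i y where iy: "i \<in> I" "y \<in> X" "x = \<Psi> i y" using X(2) by blast
    obtain k where k: "k \<in> K'" "dist y k \<le> B / L^n" using Suc.IH[OF iy(2)] by auto
    have "\<Psi> i k \<in> K'" using K(3) iy k by blast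
    moreover have "dist x (\<Psi> i k) \<le> B / L ^ Suc n"
      using k(2) L_pos by (simp add: iy dist_simil field_simps)
    ultimately show ?case by blast
  qed
  have "x0 \<in> closure K'"
  proof (unfold closure_approachable, intro allI impI)
    fix e :: real assume e: "e > 0"
    have "(\<lambda>n. B / L ^ n) \<longlonglongrightarrow> 0"
      using scaling by (intro LIMSEQ_divide_realpow_zero)
    then have "eventually (\<lambda>n. B / L ^ n < e) sequentially"
      using e by (simp add: order_tendsto_iff)
    then obtain n where "B / L ^ n < e" by (auto simp: eventually_sequentially)
    with step[OF x0, of n] show "\<exists>y\<in>K'. dist y x0 < e"
      by (metis dist_commute le_less_trans)
  qed
  then show "x0 \<in> K'" using K(1) compact_imp_closed closure_closed by auto
qed

text \<open>The attractor is the intersection of the iterated images of a ball that all the maps send into itself.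
A point of all these images lies infinitely often in the image under one and the same map, and the
images decrease.\<close>

lemma attractor_exists: "\<exists>K'. compact K' \<and> K' \<noteq> {} \<and> K' = (\<Union>i\<in>I. \<Psi> i ` K')"
proof -
  define \<Phi> where "\<Phi> X = (\<Union>i\<in>I. \<Psi> i ` X)" for X
  define m where "m = Max ((\<lambda>i. norm (\<Psi> i 0)) ` I)"
  define R where "R = m * L / (L - 1)"
  have m: "norm (\<Psi> i 0) \<le> m" if "i \<in> I" for i unfolding m_def using that finite_I by auto
  have m0: "m \<ge> 0" using m[OF one_in_I] norm_ge_zero order_trans by blast
  have R0: "R \<ge> 0" unfolding R_def using m0 scaling by auto
  have mR: "m + R / L = R"
    unfolding R_def using scaling by (simp add: field_simps)
  have ball: "\<Phi> (cball 0 R) \<subseteq> cball 0 R"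
  proof -
    have "norm (\<Psi> i x) \<le> R" if "i \<in> I" "norm x \<le> R" for i x
    proof -
      have "norm (\<Psi> i x) \<le> norm (\<Psi> i 0) + dist (\<Psi> i x) (\<Psi> i 0)"
        by (simp add: dist_norm norm_triangle_sub add.commute)
      also have "\<dots> \<le> m + R / L"
        using m[OF that(1)] that(2) L_pos by (simp add: dist_simil divide_right_mono add_mono)
      finally show ?thesis using mR by simp
    qed
    then show ?thesis unfolding \<Phi>_def by (auto simp: dist_norm)
  qed
  define B where "B n = (\<Phi> ^^ n) (cball 0 R)" for n
  have B_Suc: "B (Suc n) = \<Phi> (B n)" for n by (simp add: B_def)
  have mono: "\<Phi> X \<subseteq> \<Phi> Y" if "X \<subseteq> Y" for X Y using that unfolding \<Phi>_def by blast
  have decr1: "B (Suc n) \<subseteq> B n" for n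
    by (induction n) (use ball mono in \<open>auto simp: B_def\<close>)
  have decr: "B n \<subseteq> B m" if "m \<le> n" for m n
    using decr1 that by (rule lift_Suc_antimono_le)
  have comp: "compact (B n)" for n
    by (induction n) (auto simp: B_def \<Phi>_def intro!: compact_UN compact_continuous_image continuous_simil finite_I)
  have ne: "B n \<noteq> {}" for n
    by (induction n) (use R0 I_nonempty in \<open>auto simp: B_def \<Phi>_def\<close>)
  define A where "A = (\<Inter>n. B n)"
  have "A \<noteq> {}" unfolding A_def
    by (rule compact_nest) (use comp ne decr in auto)
  moreover have "compact A" unfolding A_def
    by (rule compact_Inter) (use comp in auto)
  moreover have "A = \<Phi> A"
  proof
    show "\<Phi> A \<subseteq> A" unfolding A_def
    proof (rule INT_greatest)
      fix n have "\<Phi> (\<Inter>n. B n) \<subseteq> \<Phi> (B n)" by (rule mono) auto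
      also have "\<dots> \<subseteq> B n" using decr1 B_Suc by auto
      finally show "\<Phi> (\<Inter>n. B n) \<subseteq> B n" .
    qed
    show "A \<subseteq> \<Phi> A"
    proof
      fix x assume x: "x \<in> A"
      have "\<exists>i\<in>I. x \<in> \<Psi> i ` B n" for n
        using x B_Suc[of n] unfolding A_def \<Phi>_def by blast
      then obtain f where f: "\<And>n. f n \<in> I \<and> x \<in> \<Psi> (f n) ` B n" by metis
      have "\<exists>i\<in>I. infinite {n \<in> (UNIV::nat set). f n = i}"
        by (rule pigeonhole_infinite_rel) (use f finite_I in auto)
      then obtain i where i: "i \<in> I" "infinite {n. f n = i}" by auto
      have all: "x \<in> \<Psi> i ` B n" for n
      proof -
        obtain k where "k \<ge> n" "f k = i" using i(2) unfolding infinite_nat_iff_unbounded_le by blast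
        then show ?thesis using f[of k] decr[of n k] by blast
      qed
      then obtain z where z: "\<Psi> i z = x" by blast
      have "z \<in> B n" for n using all[of n] z simil_eq_iff by auto
      then show "x \<in> \<Phi> A" unfolding A_def \<Phi>_def using i(1) z by blast
    qed
  qed
  ultimately show ?thesis unfolding \<Phi>_def by blast
qed

lemma attractor_K: "compact K" "K \<noteq> {}" "K = (\<Union>i\<in>I. \<Psi> i ` K)"
proof -
  let ?P = "\<lambda>K'. compact K' \<and> K' \<noteq> {} \<and> K' = (\<Union>i\<in>I. \<Psi> i ` K')"
  have "\<exists>!K'. ?P K'"
  proof (rule ex_ex1I[OF attractor_exists])
    fix A B assume AB: "?P A" "?P B"
    have "A \<subseteq> B" by (rule bounded_subinvariant_subset) (use AB compact_imp_bounded in auto)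
    moreover have "B \<subseteq> A" by (rule bounded_subinvariant_subset) (use AB compact_imp_bounded in auto)
    ultimately show "A = B" by auto
  qed
  from theI'[OF this] show "compact K" "K \<noteq> {}" "K = (\<Union>i\<in>I. \<Psi> i ` K)"
    unfolding fractal0_def I_def by auto
qed

lemma subinvariant_subset_K: "bounded X \<Longrightarrow> X \<subseteq> (\<Union>i\<in>I. \<Psi> i ` X) \<Longrightarrow> X \<subseteq> K"
  using bounded_subinvariant_subset[of K X] attractor_K by blast

lemma simil_in_K: "i \<in> I \<Longrightarrow> x \<in> K \<Longrightarrow> \<Psi> i x \<in> K" using attractor_K(3) by blast

lemma in_K_cases: assumes "x \<in> K" obtains i k where "i \<in> I" "k \<in> K" "x = \<Psi> i k"
  using assms attractor_K(3) by blast

lemma fixed_in_K: assumes "i \<in> I" "\<Psi> i x = x" shows "x \<in> K"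
proof -
  have "x \<in> \<Psi> i ` {x}" using assms(2) by force
  then have "{x} \<subseteq> K" using assms(1) by (intro subinvariant_subset_K) blast+
  then show ?thesis by simp
qed

lemma V_subset_K: "V \<subseteq> K"
proof
  fix p assume "p \<in> V"
  then obtain a where "a \<in> I" "\<Psi> a p = p" by (rule V_fixed)
  then show "p \<in> K" by (rule fixed_in_K)
qed

lemma osc:
  obtains W where "open W" "W \<noteq> {}"
    "\<forall>i\<in>I. \<forall>j\<in>I. i \<noteq> j \<longrightarrow> \<Psi> i ` W \<inter> \<Psi> j ` W = {}" "\<forall>i\<in>I. \<Psi> i ` W \<subseteq> W"
proof -
  obtain W where W: "open W" "W \<noteq> {}"
    "\<forall>i\<in>I. \<forall>j\<in>I. i \<noteq> j \<longrightarrow> \<Psi> i ` W \<inter> \<Psi> j ` W = {}" "(\<Union>i\<in>I. \<Psi> i ` W) \<subseteq> W"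
    using open_set_condition unfolding I_def[symmetric] by (elim exE conjE)
  have "\<forall>i\<in>I. \<Psi> i ` W \<subseteq> W" using W(4) by blast
  then show thesis by (rule that[OF W(1-3)])
qed

lemma simil_pow_diff_norm: "dist ((\<Psi> i ^^ n) x) ((\<Psi> i ^^ n) y) = dist x y / L ^ n"
  by (induction n) (use L_pos in \<open>auto simp: dist_simil field_simps\<close>)

text \<open>If a second cell contained \<open>p\<close>, nesting would give \<open>p = \<Psi> b q\<close> with \<open>q\<close> fixed by some \<open>\<Psi> c\<close>, and \<open>p\<close>
would lie in the \<open>n + 1\<close> cells with addresses \<open>a\<^sup>i b c\<^sup>n\<^sup>-\<^sup>i\<close>, all of the same size. The open set condition
leaves room for boundedly many of them.\<close>

lemma vertex_unique_cell:
  assumes p: "p \<in> V" "a \<in> I" "\<Psi> a p = p" and b: "b \<in> I" "p \<in> \<Psi> b ` K"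
  shows "b = a"
proof (rule ccontr)
  assume ne: "b \<noteq> a"
  have pK: "p \<in> K" using p(1) V_subset_K by blast
  then have "p \<in> \<Psi> a ` K" using p(3) by (metis imageI)
  then have "p \<in> \<Psi> b ` V" using nesting_I[OF p(2) b(1)] b ne by blast
  then obtain q where q: "q \<in> V" "p = \<Psi> b q" by auto
  obtain c where c: "c \<in> I" "\<Psi> c q = q" using V_fixed[OF q(1)] .
  obtain O' where O: "open O'" "O' \<noteq> {}"
    and disj: "\<forall>i\<in>I. \<forall>j\<in>I. i \<noteq> j \<longrightarrow> \<Psi> i ` O' \<inter> \<Psi> j ` O' = {}"
    and inv: "\<forall>i\<in>I. \<Psi> i ` O' \<subseteq> O'" by (rule osc)
  obtain z \<rho> where z: "\<rho> > 0" "ball z \<rho> \<subseteq> O'" using O open_contains_ball by blast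
  have pow: "(\<Psi> i ^^ n) x \<in> O'" if "i \<in> I" "x \<in> O'" for i n x
    using that inv by (induction n) (auto 4 4)
  have powa: "(\<Psi> a ^^ n) p = p" for n by (induction n) (use p in auto)
  have powc: "(\<Psi> c ^^ n) q = q" for n by (induction n) (use c in auto)
  define R where "R = dist z q"
  have bound: "real (Suc n) \<le> (1 + 2 * R / \<rho>)\<^sup>2" for n
  proof -
    \<comment> \<open>the map of the cell with address \<open>a\<^sup>i b c\<^sup>n\<^sup>-\<^sup>i\<close>; it sends \<open>q\<close> to \<open>p\<close>\<close>
    define f where "f i x = (\<Psi> a ^^ i) (\<Psi> b ((\<Psi> c ^^ (n - i)) x))" for i x
    have dist_f: "dist (f i x) (f i y) = dist x y / L ^ Suc n" if "i \<le> n" for i x y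
    proof -
      have "L ^ n = L ^ i * L ^ (n - i)" using that by (simp add: power_add[symmetric])
      then show ?thesis using L_pos
        by (simp add: f_def simil_pow_diff_norm dist_simil field_simps)
    qed
    have fq: "f i q = p" for i by (simp add: f_def powc q(2)[symmetric] powa)
    have fsep: "f i x \<noteq> f j y" if "i < j" "j \<le> n" "x \<in> O'" "y \<in> O'" for i j x y
    proof
      assume eq: "f i x = f j y"
      have "f j y = (\<Psi> a ^^ i) (\<Psi> a ((\<Psi> a ^^ (j - i - 1)) (\<Psi> b ((\<Psi> c ^^ (n - j)) y))))"
      proof -
        have "j = i + Suc (j - i - 1)" using that by simp
        then have "\<Psi> a ^^ j = (\<Psi> a ^^ i) \<circ> (\<Psi> a \<circ> (\<Psi> a ^^ (j - i - 1)))"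
          by (metis funpow_add funpow.simps(2))
        then show ?thesis by (simp add: f_def)
      qed
      moreover have "inj (\<Psi> a ^^ i)" using inj_simil inj_fn by blast
      ultimately have "\<Psi> b ((\<Psi> c ^^ (n - i)) x) = \<Psi> a ((\<Psi> a ^^ (j - i - 1)) (\<Psi> b ((\<Psi> c ^^ (n - j)) y)))"
        using eq unfolding f_def by (auto dest: injD)
      moreover have "(\<Psi> c ^^ (n - i)) x \<in> O'" "(\<Psi> a ^^ (j - i - 1)) (\<Psi> b ((\<Psi> c ^^ (n - j)) y)) \<in> O'"
        using pow inv that c p b by (blast+)
      ultimately show False using disj[rule_format, OF b(1) p(2) ne] by blast
    qed
    have zO: "z \<in> O'" using z by auto
    define S where "S = (\<lambda>i. f i z) ` {..n}"
    have injf: "inj_on (\<lambda>i. f i z) {..n}"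
      by (rule linorder_inj_onI) (use fsep zO in auto)
    have sep1: "dist (f i z) (f j z) \<ge> \<rho> / L ^ Suc n" if "i < j" "j \<le> n" for i j
    proof (rule ccontr)
      assume "\<not> ?thesis"
      then have lt: "dist (f i z) (f j z) < \<rho> / L ^ Suc n" by simp
      have "f i = (\<Psi> a ^^ i) \<circ> \<Psi> b \<circ> (\<Psi> c ^^ (n - i))" by (auto simp: f_def fun_eq_iff)
      moreover have "surj ((\<Psi> a ^^ i) \<circ> \<Psi> b \<circ> (\<Psi> c ^^ (n - i)))"
        by (intro comp_surj surj_fn surj_simil)
      ultimately have "surj (f i)" by (simp only:)
      then obtain x where x: "f i x = f j z" by (metis surjD)
      have "dist z x < \<rho>" using lt dist_f[of i z x] that x L_pos
        by (simp add: divide_less_cancel)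
      then have "x \<in> O'" using z by auto
      then show False using fsep[OF that _ zO] x by blast
    qed
    have "real (card S) \<le> (1 + 2 * (R / L ^ Suc n) / (\<rho> / L ^ Suc n))\<^sup>2"
    proof (rule packing_bound)
      show "finite S" by (simp add: S_def)
      show "S \<subseteq> cball p (R / L ^ Suc n)"
      proof
        fix x assume "x \<in> S"
        then obtain i where i: "x = f i z" "i \<le> n" by (auto simp: S_def)
        have "dist p x = R / L ^ Suc n"
          using dist_f[OF i(2), of z q] unfolding fq i(1) R_def by (simp add: dist_commute)
        then show "x \<in> cball p (R / L ^ Suc n)" by simp
      qed
      show "dist x y \<ge> \<rho> / L ^ Suc n" if "x \<in> S" "y \<in> S" "x \<noteq> y" for x y
      proof -
        note xy = that
        obtain i j where ij: "x = f i z" "y = f j z" "i \<le> n" "j \<le> n"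
          using xy(1,2) unfolding S_def by blast
        then have "i < j \<or> j < i" using xy(3) by (metis linorder_neqE_nat)
        then show ?thesis using ij sep1 by (metis dist_commute)
      qed
    qed (use z L_pos R_def in auto)
    moreover have "card S = Suc n" unfolding S_def using card_image[OF injf] by simp
    moreover have "(R / L ^ Suc n) / (\<rho> / L ^ Suc n) = R / \<rho>" using L_pos by simp
    ultimately show ?thesis
      by (metis times_divide_eq_right)
  qed
  obtain n :: nat where "(1 + 2 * R / \<rho>)\<^sup>2 < real n" using reals_Archimedean2 by blast
  with bound[of n] show False by simp
qed

lemma vertex_in_cell:
  assumes "p \<in> V" "a \<in> I" "\<Psi> a p = p" "b \<in> I" "k \<in> K" "\<Psi> b k = p"
  shows "b = a" "k = p"
proof -
  have "p \<in> \<Psi> b ` K" using assms(5) assms(6)[symmetric] by (rule rev_image_eqI)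
  then show ba: "b = a" by (rule vertex_unique_cell[OF assms(1-4)])
  show "k = p" using assms(3,6) simil_eq_iff[of a k p] unfolding ba by simp
qed

end

section \<open>Reflections and the linear part of the similitudes\<close>

text \<open>Affine maps send centroids to centroids, so the common image of \<open>V\<close> determines the value at the centroid
of \<open>V\<close>.\<close>

lemma sum_image_affine_eq:
  fixes f g :: "'a::real_vector \<Rightarrow> 'a"
  assumes V: "finite V" "V \<noteq> {}" and inj: "inj_on f V" "inj_on g V" and eq: "f ` V = g ` V"
    and f: "\<And>x. f x = A x + a" "linear A" and g: "\<And>x. g x = B x + b" "linear B"
  shows "f ((1 / real (card V)) *\<^sub>R \<Sum>V) = g ((1 / real (card V)) *\<^sub>R \<Sum>V)"
proof -
  let ?n = "real (card V)"
  have n: "?n > 0" using V by (simp add: card_gt_0_iff)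
  have *: "h ((1 / ?n) *\<^sub>R \<Sum>V) = (1 / ?n) *\<^sub>R \<Sum>(h ` V)"
    if "inj_on h V" "\<And>x. h x = C x + c" "linear C" for h C c
  proof -
    have "\<Sum>(h ` V) = (\<Sum>x\<in>V. h x)" using that(1) by (simp add: sum.reindex)
    also have "\<dots> = (\<Sum>x\<in>V. C x + c)" by (simp add: that(2))
    also have "\<dots> = C (\<Sum>V) + ?n *\<^sub>R c"
      by (simp add: sum.distrib linear_sum[OF that(3)] sum_constant_scaleR)
    finally show ?thesis using n that(2)
      by (simp add: linear_scale[OF that(3)] scaleR_add_right)
  qed
  show ?thesis using *[OF inj(1) f] *[OF inj(2) g] eq by simp
qed

text \<open>Reflection in the line through the origin orthogonal to \<open>d\<close>; for \<open>d = y - x\<close> it is the linear part of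
\<open>bisector_reflection x y\<close>.\<close>

definition refl_lin :: "real^2 \<Rightarrow> real^2 \<Rightarrow> real^2" where
  "refl_lin d z = z - (2 * (z \<bullet> d) / (norm d)\<^sup>2) *\<^sub>R d"

lemma bisector_reflection_diff:
  "bisector_reflection x y u - bisector_reflection x y v = refl_lin (y - x) (u - v)"
proof -
  have "2 * ((u - midpoint x y) \<bullet> (y - x)) / (norm (y - x))\<^sup>2
      - 2 * ((v - midpoint x y) \<bullet> (y - x)) / (norm (y - x))\<^sup>2
      = 2 * ((u - v) \<bullet> (y - x)) / (norm (y - x))\<^sup>2"
    by (simp add: diff_divide_distrib[symmetric] algebra_simps inner_diff_left)
  then show ?thesis
    unfolding bisector_reflection_def refl_lin_def
    by (smt (verit) add_diff_eq diff_add_eq diff_diff_add diff_diff_eq2 scaleR_diff_left add.commute)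
qed

lemma linear_refl_lin: "linear (refl_lin d)"
  by (rule linearI) (auto simp: refl_lin_def algebra_simps inner_add_left add_divide_distrib scaleR_add_left)

lemma norm_refl_lin: "norm (refl_lin d z) = norm z"
proof (cases "d = 0")
  case False
  define c where "c = z \<bullet> d / (norm d)\<^sup>2"
  have nd: "(norm d)\<^sup>2 \<noteq> 0" using False by simp
  have zd: "z \<bullet> d = c * (norm d)\<^sup>2" using nd by (simp add: c_def)
  have "refl_lin d z = z - (2 * c) *\<^sub>R d" by (simp add: refl_lin_def c_def)
  then have "(norm (refl_lin d z))\<^sup>2 = (z - (2 * c) *\<^sub>R d) \<bullet> (z - (2 * c) *\<^sub>R d)"
    by (simp add: power2_norm_eq_inner)
  also have "\<dots> = z \<bullet> z - 2 * (2 * c) * (z \<bullet> d) + (2 * c)\<^sup>2 * (d \<bullet> d)"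
    by (simp add: inner_diff_left inner_diff_right inner_commute power2_eq_square algebra_simps)
  also have "\<dots> = z \<bullet> z" using zd unfolding power2_norm_eq_inner by (simp add: power2_eq_square)
  finally show ?thesis by (metis norm_ge_zero power2_eq_iff_nonneg power2_norm_eq_inner)
qed (simp add: refl_lin_def)

lemma norm_minus_midpoint_inner:
  fixes x y z :: "'a::real_inner"
  shows "(norm (z - x))\<^sup>2 - (norm (z - y))\<^sup>2 = 2 * ((z - midpoint x y) \<bullet> (y - x))"
  by (simp add: power2_norm_eq_inner midpoint_def inner_diff_left inner_diff_right inner_add_left
      inner_add_right inner_commute algebra_simps)

lemma bisector_reflection_fixed:
  assumes "norm (z - x) = norm (z - y)"
  shows "bisector_reflection x y z = z"
  using norm_minus_midpoint_inner[of z x y] assms by (simp add: bisector_reflection_def)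

lemma bisector_reflection_swap:
  assumes "x \<noteq> y"
  shows "bisector_reflection x y x = y" "bisector_reflection x y y = x"
proof -
  have n: "(norm (y - x))\<^sup>2 \<noteq> 0" using assms by simp
  have "2 * ((x - midpoint x y) \<bullet> (y - x)) = - (norm (y - x))\<^sup>2"
    using norm_minus_midpoint_inner[of x x y] by (simp add: norm_minus_commute)
  then show "bisector_reflection x y x = y" using n by (simp add: bisector_reflection_def)
  have "2 * ((y - midpoint x y) \<bullet> (y - x)) = (norm (y - x))\<^sup>2"
    using norm_minus_midpoint_inner[of y x y] by simp
  then show "bisector_reflection x y y = x" using n by (simp add: bisector_reflection_def)
qed

lemma bisector_reflection_shift:
  assumes "(z - x) \<bullet> (y - x) = 0" "x \<noteq> y"
  shows "bisector_reflection x y z = z + (y - x)"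
proof -
  have "bisector_reflection x y z - bisector_reflection x y x = refl_lin (y - x) (z - x)"
    by (rule bisector_reflection_diff)
  also have "\<dots> = z - x" using assms by (simp add: refl_lin_def)
  finally show ?thesis using bisector_reflection_swap(1)[OF assms(2)] by (simp add: algebra_simps)
qed

lemma bisector_reflection_affine:
  "bisector_reflection x y z = refl_lin (y - x) z + bisector_reflection x y 0"
  using bisector_reflection_diff[of x y z 0] by (simp add: algebra_simps)

lemma continuous_bisector_reflection: "continuous_on A (bisector_reflection x y)"
proof (rule continuous_on_eq)
  have "continuous_on A (refl_lin (y - x))"
    using linear_refl_lin linear_continuous_on linear_conv_bounded_linear by blast
  then show "continuous_on A (\<lambda>z. refl_lin (y - x) z + bisector_reflection x y 0)"
    by (intro continuous_intros)
qed (rule bisector_reflection_affine[symmetric])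

lemma inj_bisector_reflection: "inj (bisector_reflection x y)"
proof (rule injI)
  fix u v assume "bisector_reflection x y u = bisector_reflection x y v"
  then have "refl_lin (y - x) (u - v) = 0" using bisector_reflection_diff[of x y u v] by simp
  then show "u = v" using norm_refl_lin[of "y - x" "u - v"] by simp
qed

context simple_nested_fractal
begin

definition "centroid = (1 / real (card V)) *\<^sub>R \<Sum>V"

lemma symmetry_I:
  assumes "i \<in> I" "x \<in> V" "y \<in> V" "x \<noteq> y"
  obtains j where "j \<in> I" "bisector_reflection x y ` \<Psi> i ` V = \<Psi> j ` V"
  using symmetry assms unfolding I_def by blast

lemma simil_affine: "\<Psi> i x = (1/L) *\<^sub>R U x + transl F i"
  by (simp add: simil_def)

lemma linear_scaled_U: "linear (\<lambda>x. (1/L) *\<^sub>R U x)"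
  using linear_U by (rule linear_compose_scale_right)

lemma reflection_centroid:
  assumes "bisector_reflection x y ` \<Psi> i ` V = \<Psi> j ` V"
  shows "bisector_reflection x y (\<Psi> i centroid) = \<Psi> j centroid"
  unfolding centroid_def
proof (rule sum_image_affine_eq[where f = "\<lambda>z. bisector_reflection x y (\<Psi> i z)" and g = "\<Psi> j"])
  show "inj_on (\<lambda>z. bisector_reflection x y (\<Psi> i z)) V"
    using inj_compose[OF inj_bisector_reflection inj_simil, of x y i] by (auto simp: comp_def intro: inj_on_subset)
  show "inj_on (\<Psi> j) V" using inj_simil inj_on_subset by blast
  show "(\<lambda>z. bisector_reflection x y (\<Psi> i z)) ` V = \<Psi> j ` V" using assms by (simp add: image_image)
  show "linear (\<lambda>z. refl_lin (y - x) ((1/L) *\<^sub>R U z))"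
    using linear_compose[OF linear_scaled_U linear_refl_lin] by (simp add: comp_def)
  show "bisector_reflection x y (\<Psi> i z)
      = refl_lin (y - x) ((1/L) *\<^sub>R U z) + (refl_lin (y - x) (transl F i) + bisector_reflection x y 0)" for z
    using linear_add[OF linear_refl_lin]
    by (subst bisector_reflection_affine) (simp add: simil_affine add.assoc)
qed (use finite_V V_nonempty linear_scaled_U in \<open>auto simp: simil_affine\<close>)

text \<open>The reflection exchanges \<open>p\<close> and \<open>q\<close>. Each of them lies in a single cell, so these two cells and their
centroids are exchanged as well.\<close>

lemma refl_cell_centroid:
  assumes "p \<in> V" "q \<in> V" "p \<noteq> q"
  shows "refl_lin (q - p) (U (centroid - p)) = U (centroid - q)"
proof -
  obtain a where a: "a \<in> I" "\<Psi> a p = p" using V_fixed[OF assms(1)] .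
  obtain e where e: "e \<in> I" "\<Psi> e q = q" using V_fixed[OF assms(2)] .
  let ?S = "bisector_reflection p q"
  obtain j where j: "j \<in> I" "?S ` \<Psi> a ` V = \<Psi> j ` V" using symmetry_I[OF a(1) assms] .
  have "q = ?S (\<Psi> a p)" using a bisector_reflection_swap(1)[OF assms(3)] by simp
  then have "q \<in> \<Psi> j ` V" using j(2) assms(1) by blast
  then have "q \<in> \<Psi> j ` K" using V_subset_K by blast
  then have je: "j = e" using vertex_unique_cell[OF assms(2) e j(1)] by simp
  have "?S (\<Psi> a centroid) = \<Psi> e centroid" using reflection_centroid[OF j(2)] je by simp
  then have "?S (\<Psi> a centroid) - ?S (\<Psi> a p) = \<Psi> e centroid - \<Psi> e q"
    using a e bisector_reflection_swap(1)[OF assms(3)] by simp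
  then have "refl_lin (q - p) ((1/L) *\<^sub>R U (centroid - p)) = (1/L) *\<^sub>R U (centroid - q)"
    by (simp only: bisector_reflection_diff simil_diff)
  then show ?thesis using L_pos by (simp add: linear_scale[OF linear_refl_lin])
qed

lemma norm_centroid_vertex:
  assumes "p \<in> V" "q \<in> V" shows "norm (centroid - p) = norm (centroid - q)"
  using refl_cell_centroid[OF assms] norm_refl_lin norm_U by (cases "p = q") metis+

text \<open>By \<open>refl_cell_centroid\<close>, \<open>U (q - p)\<close> is the difference of a vector and its mirror image, hence a multiple
of \<open>q - p\<close>; and \<open>U\<close> preserves lengths.\<close>

lemma U_vertex_diff_cases:
  assumes "p \<in> V" "q \<in> V" shows "U (q - p) = q - p \<or> U (q - p) = - (q - p)"
proof (cases "p = q")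
  case True then show ?thesis using linear_0[OF linear_U] by simp
next
  case False
  let ?d = "q - p"
  define c where "c = 2 * (U (centroid - p) \<bullet> ?d) / (norm ?d)\<^sup>2"
  have "U (centroid - q) = U (centroid - p) - c *\<^sub>R ?d"
    using refl_cell_centroid[OF assms False] by (simp add: refl_lin_def c_def)
  moreover have "U (centroid - q) = U (centroid - p) - U ?d"
    using linear_diff[OF linear_U, of "centroid - p" ?d] by simp
  ultimately have Ud: "U ?d = c *\<^sub>R ?d" by simp
  then have "\<bar>c\<bar> * norm ?d = norm ?d" using norm_U[of ?d] by simp
  then have "c = 1 \<or> c = -1" using False by (auto simp: abs_if split: if_splits)
  then show ?thesis using Ud by auto
qed

text \<open>Two sides of a triangle with different signs would leave no sign for the third side.\<close>

lemma U_sign: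
  obtains \<epsilon> :: real where "\<epsilon> = 1 \<or> \<epsilon> = -1" "\<forall>p\<in>V. \<forall>q\<in>V. U (q - p) = \<epsilon> *\<^sub>R (q - p)"
proof -
  obtain p0 q0 where pq: "p0 \<in> V" "q0 \<in> V" "p0 \<noteq> q0"
    using card_essential finite_V
    by (metis card_le_Suc0_iff_eq not_less_eq_eq numeral_2_eq_2)
  obtain \<epsilon> :: real where e: "\<epsilon> = 1 \<or> \<epsilon> = -1" "U (q0 - p0) = \<epsilon> *\<^sub>R (q0 - p0)"
    using U_vertex_diff_cases[OF pq(1,2)] by (metis scaleR_minus1_left scaleR_one)
  have *: "U (p - p0) = \<epsilon> *\<^sub>R (p - p0)" if p: "p \<in> V" for p
  proof -
    obtain l :: real where l: "l = 1 \<or> l = -1" "U (p - p0) = l *\<^sub>R (p - p0)"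
      using U_vertex_diff_cases[OF pq(1) p] by (metis scaleR_minus1_left scaleR_one)
    obtain m :: real where m: "m = 1 \<or> m = -1" "U (p - q0) = m *\<^sub>R (p - q0)"
      using U_vertex_diff_cases[OF pq(2) p] by (metis scaleR_minus1_left scaleR_one)
    have "U (p - q0) = U (p - p0) - U (q0 - p0)"
      using linear_diff[OF linear_U, of "p - p0" "q0 - p0"] by simp
    then have eq: "m *\<^sub>R (p - q0) = l *\<^sub>R (p - p0) - \<epsilon> *\<^sub>R (q0 - p0)" using m l e by simp
    show ?thesis
    proof (cases "l = \<epsilon>")
      case True then show ?thesis using l by simp
    next
      case False
      then have "l = - \<epsilon>" using l e by auto
      then consider "m = l" | "m = \<epsilon>" using m e by auto
      then show ?thesis
      proof cases
        case 1
        have "l *\<^sub>R (p - q0) = l *\<^sub>R (p - p0) - l *\<^sub>R (q0 - p0)" by (simp add: algebra_simps)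
        then have "(l - \<epsilon>) *\<^sub>R (q0 - p0) = 0" using eq 1 by (simp add: algebra_simps)
        then show ?thesis using False pq by simp
      next
        case 2
        have "\<epsilon> *\<^sub>R (p - q0) = \<epsilon> *\<^sub>R (p - p0) - \<epsilon> *\<^sub>R (q0 - p0)" by (simp add: algebra_simps)
        then have "(l - \<epsilon>) *\<^sub>R (p - p0) = 0" using eq 2 by (simp add: algebra_simps)
        then show ?thesis using False by (simp add: linear_0[OF linear_U])
      qed
    qed
  qed
  have "U (q - p) = \<epsilon> *\<^sub>R (q - p)" if "p \<in> V" "q \<in> V" for p q
  proof -
    have "U (q - p) = U (q - p0) - U (p - p0)"
      using linear_diff[OF linear_U, of "q - p0" "p - p0"] by simp
    then show ?thesis using *[OF that(1)] *[OF that(2)] by (simp add: algebra_simps)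
  qed
  then show thesis using that e(1) by blast
qed

lemma cell_edge_same_cell:
  assumes "(x, y) \<in> cell_edges F"
  obtains i where "i \<in> I" "x \<in> \<Psi> i ` V" "y \<in> \<Psi> i ` V"
proof -
  obtain i where i: "i \<in> I" "x \<in> \<Psi> i ` K" "y \<in> \<Psi> i ` K" and A: "x \<in> cell_vertices F" "y \<in> cell_vertices F"
    using assms unfolding cell_edges_def I_def by auto
  have "z \<in> \<Psi> i ` V" if "z \<in> \<Psi> i ` K" "z \<in> cell_vertices F" for z
  proof -
    note z = that
    obtain j where j: "j \<in> I" "z \<in> \<Psi> j ` V" using z(2) unfolding cell_vertices_def I_def by auto
    show ?thesis
    proof (cases "j = i")
      case False
      have "z \<in> \<Psi> j ` K" using j(2) V_subset_K by blast
      then show ?thesis using nesting_I[OF j(1) i(1) False] z(1) by blast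
    qed (use j in simp)
  qed
  then show thesis using that i A by blast
qed

text \<open>Connectivity of the cell graph as an induction principle: by nesting, the ends of an edge are vertices of
one cell.\<close>

lemma cell_vertices_induct [consumes 1, case_names start cell]:
  assumes "x \<in> cell_vertices F"
    and start: "\<exists>z\<in>cell_vertices F. P z"
    and cell: "\<And>i u v. i \<in> I \<Longrightarrow> u \<in> V \<Longrightarrow> v \<in> V \<Longrightarrow> P (\<Psi> i u) \<Longrightarrow> P (\<Psi> i v)"
  shows "P x"
proof -
  obtain z where z: "z \<in> cell_vertices F" "P z" using start by blast
  have "(z, x) \<in> (cell_edges F)\<^sup>*" using connectivity z(1) assms(1) by blast
  then show ?thesis
  proof (induction rule: rtrancl_induct)
    case base then show ?case using z by simp
  next
    case (step y x)
    obtain i where i: "i \<in> I" "y \<in> \<Psi> i ` V" "x \<in> \<Psi> i ` V" using cell_edge_same_cell[OF step(2)] .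
    then show ?case using step.IH cell by blast
  qed
qed

lemma simil_V_cell_vertices: "i \<in> I \<Longrightarrow> v \<in> V \<Longrightarrow> \<Psi> i v \<in> cell_vertices F"
  unfolding cell_vertices_def I_def by blast

lemma V_cell_vertices: assumes "p \<in> V" shows "p \<in> cell_vertices F"
  using V_fixed[OF assms] simil_V_cell_vertices[OF _ assms] by metis

text \<open>Along the edges of the cell graph \<open>x - p\<close> changes by multiples of images under \<open>U\<close> of differences of
essential fixed points, so \<open>f\<close> vanishes at all cell vertices. Then the maximum of \<open>norm (f (x - p))\<close>
over the attractor is at most its own multiple by \<open>1 / L\<close>.\<close>

lemma linear_vanish_on_K_general:
  fixes f :: "real^2 \<Rightarrow> real^2"
  assumes f: "linear f" "\<And>x y. x \<in> K \<Longrightarrow> y \<in> K \<Longrightarrow> norm (f (U (x - y))) \<le> norm (f (x - y))"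
    and p: "p \<in> V" "\<And>v. v \<in> V \<Longrightarrow> f (v - p) = 0" and x: "x \<in> K"
  shows "f (x - p) = 0"
proof -
  have VK: "v \<in> V \<Longrightarrow> v \<in> K" for v using V_subset_K by blast
  have fU: "f (U (u - v)) = 0" if "u \<in> V" "v \<in> V" for u v
  proof -
    have "f (u - v) = f (u - p) - f (v - p)" using linear_diff[OF f(1), of "u - p" "v - p"] by simp
    then have "f (u - v) = 0" using p that by simp
    then show ?thesis using f(2)[of u v] VK that by simp
  qed
  have cells: "f (y - p) = 0" if "y \<in> cell_vertices F" for y
    using that
  proof (induction y rule: cell_vertices_induct)
    case start
    show ?case using V_cell_vertices[OF p(1)] linear_0[OF f(1)] by (intro bexI[of _ p]) auto
  next
    case (cell i u v)
    have "f (\<Psi> i v - p) = f (\<Psi> i v - \<Psi> i u) + f (\<Psi> i u - p)"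
      using linear_add[OF f(1), of "\<Psi> i v - \<Psi> i u" "\<Psi> i u - p"] by simp
    then show ?case using cell fU by (simp add: simil_diff linear_scale[OF f(1)])
  qed
  have cont: "continuous_on K (\<lambda>x. norm (f (x - p)))"
  proof -
    have "continuous_on UNIV f" using f(1) linear_continuous_on linear_conv_bounded_linear by blast
    then show ?thesis
      by (intro continuous_intros continuous_on_compose2[where f = "\<lambda>x. x - p" and g = f]) auto
  qed
  obtain x0 where x0: "x0 \<in> K" "\<And>y. y \<in> K \<Longrightarrow> norm (f (y - p)) \<le> norm (f (x0 - p))"
    using continuous_attains_sup[OF attractor_K(1,2) cont] by blast
  obtain i k where ik: "i \<in> I" "k \<in> K" "x0 = \<Psi> i k" using in_K_cases[OF x0(1)] .
  have "f (x0 - p) = f (\<Psi> i k - \<Psi> i p) + f (\<Psi> i p - p)"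
    using linear_add[OF f(1), of "\<Psi> i k - \<Psi> i p" "\<Psi> i p - p"] ik by simp
  also have "\<dots> = (1/L) *\<^sub>R f (U (k - p))"
    using cells[OF simil_V_cell_vertices[OF ik(1) p(1)]] by (simp add: simil_diff linear_scale[OF f(1)])
  finally have "norm (f (x0 - p)) = norm (f (U (k - p))) / L" using L_pos by simp
  also have "\<dots> \<le> norm (f (x0 - p)) / L"
    using f(2)[OF ik(2) VK[OF p(1)]] x0(2)[OF ik(2)] L_pos by (intro divide_right_mono) auto
  finally have "norm (f (x0 - p)) * (1 - 1/L) \<le> 0" by (simp add: algebra_simps)
  moreover have "1 - 1/L > 0" using scaling by simp
  ultimately have "norm (f (x0 - p)) \<le> 0" by (simp add: mult_le_0_iff)
  then show ?thesis using x0(2)[OF x] by (metis norm_le_zero_iff order_trans)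
qed

text \<open>The linear map \<open>U z - \<epsilon> z\<close> commutes with \<open>U\<close>, which makes \<open>linear_vanish_on_K_general\<close> applicable.\<close>

lemma U_eq_sign_on_K:
  assumes e: "\<epsilon> = 1 \<or> \<epsilon> = (-1::real)" "\<And>p q. p \<in> V \<Longrightarrow> q \<in> V \<Longrightarrow> U (q - p) = \<epsilon> *\<^sub>R (q - p)"
    and x: "x \<in> K" "y \<in> K"
  shows "U (x - y) = \<epsilon> *\<^sub>R (x - y)"
proof -
  obtain p where p: "p \<in> V" using V_nonempty by blast
  define f where "f z = U z - \<epsilon> *\<^sub>R z" for z
  have lf: "linear f" unfolding f_def
    by (intro linear_compose_sub linear_U linear_compose_scale_right[OF linear_id[unfolded id_def]])
  have fU: "f (U z) = U (f z)" for z
    by (simp add: f_def linear_diff[OF linear_U] linear_scale[OF linear_U])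
  have "f (z - p) = 0" if "z \<in> K" for z
    proof (rule linear_vanish_on_K_general[OF lf _ p _ that])
    show "norm (f (U (x - y))) \<le> norm (f (x - y))" for x y unfolding fU norm_U by simp
    show "f (v - p) = 0" if "v \<in> V" for v using e(2)[OF p that] by (simp add: f_def)
  qed
  then have "f (x - p) - f (y - p) = 0" using x by simp
  moreover have "f (x - p) - f (y - p) = f (x - y)" using linear_diff[OF lf, of "x - p" "y - p"] by simp
  ultimately show ?thesis by (simp add: f_def)
qed

lemma reflection_centroid_fixed:
  assumes "p \<in> V" "q \<in> V" shows "bisector_reflection p q centroid = centroid"
  by (rule bisector_reflection_fixed) (rule norm_centroid_vertex[OF assms])

end

section \<open>Connectedness of the attractor and triviality of the linear part\<close>

text \<open>A separation of the half would extend to one of \<open>K\<close>, since the other half is attached to it at \<open>p\<close> only.\<close>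

lemma connected_halfspace_part:
  fixes f :: "'a::topological_space \<Rightarrow> real"
  assumes K: "connected K" and f: "continuous_on K f" and p: "K \<inter> {x. f x = 0} = {p}"
  shows "connected (K \<inter> {x. f x \<le> 0})"
proof (rule ccontr)
  let ?H = "K \<inter> {x. f x \<le> 0}" and ?G = "K \<inter> {x. f x \<ge> 0}"
  have pH: "p \<in> ?H" "p \<in> K" "f p = 0" using p by auto
  assume "\<not> connected ?H"
  then obtain A B where AB: "closedin (top_of_set ?H) A" "closedin (top_of_set ?H) B"
    "?H \<subseteq> A \<union> B" "A \<inter> B = {}" "A \<noteq> {}" "B \<noteq> {}"
    unfolding connected_closedin by auto
  have "closedin (top_of_set K) ?H"
  proof -
    have "K \<inter> f -` {..0} = ?H" by auto
    then show ?thesis using continuous_closedin_preimage[OF f closed_atMost[of 0]] by simp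
  qed
  then have AB': "closedin (top_of_set K) A" "closedin (top_of_set K) B"
    using AB(1,2) closedin_trans by blast+
  have G: "closedin (top_of_set K) ?G"
  proof -
    have "K \<inter> f -` {0..} = ?G" by auto
    then show ?thesis using continuous_closedin_preimage[OF f closed_atLeast[of 0]] by simp
  qed
  have sub: "A \<subseteq> ?H" "B \<subseteq> ?H" using AB(1,2) closedin_imp_subset by blast+
  have *: False if "closedin (top_of_set K) A" "closedin (top_of_set K) B" "?H \<subseteq> A \<union> B" "A \<inter> B = {}" 
    "B \<noteq> {}" "p \<in> A" "A \<subseteq> ?H" "B \<subseteq> ?H" for A B
  proof -
    have "closedin (top_of_set K) (A \<union> ?G)" using that(1) G by (rule closedin_Un)
    moreover have "K \<subseteq> (A \<union> ?G) \<union> B" using that(3) by auto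
    moreover have "(A \<union> ?G) \<inter> B = {}"
    proof -
      have "?G \<inter> B \<subseteq> {p}" using that(8) p by force
      then show ?thesis using that(4,6) by blast
    qed
    moreover have "A \<union> ?G \<noteq> {}" using that(6) by auto
    ultimately show False using K that(2,5) unfolding connected_closedin by blast
  qed
  have "p \<in> A \<or> p \<in> B" using pH(1) AB(3) by blast
  then show False
  proof
    assume "p \<in> A" then show False using *[OF AB' AB(3,4,6) _ sub] by simp
  next
    assume "p \<in> B" then show False using *[OF AB'(2,1) _ _ AB(5) _ sub(2,1)] AB(3,4) by blast
  qed
qed

lemma connected_no_zero_same_sign:
  fixes f :: "'a::topological_space \<Rightarrow> real"
  assumes "connected S" "continuous_on S f" "\<And>x. x \<in> S \<Longrightarrow> f x \<noteq> 0" "x \<in> S" "y \<in> S" "f x \<le> 0"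
  shows "f y < 0"
proof (rule ccontr)
  assume "\<not> f y < 0"
  then have y: "f y > 0" using assms(3)[OF assms(5)] by simp
  have "connected (f ` S)" using assms(1,2) connected_continuous_image by blast
  then have "0 \<in> f ` S"
    using assms(4-6) y connectedD_interval[of "f ` S" "f x" "f y" 0] by auto
  then show False using assms(3) by auto
qed

text \<open>Take a point \<open>p\<close> and a line through it that cuts off as few points of \<open>V\<close> as possible, and a point \<open>a\<close>
among those cut off. The part of \<open>K\<close> on the other side of the line is connected and avoids \<open>a\<close>, so it lies
on one side of the line through \<open>a\<close>, whose other side then contains fewer points of \<open>V\<close>.\<close>

lemma finite_no_all_separating:
  fixes V K :: "'a::real_inner set"
  assumes K: "connected K" and V: "finite V" "V \<noteq> {}" "V \<subseteq> K"
    and sep: "\<And>p. p \<in> V \<Longrightarrow> \<exists>u. K \<inter> {x. (x - p) \<bullet> u = 0} = {p} \<and>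
       (\<exists>v\<in>V. (v - p) \<bullet> u < 0) \<and> (\<exists>v\<in>V. (v - p) \<bullet> u > 0)"
  shows False
proof -
  define Q where "Q p u \<longleftrightarrow> p \<in> V \<and> K \<inter> {x. (x - p) \<bullet> u = 0} = {p} \<and>
       (\<exists>v\<in>V. (v - p) \<bullet> u < 0) \<and> (\<exists>v\<in>V. (v - p) \<bullet> u > 0)" for p u
  have Qneg: "Q p (- u)" if "Q p u" for p u using that unfolding Q_def by auto
  define n where "n = (\<lambda>(p, u). card {v\<in>V. (v - p) \<bullet> u > 0})"
  obtain p1 where "p1 \<in> V" using V by blast
  then have "\<exists>u. Q p1 u" using sep unfolding Q_def by blast
  then have "\<exists>pu. case_prod Q pu" by auto
  from ex_has_least_nat[of "case_prod Q", where m = n] this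
  obtain p u where pu: "Q p u" and least: "\<And>p' u'. Q p' u' \<Longrightarrow> n (p, u) \<le> n (p', u')" by fastforce
  obtain a where a: "a \<in> V" "(a - p) \<bullet> u > 0" using pu unfolding Q_def by auto
  have "\<exists>u. Q a u" using sep[OF a(1)] a(1) unfolding Q_def by simp
  then obtain u0 where u0: "Q a u0" by (rule exE)
  have pK: "p \<in> K" "p \<in> V" using pu V unfolding Q_def by auto
  have "p \<noteq> a" using a by auto
  then have "(p - a) \<bullet> u0 \<noteq> 0" using u0 pK unfolding Q_def by auto
  then obtain u' where u': "Q a u'" "(p - a) \<bullet> u' < 0"
    using u0 Qneg[OF u0] by (cases "(p - a) \<bullet> u0 < 0") auto
  have "{v\<in>V. (v - a) \<bullet> u' > 0} \<subset> {v\<in>V. (v - p) \<bullet> u > 0}"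
  proof
    show "{v\<in>V. (v - a) \<bullet> u' > 0} \<subseteq> {v\<in>V. (v - p) \<bullet> u > 0}"
    proof (rule ccontr)
      assume "\<not> ?thesis"
      then obtain x where x: "x \<in> V" "(x - a) \<bullet> u' > 0" "\<not> (x - p) \<bullet> u > 0" by blast
      let ?H = "K \<inter> {x. (x - p) \<bullet> u \<le> 0}"
      have "connected ?H"
        by (rule connected_halfspace_part[OF K, where p = p]) (use pu in \<open>auto simp: Q_def intro!: continuous_intros\<close>)
      moreover have "continuous_on ?H (\<lambda>y. (y - a) \<bullet> u')" by (intro continuous_intros)
      moreover have "(y - a) \<bullet> u' \<noteq> 0" if "y \<in> ?H" for y
      proof
        assume "(y - a) \<bullet> u' = 0"
        then have "y \<in> K \<inter> {x. (x - a) \<bullet> u' = 0}" using that by blast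
        then have "y = a" using u'(1) unfolding Q_def by blast
        then show False using that a(2) by simp
      qed
      ultimately have "(x - a) \<bullet> u' < 0"
        by (rule connected_no_zero_same_sign[where x = p]) (use pK x V u'(2) in \<open>auto simp: not_less\<close>)
      then show False using x by simp
    qed
    have "a \<in> {v\<in>V. (v - p) \<bullet> u > 0} - {v\<in>V. (v - a) \<bullet> u' > 0}" using a by auto
    then show "{v\<in>V. (v - a) \<bullet> u' > 0} \<noteq> {v\<in>V. (v - p) \<bullet> u > 0}" by blast
  qed
  then have "n (a, u') < n (p, u)" unfolding n_def using V by (auto intro: psubset_card_mono)
  then show False using least[OF u'(1)] by simp
qed

context simple_nested_fractal
begin

text \<open>If a cell meets both parts, its preimage splits into two parts whose gap is larger by the factor \<open>L\<close>; if
no cell does, the cell graph is disconnected. Since the gap can not exceed the diameter, it vanishes.\<close>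

lemma K_no_gap:
  assumes "K = A \<union> B" "A \<noteq> {}" "B \<noteq> {}" "e > 0"
  shows "\<exists>a\<in>A. \<exists>b\<in>B. dist a b < e"
proof -
  obtain D where D: "D > 0" "\<And>x y. x \<in> K \<Longrightarrow> y \<in> K \<Longrightarrow> dist x y < D"
  proof -
    obtain D where "\<And>x y. x \<in> K \<Longrightarrow> y \<in> K \<Longrightarrow> dist x y \<le> D"
      using compact_imp_bounded[OF attractor_K(1)] unfolding bounded_two_points by blast
    then have "\<And>x y. x \<in> K \<Longrightarrow> y \<in> K \<Longrightarrow> dist x y < \<bar>D\<bar> + 1" by fastforce
    then show thesis using that[of "\<bar>D\<bar> + 1"] by simp
  qed
  have step: "\<exists>a\<in>A. \<exists>b\<in>B. dist a b < D / L ^ n" if "K = A \<union> B" "A \<noteq> {}" "B \<noteq> {}" for A B n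
    using that
  proof (induction n arbitrary: A B)
    case 0
    then show ?case using D(2) by fastforce
  next
    case (Suc n)
    show ?case
    proof (cases "\<exists>i\<in>I. \<Psi> i ` K \<inter> A \<noteq> {} \<and> \<Psi> i ` K \<inter> B \<noteq> {}")
      case True
      then obtain i where i: "i \<in> I" "\<Psi> i ` K \<inter> A \<noteq> {}" "\<Psi> i ` K \<inter> B \<noteq> {}" by blast
      define A' where "A' = {x\<in>K. \<Psi> i x \<in> A}"
      define B' where "B' = {x\<in>K. \<Psi> i x \<in> B}"
      have "K = A' \<union> B'" using Suc.prems(1) simil_in_K[OF i(1)] unfolding A'_def B'_def by blast
      moreover have "A' \<noteq> {}" "B' \<noteq> {}" using i unfolding A'_def B'_def by auto
      ultimately obtain a b where ab: "a \<in> A'" "b \<in> B'" "dist a b < D / L ^ n" using Suc.IH by blast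
      have "dist (\<Psi> i a) (\<Psi> i b) < D / L ^ Suc n" using ab(3) L_pos by (simp add: dist_simil field_simps)
      then show ?thesis using ab unfolding A'_def B'_def by blast
    next
      case False
      have one: "(\<exists>z\<in>cell_vertices F. z \<in> X)" if X: "X \<noteq> {}" "X \<subseteq> K" "\<forall>i\<in>I. \<Psi> i ` K \<subseteq> X \<or> \<Psi> i ` K \<inter> X = {}" for X
      proof -
        obtain x where x: "x \<in> X" using X by blast
        then obtain i k where ik: "i \<in> I" "k \<in> K" "x = \<Psi> i k" using X in_K_cases by blast
        obtain v where v: "v \<in> V" using V_nonempty by blast
        have "\<Psi> i v \<in> X" using ik x X(3) v V_subset_K by blast
        then show ?thesis using simil_V_cell_vertices[OF ik(1) v] by blast
      qed
      have closed: "\<Psi> i v \<in> A" if "i \<in> I" "u \<in> V" "v \<in> V" "\<Psi> i u \<in> A" for i u v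
      proof -
        have "\<Psi> i u \<in> \<Psi> i ` K" "\<Psi> i v \<in> \<Psi> i ` K" "\<Psi> i v \<in> K"
          using that V_subset_K simil_in_K by blast+
        then show ?thesis using False that(1,4) Suc.prems(1) by blast
      qed
      show ?thesis
      proof (cases "A \<inter> B = {}")
        case True
        have sub: "\<Psi> i ` K \<subseteq> A \<union> B" if "i \<in> I" for i using simil_in_K[OF that] Suc.prems(1) by blast
        have "\<exists>z\<in>cell_vertices F. z \<in> A"
          by (rule one) (use Suc.prems sub False True in blast)+
        moreover have "\<exists>z\<in>cell_vertices F. z \<in> B"
          by (rule one) (use Suc.prems sub False True in blast)+
        moreover have "x \<in> A" if "x \<in> cell_vertices F" "\<exists>z\<in>cell_vertices F. z \<in> A" for x
          using that(1) by (rule cell_vertices_induct[OF _ that(2)]) (rule closed)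
        ultimately show ?thesis using True by blast
      next
        case False
        then obtain z where "z \<in> A" "z \<in> B" by blast
        then show ?thesis using D(1) L_pos by (intro bexI[of _ z]) auto
      qed
    qed
  qed
  have "(\<lambda>n. D / L ^ n) \<longlonglongrightarrow> 0" using scaling by (intro LIMSEQ_divide_realpow_zero)
  then have "eventually (\<lambda>n. D / L ^ n < e) sequentially"
    using assms(4) by (simp add: order_tendsto_iff)
  then obtain n where "D / L ^ n < e" by (auto simp: eventually_sequentially)
  moreover obtain a b where "a \<in> A" "b \<in> B" "dist a b < D / L ^ n"
    using step[OF assms(1-3), of n] by (elim bexE)
  ultimately show ?thesis by (meson less_trans)
qed

lemma connected_K: "connected K"
proof (rule ccontr)
  assume "\<not> connected K"
  then obtain A B where AB: "closedin (top_of_set K) A" "closedin (top_of_set K) B"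
    "K \<subseteq> A \<union> B" "A \<inter> B = {}" "A \<noteq> {}" "B \<noteq> {}"
    unfolding connected_closedin by auto
  have sub: "A \<subseteq> K" "B \<subseteq> K" using AB closedin_imp_subset by blast+
  have comp: "compact A" "compact B" using AB(1,2) attractor_K(1) closedin_compact by blast+
  have "closed B" using comp compact_imp_closed by blast
  then obtain d where d: "d > 0" "\<And>x y. x \<in> A \<Longrightarrow> y \<in> B \<Longrightarrow> d \<le> dist x y"
    using separate_compact_closed[OF comp(1) _ AB(4)] by blast
  have "K = A \<union> B" using AB(3) sub by blast
  from K_no_gap[OF this AB(5,6) d(1)] show False using d(2) by fastforce
qed

text \<open>On the attractor \<open>\<Psi> i\<close> is, seen from the centroid of the essential fixed points, the multiplication by
\<open>\<epsilon> / L\<close> followed by a translation, and the reflection fixes the centroid.\<close>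

lemma reflection_commutes:
  assumes e: "\<epsilon> = 1 \<or> \<epsilon> = (-1::real)" "\<And>p q. p \<in> V \<Longrightarrow> q \<in> V \<Longrightarrow> U (q - p) = \<epsilon> *\<^sub>R (q - p)"
    and pq: "p \<in> V" "q \<in> V" "p \<noteq> q"
    and j: "bisector_reflection p q ` \<Psi> i ` V = \<Psi> j ` V"
    and k: "k \<in> K"
  shows "bisector_reflection p q (\<Psi> i k) = \<Psi> j (bisector_reflection p q k)"
proof -
  let ?S = "bisector_reflection p q" and ?s = "refl_lin (q - p)"
  define U' where "U' z = U z - \<epsilon> *\<^sub>R z" for z
  have lin: "linear U'" unfolding U'_def
    by (intro linear_compose_sub linear_U linear_compose_scale_right[OF linear_id[unfolded id_def]])
  have Uk: "U (k - centroid) = \<epsilon> *\<^sub>R (k - centroid)"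
  proof -
    have "U' (k - centroid) = 0"
    proof -
      have n: "real (card V) > 0" using finite_V V_nonempty by (simp add: card_gt_0_iff)
      have "real (card V) *\<^sub>R (k - centroid) = (\<Sum>v\<in>V. k - v)"
        using n by (simp add: centroid_def sum_subtractf sum_constant_scaleR scaleR_diff_right del: sum_constant)
      also have "U' \<dots> = 0"
        unfolding linear_sum[OF lin]
        by (rule sum.neutral) (use U_eq_sign_on_K[OF e k] V_subset_K in \<open>auto simp: U'_def\<close>)
      finally show ?thesis using n by (simp add: linear_scale[OF lin])
    qed
    then show ?thesis by (simp add: U'_def)
  qed
  have "U (z - c *\<^sub>R d) = \<epsilon> *\<^sub>R (z - c *\<^sub>R d)" if "U z = \<epsilon> *\<^sub>R z" "U d = \<epsilon> *\<^sub>R d" for z d c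
    using that by (simp add: linear_diff[OF linear_U] linear_scale[OF linear_U] scaleR_diff_right)
  from this[OF Uk e(2)[OF pq(1,2)]] have Us: "U (?s (k - centroid)) = \<epsilon> *\<^sub>R ?s (k - centroid)"
    unfolding refl_lin_def .
  have Sw: "?S centroid = centroid" by (rule reflection_centroid_fixed[OF pq(1,2)])
  have Sk: "?S k - centroid = ?s (k - centroid)" using bisector_reflection_diff[of p q k centroid] Sw by simp
  have "?S (\<Psi> i k) - \<Psi> j centroid = ?S (\<Psi> i k) - ?S (\<Psi> i centroid)" using reflection_centroid[OF j] by simp
  also have "\<dots> = ?s ((1/L) *\<^sub>R U (k - centroid))" by (simp add: bisector_reflection_diff simil_diff)
  also have "\<dots> = (1/L) *\<^sub>R (\<epsilon> *\<^sub>R ?s (k - centroid))" by (simp add: Uk linear_scale[OF linear_refl_lin])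
  also have "\<dots> = (1/L) *\<^sub>R U (?S k - centroid)" by (simp only: Us Sk)
  also have "\<dots> = \<Psi> j (?S k) - \<Psi> j centroid" by (simp add: simil_diff)
  finally show ?thesis by simp
qed

lemma reflection_K_of_sign:
  assumes e: "\<epsilon> = 1 \<or> \<epsilon> = (-1::real)" "\<And>p q. p \<in> V \<Longrightarrow> q \<in> V \<Longrightarrow> U (q - p) = \<epsilon> *\<^sub>R (q - p)"
    and pq: "p \<in> V" "q \<in> V" "p \<noteq> q"
  shows "bisector_reflection p q ` K \<subseteq> K"
proof (rule subinvariant_subset_K)
  let ?S = "bisector_reflection p q"
  show "bounded (?S ` K)"
    by (rule compact_imp_bounded[OF compact_continuous_image[OF continuous_bisector_reflection attractor_K(1)]])
  show "?S ` K \<subseteq> (\<Union>i\<in>I. \<Psi> i ` ?S ` K)"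
  proof
    fix y assume "y \<in> ?S ` K"
    then obtain i k where ik: "i \<in> I" "k \<in> K" "y = ?S (\<Psi> i k)" using in_K_cases by blast
    obtain j where j: "j \<in> I" "?S ` \<Psi> i ` V = \<Psi> j ` V" using symmetry_I[OF ik(1) pq] .
    have "y = \<Psi> j (?S k)" using reflection_commutes[OF e pq j(2) ik(2)] ik(3) by simp
    then show "y \<in> (\<Union>i\<in>I. \<Psi> i ` ?S ` K)" using j(1) ik(2) by blast
  qed
qed

lemma reflection_V_of_sign:
  assumes e: "\<epsilon> = 1 \<or> \<epsilon> = (-1::real)" "\<And>p q. p \<in> V \<Longrightarrow> q \<in> V \<Longrightarrow> U (q - p) = \<epsilon> *\<^sub>R (q - p)"
    and pq: "p \<in> V" "q \<in> V" "p \<noteq> q" and v: "v \<in> V"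
  shows "bisector_reflection p q v \<in> V"
proof -
  let ?S = "bisector_reflection p q"
  obtain j where j: "j \<in> I" "?S ` \<Psi> 1 ` V = \<Psi> j ` V" using symmetry_I[OF one_in_I pq] .
  have "\<Psi> j (?S v) = ?S (\<Psi> 1 v)" using reflection_commutes[OF e pq j(2)] v V_subset_K by auto
  also have "\<dots> \<in> \<Psi> j ` V" using j(2) v by blast
  finally show ?thesis using simil_eq_iff by auto
qed

text \<open>The defining condition is symmetric, so the partner is essential, too.\<close>

lemma essential_partner:
  assumes "p \<in> V"
  obtains q i j where "q \<in> V" "q \<noteq> p" "i \<in> I" "j \<in> I" "i \<noteq> j" "\<Psi> i p = \<Psi> j q"
proof -
  obtain q i j where q: "q \<in> fixed_points F" "q \<noteq> p" "i \<in> I" "j \<in> I" "\<Psi> i \<noteq> \<Psi> j" "\<Psi> i p = \<Psi> j q"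
    and p: "p \<in> fixed_points F"
    using assms unfolding essential_fixed_points_def I_def by blast
  have "q \<in> V" unfolding essential_fixed_points_def
    using q p unfolding I_def[symmetric] by (metis (mono_tags, lifting) mem_Collect_eq)
  moreover have "i \<noteq> j" using q by auto
  ultimately show thesis using that q by blast
qed

text \<open>The three points are collinear, and a line meets a circle in at most two points.\<close>

lemma circle_three_points:
  fixes p x c :: "'a::real_inner" and l :: real
  assumes "norm (x - c) = norm (p - c)" "norm (p - (1/l) *\<^sub>R (x - p) - c) = norm (p - c)" "l > 0"
  shows "x = p"
proof -
  define e where "e = x - p"
  define b where "b = p - c"
  have *: "(norm (b + t *\<^sub>R e))\<^sup>2 = (norm b)\<^sup>2 + 2 * t * (b \<bullet> e) + t\<^sup>2 * (norm e)\<^sup>2" for t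
    unfolding power2_norm_eq_inner
    by (simp add: inner_add_left inner_add_right inner_commute power2_eq_square algebra_simps)
  have "norm (b + 1 *\<^sub>R e) = norm b" using assms(1) by (simp add: b_def e_def)
  then have 1: "2 * (b \<bullet> e) + (norm e)\<^sup>2 = 0" using *[of 1] by simp
  have "p - (1/l) *\<^sub>R (x - p) - c = b + (-1/l) *\<^sub>R e" by (simp add: b_def e_def)
  then have "norm (b + (-1/l) *\<^sub>R e) = norm b" using assms(2) by (metis b_def)
  then have "- 2 / l * (b \<bullet> e) + (norm e)\<^sup>2 / l\<^sup>2 = 0"
    using *[of "-1/l"] by (simp add: power_divide)
  moreover have "b \<bullet> e = - (norm e)\<^sup>2 / 2" using 1 by simp
  ultimately have "(norm e)\<^sup>2 / l + (norm e)\<^sup>2 / l\<^sup>2 = 0" by simp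
  moreover have "(norm e)\<^sup>2 / l \<ge> 0" "(norm e)\<^sup>2 / l\<^sup>2 \<ge> 0" using assms(3) by auto
  ultimately have "(norm e)\<^sup>2 / l = 0" by linarith
  then show ?thesis using assms(3) by (simp add: e_def)
qed

text \<open>Let \<open>\<Psi> i p = \<Psi> j q\<close> witness that \<open>p\<close> is essential, and consider the line through \<open>p\<close> orthogonal to
\<open>q - p\<close>. The reflection exchanging \<open>p\<close> and \<open>q\<close> translates its points by \<open>q - p\<close>, so every point of the
attractor on this line has the same image under \<open>\<Psi> i\<close> as its mirror image has under \<open>\<Psi> j\<close>; by nesting it
is an essential fixed point. With a negative sign this forces \<open>p\<close> to be the only such point and puts the
cell at \<open>p\<close> across the line, so that \<open>p\<close> separates the attractor, for every \<open>p\<close>.\<close>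

lemma U_sign_not_minus_one:
  assumes e: "\<And>p q. p \<in> V \<Longrightarrow> q \<in> V \<Longrightarrow> U (q - p) = (-1::real) *\<^sub>R (q - p)"
  shows False
proof (rule finite_no_all_separating[OF connected_K finite_V V_nonempty V_subset_K])
  fix p assume p: "p \<in> V"
  have e1: "(-1::real) = 1 \<or> (-1::real) = -1" by simp
  note e = e1 e
  obtain q i j where q: "q \<in> V" "q \<noteq> p" and ij: "i \<in> I" "j \<in> I" "i \<noteq> j" "\<Psi> i p = \<Psi> j q"
    using essential_partner[OF p] .
  obtain a where a: "a \<in> I" "\<Psi> a p = p" using V_fixed[OF p] .
  let ?d = "q - p" and ?S = "bisector_reflection p q"
  have pq: "p \<noteq> q" using q by simp
  have pK: "p \<in> K" using p V_subset_K by blast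
  \<comment> \<open>a point of the line has the same image under \<open>\<Psi> i\<close> as its mirror image under \<open>\<Psi> j\<close>\<close>
  have lineV: "x \<in> V" if x: "x \<in> K" "(x - p) \<bullet> ?d = 0" for x
  proof -
    have Sx: "?S x = x + ?d" using bisector_reflection_shift[OF x(2) pq] .
    have SK: "?S x \<in> K" using reflection_K_of_sign[OF e p q(1) pq] x(1) by blast
    have "\<Psi> i x - \<Psi> i p = \<Psi> j (?S x) - \<Psi> j q" by (simp add: simil_diff Sx)
    then have "\<Psi> i x = \<Psi> j (?S x)" using ij(4) by simp
    then have "\<Psi> i x \<in> \<Psi> i ` K \<inter> \<Psi> j ` K" using x(1) SK by blast
    then have "\<Psi> i x \<in> \<Psi> i ` V" using nesting_I[OF ij(1-3)] by blast
    then show ?thesis using simil_eq_iff by auto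
  qed
  have cell: "\<Psi> a x = p - (1/L) *\<^sub>R (x - p)" if "x \<in> K" for x
  proof -
    have "\<Psi> a x - \<Psi> a p = - (1/L) *\<^sub>R (x - p)"
      using U_eq_sign_on_K[OF e that pK] by (simp add: simil_diff flip: scaleR_minus_right)
    then show ?thesis using a(2) by (simp add: algebra_simps)
  qed
  \<comment> \<open>with \<open>x\<close>, its image in the cell at \<open>p\<close> is a third point of the line on the circle through \<open>V\<close>\<close>
  have line: "x = p" if x: "x \<in> K" "(x - p) \<bullet> ?d = 0" for x
  proof -
    define y where "y = \<Psi> a x"
    have y: "y = p - (1/L) *\<^sub>R (x - p)" using cell[OF x(1)] by (simp add: y_def)
    have "(y - p) \<bullet> ?d = 0" using x(2) by (simp add: y)
    then have "y \<in> V" using lineV simil_in_K[OF a(1) x(1)] by (simp add: y_def)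
    moreover have "x \<in> V" using lineV x by blast
    ultimately have "norm (centroid - x) = norm (centroid - p)" "norm (centroid - y) = norm (centroid - p)"
      using norm_centroid_vertex p by blast+
    then show ?thesis using circle_three_points[of x centroid p L] L_pos y by (simp add: norm_minus_commute)
  qed
  have line_eq: "K \<inter> {x. (x - p) \<bullet> ?d = 0} = {p}" using line pK by auto
  \<comment> \<open>otherwise no chain of cells would lead from the cell at \<open>p\<close>, which lies across the line, to \<open>q\<close>\<close>
  have "\<exists>v\<in>V. (v - p) \<bullet> ?d < 0"
  proof (rule ccontr)
    assume "\<not> ?thesis"
    then have nonneg: "(v - p) \<bullet> ?d \<ge> 0" if "v \<in> V" for v using that by force
    have "(x - p) \<bullet> ?d \<le> 0" if "x \<in> cell_vertices F" for x
      using that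
    proof (induction x rule: cell_vertices_induct)
      case start
      show ?case using V_cell_vertices[OF p] by (intro bexI[of _ p]) auto
    next
      case (cell i u v)
      show ?case
      proof (cases "i = a")
        case True
        have "\<Psi> i v = p - (1/L) *\<^sub>R (v - p)"
          using True \<open>\<And>x. x \<in> K \<Longrightarrow> \<Psi> a x = p - (1/L) *\<^sub>R (x - p)\<close> cell(3) V_subset_K by blast
        then show ?thesis using nonneg[OF cell(3)] L_pos by simp
      next
        case False
        have conn: "connected (\<Psi> i ` K)"
          using connected_K continuous_simil connected_continuous_image by blast
        have nz: "(x - p) \<bullet> ?d \<noteq> 0" if "x \<in> \<Psi> i ` K" for x
        proof
          assume "(x - p) \<bullet> ?d = 0"
          moreover have "x \<in> K" using that simil_in_K[OF cell(1)] by blast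
          ultimately have "p \<in> \<Psi> i ` K" using line that by blast
          then show False using vertex_unique_cell[OF p a cell(1)] False by blast
        qed
        have "(\<Psi> i v - p) \<bullet> ?d < 0"
          by (rule connected_no_zero_same_sign[OF conn _ nz, where x = "\<Psi> i u"])
            (use cell V_subset_K in \<open>auto intro!: continuous_intros\<close>)
        then show ?thesis by simp
      qed
    qed
    from this[OF V_cell_vertices[OF q(1)]] have "?d \<bullet> ?d \<le> 0" by simp
    then show False using pq by (metis inner_gt_zero_iff linorder_not_less right_minus_eq)
  qed
  moreover have "(q - p) \<bullet> ?d > 0" using pq by (simp add: inner_gt_zero_iff)
  ultimately show "\<exists>u. K \<inter> {x. (x - p) \<bullet> u = 0} = {p} \<and>
       (\<exists>v\<in>V. (v - p) \<bullet> u < 0) \<and> (\<exists>v\<in>V. (v - p) \<bullet> u > 0)"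
    using line_eq q(1) by blast
qed

lemma U_vertex_diff: "p \<in> V \<Longrightarrow> q \<in> V \<Longrightarrow> U (q - p) = 1 *\<^sub>R (q - p)"
proof -
  obtain \<epsilon> :: real where e: "\<epsilon> = 1 \<or> \<epsilon> = -1" "\<forall>p\<in>V. \<forall>q\<in>V. U (q - p) = \<epsilon> *\<^sub>R (q - p)"
    by (rule U_sign)
  have "\<epsilon> \<noteq> -1" using e(2) U_sign_not_minus_one by blast
  then show "p \<in> V \<Longrightarrow> q \<in> V \<Longrightarrow> U (q - p) = 1 *\<^sub>R (q - p)" using e by simp
qed

lemma zero_in_K: "0 \<in> K"
  by (rule fixed_in_K[OF one_in_I]) (simp add: simil_def linear_0[OF linear_U] transl_1[simplified])

text \<open>The fixed point \<open>0\<close> of \<open>\<Psi> 1\<close> lies in the attractor, so \<open>U\<close> fixes not only the differences but the points.\<close>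

lemma U_id_on_K: "x \<in> K \<Longrightarrow> U x = x"
  using U_eq_sign_on_K[of 1 x 0] U_vertex_diff zero_in_K by simp

lemma simil_on_K: "x \<in> K \<Longrightarrow> \<Psi> i x = (1/L) *\<^sub>R x + transl F i"
  by (simp add: simil_def U_id_on_K)

lemma transl_in_K: "i \<in> I \<Longrightarrow> transl F i \<in> K"
  using simil_in_K[OF _ zero_in_K] by (simp add: simil_def linear_0[OF linear_U])

lemma reflection_K: "p \<in> V \<Longrightarrow> q \<in> V \<Longrightarrow> p \<noteq> q \<Longrightarrow> x \<in> K \<Longrightarrow> bisector_reflection p q x \<in> K"
  using reflection_K_of_sign[of 1 p q] U_vertex_diff by blast

lemma reflection_V: "p \<in> V \<Longrightarrow> q \<in> V \<Longrightarrow> p \<noteq> q \<Longrightarrow> v \<in> V \<Longrightarrow> bisector_reflection p q v \<in> V"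
  using reflection_V_of_sign[of 1 p q] U_vertex_diff by blast

lemma linear_vanish_K:
  fixes f :: "real^2 \<Rightarrow> real^2"
  assumes "linear f" "p \<in> V" "\<And>v. v \<in> V \<Longrightarrow> f (v - p) = 0" "x \<in> K"
  shows "f (x - p) = 0"
  by (rule linear_vanish_on_K_general[OF assms(1) _ assms(2,3,4)])
    (simp_all add: linear_diff[OF linear_U] U_id_on_K)

end

section \<open>Symmetries of the attractor and addresses of complexes\<close>

lemma refl_lin_involution: "refl_lin d (refl_lin d z) = z"
proof (cases "d = 0")
  case False
  then have n: "(norm d)\<^sup>2 \<noteq> 0" by simp
  define c where "c = 2 * (z \<bullet> d) / (norm d)\<^sup>2"
  have 1: "refl_lin d z = z - c *\<^sub>R d" by (simp add: refl_lin_def c_def)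
  have "refl_lin d z \<bullet> d = z \<bullet> d - c * (norm d)\<^sup>2"
    unfolding 1 power2_norm_eq_inner by (simp add: inner_diff_left)
  also have "\<dots> = - (z \<bullet> d)" using n by (simp add: c_def)
  finally have "refl_lin d (refl_lin d z) = refl_lin d z + c *\<^sub>R d"
    unfolding refl_lin_def[of d "refl_lin d z"] by (simp add: c_def)
  then show ?thesis using 1 by simp
qed (simp add: refl_lin_def)

lemma orthogonal_refl_lin: "orthogonal_transformation (refl_lin d)"
  by (simp add: orthogonal_transformation linear_refl_lin norm_refl_lin)

lemma bisector_reflection_involution:
  assumes "x \<noteq> y"
  shows "bisector_reflection x y (bisector_reflection x y z) = z"
proof -
  let ?S = "bisector_reflection x y"
  have "?S (?S z) - ?S (?S x) = z - x" by (simp add: bisector_reflection_diff refl_lin_involution)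
  then show ?thesis using bisector_reflection_swap[OF assms] by simp
qed

definition affine_isometry :: "('a::real_inner \<Rightarrow> 'a) \<Rightarrow> bool" where
  "affine_isometry T \<longleftrightarrow> (\<exists>A. orthogonal_transformation A \<and> (\<forall>x y. T x - T y = A (x - y)))"

lemma affine_isometry_bisector_reflection: "affine_isometry (bisector_reflection x y)"
  unfolding affine_isometry_def using orthogonal_refl_lin bisector_reflection_diff by blast

lemma affine_isometry_compose:
  assumes "affine_isometry S" "affine_isometry T" shows "affine_isometry (S \<circ> T)"
proof -
  obtain A B where "orthogonal_transformation A" "\<forall>x y. S x - S y = A (x - y)"
    "orthogonal_transformation B" "\<forall>x y. T x - T y = B (x - y)"
    using assms unfolding affine_isometry_def by blast
  then show ?thesis unfolding affine_isometry_def
    by (intro exI[of _ "A \<circ> B"]) (simp add: orthogonal_transformation_compose)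
qed

lemma affine_isometry_dist: assumes "affine_isometry T" shows "dist (T x) (T y) = dist x y"
  using assms unfolding affine_isometry_def dist_norm by (metis orthogonal_transformation_norm)

lemma inner_zero_parallel:
  fixes a b z :: "real^2"
  assumes "a \<noteq> 0" "z \<noteq> 0" "z \<bullet> a = 0" "z \<bullet> b = 0"
  obtains l where "b = l *\<^sub>R a"
proof -
  have za: "z$1 * a$1 + z$2 * a$2 = 0" and zb: "z$1 * b$1 + z$2 * b$2 = 0"
    using assms(3,4) by (simp_all add: inner_vec_def sum_2)
  have det: "a$1 * b$2 = a$2 * b$1"
  proof (cases "z$1 = 0")
    case True
    then have "z$2 \<noteq> 0" using assms(2) by (auto simp: vec_eq_iff forall_2)
    then show ?thesis using za zb True by simp
  next
    case False
    have "z$1 * (a$1 * b$2) = z$1 * (a$2 * b$1)" using za zb by algebra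
    then show ?thesis using False by simp
  qed
  show thesis
  proof (cases "a$1 = 0")
    case True
    then have a2: "a$2 \<noteq> 0" using assms(1) by (auto simp: vec_eq_iff forall_2)
    then have "b$1 = 0" using det True by simp
    then have "b = (b$2 / a$2) *\<^sub>R a" using True a2 by (auto simp: vec_eq_iff forall_2)
    then show thesis by (rule that)
  next
    case False
    then have "b = (b$1 / a$1) *\<^sub>R a" using det by (auto simp: vec_eq_iff forall_2 field_simps)
    then show thesis by (rule that)
  qed
qed

context simple_nested_fractal
begin

lemma reflection_image_K:
  assumes "p \<in> V" "q \<in> V" "p \<noteq> q" shows "bisector_reflection p q ` K = K"
proof
  show "bisector_reflection p q ` K \<subseteq> K" using reflection_K[OF assms] by blast
  show "K \<subseteq> bisector_reflection p q ` K"
  proof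
    fix x assume "x \<in> K"
    then have "bisector_reflection p q x \<in> K" using reflection_K[OF assms] by blast
    then show "x \<in> bisector_reflection p q ` K"
      using bisector_reflection_involution[OF assms(3), of x] by (metis imageI)
  qed
qed

lemma isometry_fixing_vertices:
  assumes "affine_isometry T" "\<And>v. v \<in> V \<Longrightarrow> T v = v" "x \<in> K"
  shows "T x = x"
proof -
  obtain A where A: "orthogonal_transformation A" "\<And>x y. T x - T y = A (x - y)"
    using assms(1) unfolding affine_isometry_def by blast
  obtain p where p: "p \<in> V" using V_nonempty by blast
  define f where "f z = A z - z" for z
  have "linear f" unfolding f_def
    by (intro linear_compose_sub orthogonal_transformation_linear A linear_id[unfolded id_def])
  moreover have "f (v - p) = 0" if "v \<in> V" for v
    using A(2)[of v p] assms(2) that p by (simp add: f_def)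
  ultimately have "f (x - p) = 0" using linear_vanish_K p assms(3) by blast
  then show ?thesis using A(2)[of x p] assms(2)[OF p] by (simp add: f_def)
qed

lemma isometry_centroid:
  assumes T: "affine_isometry T" "\<And>v. v \<in> V \<Longrightarrow> T v \<in> V"
  shows "T centroid = centroid"
proof -
  obtain A where A: "orthogonal_transformation A" "\<And>x y. T x - T y = A (x - y)"
    using assms(1) unfolding affine_isometry_def by blast
  have inj: "inj T"
    by (rule injI) (metis T(1) affine_isometry_dist dist_eq_0_iff)
  have injV: "inj_on T V" using inj inj_on_subset by blast
  have "T ` V = V"
    by (rule card_subset_eq[OF finite_V]) (use T(2) card_image[OF injV] in auto)
  then have eq: "T ` V = id ` V" by simp
  have "T z = A z + T 0" for z using A(2)[of z 0] by (simp add: algebra_simps)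
  from sum_image_affine_eq[OF finite_V V_nonempty injV _ eq this, where B = id and b = 0]
  show ?thesis using orthogonal_transformation_linear[OF A(1)] by (simp add: centroid_def linear_id)
qed

lemma vertex_neq_centroid: assumes "p \<in> V" shows "p \<noteq> centroid"
proof
  assume eq: "p = centroid"
  obtain q where q: "q \<in> V" "q \<noteq> p"
    using essential_partner[OF assms] by metis
  then show False using norm_centroid_vertex[OF assms q(1)] eq by simp
qed

text \<open>If \<open>T\<close> moves an essential fixed point \<open>x\<close>, then \<open>T\<close> followed by the reflection exchanging \<open>x\<close> and \<open>T x\<close>
fixes \<open>p\<close>, \<open>x\<close> and the centroid. These are not collinear, as otherwise \<open>T\<close> would fix \<open>x\<close>; so the
composition fixes all essential fixed points, hence the attractor, which the reflection preserves.\<close>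

lemma isometry_fixing_vertex_image_K:
  assumes T: "affine_isometry T" "\<And>v. v \<in> V \<Longrightarrow> T v \<in> V" and p: "p \<in> V" "T p = p"
  shows "T ` K = K"
proof (cases "\<forall>v\<in>V. T v = v")
  case True
  then have "T x = x" if "x \<in> K" for x using isometry_fixing_vertices[OF T(1) _ that] by blast
  then show ?thesis by force
next
  case False
  then obtain x where x: "x \<in> V" "T x \<noteq> x" by blast
  obtain A where A: "orthogonal_transformation A" "\<And>x y. T x - T y = A (x - y)"
    using T(1) unfolding affine_isometry_def by blast
  have Tw: "T centroid = centroid" using isometry_centroid[OF T] .
  let ?S = "bisector_reflection x (T x)"
  have S: "affine_isometry ?S" by (rule affine_isometry_bisector_reflection)
  define T' where "T' = ?S \<circ> T"
  have TxV: "T x \<in> V" "x \<noteq> T x" using T(2) x by auto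
  have T': "affine_isometry T'" unfolding T'_def by (rule affine_isometry_compose[OF S T(1)])
  have T'V: "T' v \<in> V" if "v \<in> V" for v
    unfolding T'_def using reflection_V[OF x(1) TxV] T(2)[OF that] by simp
  have T'w: "T' centroid = centroid" using isometry_centroid[OF T' T'V] .
  have T'x: "T' x = x" unfolding T'_def using bisector_reflection_swap(2)[OF TxV(2)] by simp
  have "dist x p = dist (T x) p" using affine_isometry_dist[OF T(1), of x p] p(2) by simp
  then have "?S p = p" by (intro bisector_reflection_fixed) (simp add: dist_norm norm_minus_commute)
  then have T'p: "T' p = p" unfolding T'_def using p by simp
  obtain B where B: "orthogonal_transformation B" "\<And>x y. T' x - T' y = B (x - y)"
    using T' unfolding affine_isometry_def by blast
  have Bin: "B u \<bullet> B v = u \<bullet> v" for u v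
    using B(1) by (simp add: orthogonal_transformation_def)
  have "T' v = v" if "v \<in> V" for v
  proof (rule ccontr)
    assume ne: "T' v \<noteq> v"
    have *: "(T' v - v) \<bullet> (q - centroid) = 0" if "T' q = q" for q
    proof -
      have "(T' v - centroid) \<bullet> (q - centroid) = (v - centroid) \<bullet> (q - centroid)"
        using Bin[of "v - centroid" "q - centroid"] B(2)[of v centroid] B(2)[of q centroid] that T'w by simp
      then show ?thesis by (simp add: inner_diff_left)
    qed
    have "p - centroid \<noteq> 0" "T' v - v \<noteq> 0" using vertex_neq_centroid[OF p(1)] ne by auto
    from inner_zero_parallel[OF this *[OF T'p] *[OF T'x]]
    obtain l where l: "x - centroid = l *\<^sub>R (p - centroid)" .
    have "T x - centroid = A (x - centroid)" using A(2)[of x centroid] Tw by simp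
    also have "\<dots> = l *\<^sub>R A (p - centroid)"
      using l A(1) by (simp add: linear_scale[OF orthogonal_transformation_linear])
    also have "A (p - centroid) = p - centroid" using A(2)[of p centroid] Tw p by simp
    finally have "T x - centroid = x - centroid" using l by simp
    then show False using x(2) by simp
  qed
  then have "T' y = y" if "y \<in> K" for y using isometry_fixing_vertices[OF T' _ that] by blast
  then have T'K: "T' ` K = K" by force
  have "T ` K = ?S ` T' ` K"
    unfolding T'_def image_comp[symmetric] image_image
    by (simp add: bisector_reflection_involution[OF TxV(2)])
  then show ?thesis using T'K reflection_image_K[OF x(1) TxV] by simp
qed

text \<open>A reflection brings the image of an essential fixed point back to that point, which reduces the claim to
\<open>isometry_fixing_vertex_image_K\<close>.\<close>

lemma isometry_image_K:
  assumes T: "affine_isometry T" "\<And>v. v \<in> V \<Longrightarrow> T v \<in> V"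
  shows "T ` K = K"
proof -
  obtain p where p: "p \<in> V" using V_nonempty by blast
  show ?thesis
  proof (cases "T p = p")
    case True
    then show ?thesis using isometry_fixing_vertex_image_K[OF T p] by simp
  next
    case False
    then have pq: "p \<in> V" "T p \<in> V" "p \<noteq> T p" using T(2) p by auto
    let ?S = "bisector_reflection p (T p)"
    have "(?S \<circ> T) ` K = K"
      by (rule isometry_fixing_vertex_image_K[OF affine_isometry_compose[OF affine_isometry_bisector_reflection T(1)] _ p])
        (use reflection_V[OF pq] T(2) bisector_reflection_swap(2)[OF pq(3)] in auto)
    then have "?S ` (?S \<circ> T) ` K = K" using reflection_image_K[OF pq] by simp
    moreover have "?S ` (?S \<circ> T) ` K = T ` K"
      unfolding image_comp[symmetric] image_image by (simp add: bisector_reflection_involution[OF pq(3)])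
    ultimately show ?thesis by simp
  qed
qed

text \<open>The letters of a word are the indices in the sum that defines the vector of a complex, the letter of the
smallest power of \<open>L\<close> first; the result is the vector in units of \<open>L\<^sup>M\<close>.\<close>

primrec word_shift :: "nat list \<Rightarrow> real^2" where
  "word_shift [] = 0"
| "word_shift (a # u) = L *\<^sub>R (transl F a + word_shift u)"

definition "shifts = word_shift ` lists I"

lemma transl_Suc0: "transl F (Suc 0) = 0" using transl_1 by simp

lemma word_shift_append: "word_shift (u @ v) = word_shift u + (L ^ length u) *\<^sub>R word_shift v"
  by (induction u) (auto simp: algebra_simps)

lemma word_shift_pad: "word_shift (u @ replicate n 1) = word_shift u"
proof -
  have "word_shift (replicate n 1) = 0" by (induction n) (auto simp: transl_Suc0)
  then show ?thesis by (simp add: word_shift_append)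
qed

lemma lists_pad: "u \<in> lists I \<Longrightarrow> u @ replicate n 1 \<in> lists I"
  using one_in_I by (induction n) auto

lemma shifts_words:
  assumes "finite W" "W \<subseteq> shifts"
  shows "\<exists>n\<ge>j. \<forall>v\<in>W. \<exists>u\<in>lists I. length u = n \<and> word_shift u = v"
  using assms
proof (induction W rule: finite_induct)
  case empty then show ?case by auto
next
  case (insert v W)
  then obtain n where n: "n \<ge> j" "\<forall>v\<in>W. \<exists>u\<in>lists I. length u = n \<and> word_shift u = v" by auto
  obtain u where u: "u \<in> lists I" "v = word_shift u" using insert unfolding shifts_def by auto
  define m where "m = max n (length u)"
  have pad: "\<exists>u'\<in>lists I. length u' = m \<and> word_shift u' = word_shift u" if "u \<in> lists I" "length u \<le> m" for u
    using that lists_pad[of u "m - length u"] word_shift_pad[of u "m - length u"]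
    by (intro bexI[of _ "u @ replicate (m - length u) 1"]) auto
  show ?case
  proof (intro exI[of _ m] conjI ballI)
    show "m \<ge> j" using n m_def by auto
    fix x assume "x \<in> insert v W"
    then obtain u' where "u' \<in> lists I" "length u' \<le> m" "word_shift u' = x"
      using n(2) u m_def by (metis insert_iff max.cobounded1 max.cobounded2)
    then show "\<exists>u\<in>lists I. length u = m \<and> word_shift u = x" using pad by blast
  qed
qed

lemma shifts_words_pair:
  assumes "v \<in> shifts" "v' \<in> shifts"
  obtains u u' where "u \<in> lists I" "u' \<in> lists I" "length u = length u'" "word_shift u = v" "word_shift u' = v'"
proof -
  obtain n where n: "\<forall>v\<in>{v, v'}. \<exists>u\<in>lists I. length u = n \<and> word_shift u = v"
    using shifts_words[of "{v, v'}" 0] assms by blast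
  then obtain u u' where "u \<in> lists I" "length u = n" "word_shift u = v" "u' \<in> lists I" "length u' = n" "word_shift u' = v'"
    by (metis insertI1 insertI2)
  then show thesis by (intro that[of u u']) simp_all
qed

text \<open>The similitude of the cell with address \<open>u\<close>. It acts on all of the plane, where \<open>U\<close> need not be the
identity, and is needed since the open set condition speaks of the maps outside of the attractor, too.\<close>

primrec cell_map :: "nat list \<Rightarrow> real^2 \<Rightarrow> real^2" where
  "cell_map [] = id"
| "cell_map (a # u) = cell_map u \<circ> \<Psi> a"

lemma U_pow: "linear (U ^^ n)" "norm ((U ^^ n) x) = norm x"
  "k \<in> K \<Longrightarrow> (U ^^ n) k = k"
proof -
  show "linear (U ^^ n)"
  proof (induction n)
    case (Suc n) then show ?case using linear_compose[OF Suc linear_U] by (simp only: funpow.simps)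
  qed (simp add: linear_id flip: id_def)
  show "norm ((U ^^ n) x) = norm x" by (induction n) (auto simp: norm_U)
  show "k \<in> K \<Longrightarrow> (U ^^ n) k = k" by (induction n) (auto simp: U_id_on_K)
qed

lemma cell_map_word_shift:
  "u \<in> lists I \<Longrightarrow> cell_map u x = (1 / L ^ length u) *\<^sub>R ((U ^^ length u) x + word_shift u)"
proof (induction u arbitrary: x)
  case (Cons a u)
  let ?n = "length u"
  have "cell_map (a # u) x = (1 / L ^ ?n) *\<^sub>R ((U ^^ ?n) (\<Psi> a x) + word_shift u)" using Cons by simp
  also have "(U ^^ ?n) (\<Psi> a x) = (1/L) *\<^sub>R (U ^^ ?n) (U x) + transl F a"
    using Cons U_pow(3)[OF transl_in_K, of a ?n]
    by (simp add: simil_affine linear_add[OF U_pow(1)] linear_scale[OF U_pow(1)])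
  also have "(1 / L ^ ?n) *\<^sub>R ((1/L) *\<^sub>R (U ^^ ?n) (U x) + transl F a + word_shift u)
      = (1 / L ^ length (a # u)) *\<^sub>R ((U ^^ length (a # u)) x + word_shift (a # u))"
    using L_pos by (simp add: funpow_swap1 scaleR_add_right)
  finally show ?case .
qed simp

lemma inj_cell_map: "inj (cell_map u)"
proof (induction u)
  case (Cons a u) then show ?case using inj_compose[OF Cons inj_simil] by (simp only: cell_map.simps)
qed simp

lemma cell_map_disjoint:
  assumes W: "\<forall>i\<in>I. \<forall>j\<in>I. i \<noteq> j \<longrightarrow> \<Psi> i ` W \<inter> \<Psi> j ` W = {}" "\<forall>i\<in>I. \<Psi> i ` W \<subseteq> W"
    and "length u = length u'" "u \<in> lists I" "u' \<in> lists I" "u \<noteq> u'"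
  shows "cell_map u ` W \<inter> cell_map u' ` W = {}"
  using assms(3-)
proof (induction u u' rule: list_induct2)
  case (Cons a u b u')
  show ?case
  proof (cases "u = u'")
    case True
    then have ab: "a \<noteq> b" "a \<in> I" "b \<in> I" using Cons by auto
    then have "\<Psi> a ` W \<inter> \<Psi> b ` W = {}" using W(1) by blast
    then have "cell_map u ` (\<Psi> a ` W) \<inter> cell_map u ` (\<Psi> b ` W) = {}"
      using image_Int[OF inj_cell_map] by (metis image_empty)
    then show ?thesis using True by (simp add: image_comp)
  next
    case False
    then have "cell_map u ` W \<inter> cell_map u' ` W = {}" using Cons by auto
    moreover have "\<Psi> a ` W \<subseteq> W" "\<Psi> b ` W \<subseteq> W" using Cons W(2) by auto
    moreover have "cell_map (a # u) ` W = cell_map u ` \<Psi> a ` W" "cell_map (b # u') ` W = cell_map u' ` \<Psi> b ` W"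
      by (simp_all add: image_comp)
    ultimately show ?thesis by (simp only:) blast
  qed
qed simp

text \<open>The open set contains a ball, and its images under the maps of different words of equal length are disjoint
balls with centres that differ by a multiple of the difference of the vectors.\<close>

lemma shifts_separated:
  obtains \<rho> where "\<rho> > 0"
    "\<forall>u\<in>lists I. \<forall>u'\<in>lists I. length u = length u' \<longrightarrow> u \<noteq> u' \<longrightarrow> \<rho> \<le> dist (word_shift u) (word_shift u')"
proof -
  obtain W where W: "open W" "W \<noteq> {}"
    "\<forall>i\<in>I. \<forall>j\<in>I. i \<noteq> j \<longrightarrow> \<Psi> i ` W \<inter> \<Psi> j ` W = {}" "\<forall>i\<in>I. \<Psi> i ` W \<subseteq> W"
    by (rule osc)
  obtain z \<rho> where z: "\<rho> > 0" "ball z \<rho> \<subseteq> W" using W(1,2) open_contains_ball by blast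
  have "\<rho> \<le> dist (word_shift u) (word_shift u')" if u: "u \<in> lists I" "u' \<in> lists I" "length u = length u'" "u \<noteq> u'" for u u'
  proof (rule ccontr)
    assume lt: "\<not> ?thesis"
    let ?n = "length u"
    have "surj U" using isometry orthogonal_transformation_surj by blast
    then have "surj (U ^^ ?n)" by (rule surj_fn)
    then obtain y where y: "(U ^^ ?n) y = word_shift u' - word_shift u" by (metis surjD)
    have "norm y < \<rho>" using lt U_pow(2)[of ?n y] y by (simp add: dist_norm norm_minus_commute)
    then have "z + y \<in> W" "z \<in> W" using z by (auto simp: dist_norm)
    moreover have "cell_map u (z + y) = cell_map u' z"
      using u y by (simp add: cell_map_word_shift linear_add[OF U_pow(1)])
    ultimately show False using cell_map_disjoint[OF W(3,4) u(3,1,2,4)] by blast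
  qed
  then show thesis using that z(1) by blast
qed

text \<open>By padding, finitely many vectors come from words of one length, so they are separated.\<close>

lemma finite_shifts_bounded_card:
  obtains P where "P > 0" "\<forall>W. finite W \<longrightarrow> W \<subseteq> shifts \<longrightarrow> (\<forall>v\<in>W. norm v \<le> R) \<longrightarrow> real (card W) \<le> P"
proof -
  obtain \<rho> where \<rho>: "\<rho> > 0"
    "\<forall>u\<in>lists I. \<forall>u'\<in>lists I. length u = length u' \<longrightarrow> u \<noteq> u' \<longrightarrow> \<rho> \<le> dist (word_shift u) (word_shift u')"
    by (rule shifts_separated)
  define R' where "R' = max R 0"
  have "real (card W) \<le> (1 + 2 * R' / \<rho>)\<^sup>2" if "finite W" "W \<subseteq> shifts" "\<forall>v\<in>W. norm v \<le> R" for W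
  proof (rule packing_bound[OF that(1) _ \<rho>(1)])
    show "W \<subseteq> cball 0 R'" using that(3) unfolding R'_def by (auto simp: le_max_iff_disj)
    show "\<rho> \<le> dist x y" if "x \<in> W" "y \<in> W" "x \<noteq> y" for x y
    proof -
      have "x \<in> shifts" "y \<in> shifts" using that \<open>W \<subseteq> shifts\<close> by auto
      then obtain u u' where "u \<in> lists I" "u' \<in> lists I" "length u = length u'" "word_shift u = x" "word_shift u' = y"
        by (rule shifts_words_pair)
      then show ?thesis using \<rho>(2) that(3) by blast
    qed
  qed (simp add: R'_def)
  moreover have "(1 + 2 * R' / \<rho>)\<^sup>2 > 0"
  proof -
    have "R' / \<rho> \<ge> 0" using \<rho>(1) by (simp add: R'_def)
    then show ?thesis by (intro zero_less_power) linarith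
  qed
  ultimately show thesis using that by blast
qed

lemma word_shift_inj:
  "u \<in> lists I \<Longrightarrow> u' \<in> lists I \<Longrightarrow> length u = length u' \<Longrightarrow> word_shift u = word_shift u' \<Longrightarrow> u = u'"
  using shifts_separated by (metis dist_self linorder_not_less)

text \<open>Some bound for the attractor, to be used in all estimates.\<close>

definition "\<kappa> = (SOME B. B > 0 \<and> (\<forall>x\<in>K. norm x \<le> B))"

lemma \<kappa>: "\<kappa> > 0" "x \<in> K \<Longrightarrow> norm x \<le> \<kappa>"
proof -
  have "\<exists>B. B > 0 \<and> (\<forall>x\<in>K. norm x \<le> B)"
    using compact_imp_bounded[OF attractor_K(1)] by (simp add: bounded_pos)
  from someI_ex[OF this] show "\<kappa> > 0" "x \<in> K \<Longrightarrow> norm x \<le> \<kappa>" unfolding \<kappa>_def by auto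
qed

lemma K_dist: "x \<in> K \<Longrightarrow> y \<in> K \<Longrightarrow> norm (x - y) \<le> 2 * \<kappa>"
  using \<kappa>(2)[of x] \<kappa>(2)[of y] norm_triangle_ineq4[of x y] by linarith

lemma K_child: "i \<in> I \<Longrightarrow> k \<in> K \<Longrightarrow> (1/L) *\<^sub>R k + transl F i \<in> K"
  using simil_in_K simil_on_K by metis

lemma K_in_parent: assumes "k \<in> K" obtains i k' where "i \<in> I" "k' \<in> K" "L *\<^sub>R k = k' + L *\<^sub>R transl F i"
proof -
  obtain i k' where ik: "i \<in> I" "k' \<in> K" "k = \<Psi> i k'" using in_K_cases[OF assms] .
  have "L *\<^sub>R k = k' + L *\<^sub>R transl F i"
    using simil_on_K[OF ik(2)] ik(3) L_pos by (simp add: scaleR_add_right)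
  then show thesis using that ik by blast
qed

lemma add_word_shift_in_scaled_K:
  "u \<in> lists I \<Longrightarrow> k \<in> K \<Longrightarrow> \<exists>k'\<in>K. k + word_shift u = (L ^ length u) *\<^sub>R k'"
proof (induction u arbitrary: k)
  case (Cons a u)
  have "(1/L) *\<^sub>R k + transl F a \<in> K" using Cons K_child by auto
  then obtain k' where k': "k' \<in> K" "(1/L) *\<^sub>R k + transl F a + word_shift u = (L ^ length u) *\<^sub>R k'"
    using Cons by auto
  have "k + word_shift (a # u) = L *\<^sub>R ((1/L) *\<^sub>R k + transl F a + word_shift u)"
    using L_pos by (simp add: scaleR_add_right)
  then show ?case using k' by (auto intro!: bexI[of _ k'])
qed auto

lemma scaled_K_covered:
  "k \<in> K \<Longrightarrow> \<exists>u\<in>lists I. length u = n \<and> (L ^ n) *\<^sub>R k - word_shift u \<in> K"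
proof (induction n arbitrary: k)
  case 0 then show ?case by (auto intro!: bexI[of _ "[]"])
next
  case (Suc n)
  obtain i k' where ik: "i \<in> I" "k' \<in> K" "L *\<^sub>R k = k' + L *\<^sub>R transl F i" using K_in_parent[OF Suc(2)] .
  obtain u where u: "u \<in> lists I" "length u = n" "(L ^ n) *\<^sub>R k' - word_shift u \<in> K" using Suc(1)[OF ik(2)] by blast
  have "(L ^ Suc n) *\<^sub>R k = (L ^ n) *\<^sub>R (L *\<^sub>R k)" by (simp add: mult.commute)
  also have "\<dots> = (L ^ n) *\<^sub>R k' + (L ^ n) *\<^sub>R word_shift [i]" unfolding ik(3) by (simp add: scaleR_add_right)
  finally have "(L ^ Suc n) *\<^sub>R k - word_shift (u @ [i]) = (L ^ n) *\<^sub>R k' - word_shift u" using u by (simp add: word_shift_append)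
  then show ?case using u ik by (intro bexI[of _ "u @ [i]"]) auto
qed

text \<open>Nesting for cells of any depth, by induction: if the parents differ, the common point is a vertex of both
parents, and a vertex of a cell lies in one of its children only, as a vertex of this child.\<close>

lemma nesting_words:
  assumes "length u = length u'" "u \<in> lists I" "u' \<in> lists I" "u \<noteq> u'"
    "x - word_shift u \<in> K" "x - word_shift u' \<in> K"
  shows "x - word_shift u \<in> V \<and> x - word_shift u' \<in> V"
  using assms
proof (induction u u' arbitrary: x rule: list_induct2)
  case (Cons a u b u')
  define k where "k = x - word_shift (a # u)"
  define k' where "k' = x - word_shift (b # u')"
  have kk: "k \<in> K" "k' \<in> K" using Cons by (auto simp: k_def k'_def)
  have ab: "a \<in> I" "b \<in> I" using Cons by auto
  have y: "(1/L) *\<^sub>R x - word_shift u = \<Psi> a k" "(1/L) *\<^sub>R x - word_shift u' = \<Psi> b k'"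
    using L_pos kk by (simp_all add: simil_on_K) (simp_all add: k_def k'_def scaleR_diff_right scaleR_add_right)
  have yK: "(1/L) *\<^sub>R x - word_shift u \<in> K" "(1/L) *\<^sub>R x - word_shift u' \<in> K"
    unfolding y using simil_in_K ab kk by auto
  show ?case
  proof (cases "u = u'")
    case True
    then have "a \<noteq> b" using Cons by auto
    moreover have eq: "\<Psi> a k = \<Psi> b k'" using y True by simp
    ultimately have "\<Psi> a k \<in> \<Psi> a ` V" "\<Psi> b k' \<in> \<Psi> b ` V"
      using nesting_I[OF ab] kk by (metis IntD1 IntD2 IntI imageI)+
    then show ?thesis using simil_eq_iff unfolding k_def k'_def by auto
  next
    case False
    then have V: "\<Psi> a k \<in> V" "\<Psi> b k' \<in> V" using Cons.IH[of "(1/L) *\<^sub>R x"] Cons.prems yK y by auto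
    have vk: "k \<in> V" if "k \<in> K" "a \<in> I" "\<Psi> a k \<in> V" for k a
    proof -
      note ak = that
      obtain c where "c \<in> I" "\<Psi> c (\<Psi> a k) = \<Psi> a k" using V_fixed[OF ak(3)] .
      then have "k = \<Psi> a k" using vertex_in_cell(2)[OF ak(3) _ _ ak(2,1)] by blast
      then show ?thesis using ak by simp
    qed
    show ?thesis using vk[OF kk(1) ab(1) V(1)] vk[OF kk(2) ab(2) V(2)] unfolding k_def k'_def by simp
  qed
qed simp

text \<open>If the parents meet, they differ by the difference of two essential fixed points, so that the two cells are
in one of finitely many relative positions, each of which has a positive distance unless the cells meet. If
the parents are disjoint, their distance bounds that of their children from below.\<close>

lemma separation_words:
  obtains c where "c > 0"
    "\<forall>u\<in>lists I. \<forall>u'\<in>lists I. \<forall>x y. length u = length u' \<longrightarrow> x - word_shift u \<in> K \<longrightarrow> y - word_shift u' \<in> K \<longrightarrow>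
       (\<exists>z. z - word_shift u \<in> K \<and> z - word_shift u' \<in> K) \<or> c \<le> norm (x - y)"
proof -
  \<comment> \<open>the possible differences of the vectors of cells whose parents meet or coincide\<close>
  define Y where "Y = (\<lambda>(a, b, p, q). L *\<^sub>R (transl F a - transl F b + (q - p))) ` (I \<times> I \<times> V \<times> V)"
  have finY: "finite Y" unfolding Y_def using finite_I finite_V by simp
  have "\<exists>d>0. (\<forall>k\<in>K. \<forall>k'\<in>K. k + \<delta> \<noteq> k') \<longrightarrow> (\<forall>k\<in>K. \<forall>k'\<in>K. d \<le> norm (k + \<delta> - k'))" for \<delta>
  proof (cases "\<forall>k\<in>K. \<forall>k'\<in>K. k + \<delta> \<noteq> k'")
    case True
    have "compact ((\<lambda>k. k + \<delta>) ` K)" by (intro compact_continuous_image continuous_intros attractor_K(1))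
    moreover have "(\<lambda>k. k + \<delta>) ` K \<inter> K = {}" using True by blast
    ultimately obtain d where "d > 0" "\<And>x y. x \<in> (\<lambda>k. k + \<delta>) ` K \<Longrightarrow> y \<in> K \<Longrightarrow> d \<le> dist x y"
      using separate_compact_closed attractor_K(1) compact_imp_closed by metis
    then show ?thesis by (intro exI[of _ d]) (auto simp: dist_norm)
  next
    case False
    then show ?thesis by (intro exI[of _ "1::real"] conjI zero_less_one impI) blast
  qed
  then obtain d where d: "\<And>\<delta>. d \<delta> > 0"
    "\<And>\<delta>. (\<forall>k\<in>K. \<forall>k'\<in>K. k + \<delta> \<noteq> k') \<Longrightarrow> (\<forall>k\<in>K. \<forall>k'\<in>K. d \<delta> \<le> norm (k + \<delta> - k'))" by metis
  define c where "c = Min (insert 1 (d ` Y))"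
  have c: "c > 0" "\<And>\<delta>. \<delta> \<in> Y \<Longrightarrow> c \<le> d \<delta>" unfolding c_def using finY d(1) by auto
  have main: "(\<exists>z. z - word_shift u \<in> K \<and> z - word_shift u' \<in> K) \<or> c \<le> norm (x - y)"
    if "length u = length u'" "u \<in> lists I" "u' \<in> lists I" "x - word_shift u \<in> K" "y - word_shift u' \<in> K" for u u' x y
    using that
  proof (induction u u' arbitrary: x y rule: list_induct2)
    case Nil
    then show ?case using zero_in_K by auto
  next
    case (Cons a u b u')
    have ab: "a \<in> I" "b \<in> I" and uI: "u \<in> lists I" "u' \<in> lists I" using Cons by auto
    have L1: "(1/L) *\<^sub>R (x - word_shift (a # u)) + transl F a = (1/L) *\<^sub>R x - word_shift u"
      "(1/L) *\<^sub>R (y - word_shift (b # u')) + transl F b = (1/L) *\<^sub>R y - word_shift u'"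
      using L_pos by (simp_all add: scaleR_diff_right scaleR_add_right)
    have yK: "(1/L) *\<^sub>R x - word_shift u \<in> K" "(1/L) *\<^sub>R y - word_shift u' \<in> K"
      using K_child[OF ab(1)] K_child[OF ab(2)] Cons.prems L1 by metis+
    have parents: "(\<exists>z. z - word_shift u \<in> K \<and> z - word_shift u' \<in> K) \<or> c \<le> norm ((1/L) *\<^sub>R x - (1/L) *\<^sub>R y)"
      using Cons.IH uI yK by blast
    show ?case
    proof (cases "\<exists>z. z - word_shift u \<in> K \<and> z - word_shift u' \<in> K")
      case True
      then obtain z where z: "z - word_shift u \<in> K" "z - word_shift u' \<in> K" by blast
      have "\<exists>p\<in>V. \<exists>q\<in>V. word_shift u - word_shift u' = q - p"
      proof (cases "u = u'")
        case True then show ?thesis using V_nonempty by auto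
      next
        case False
        then have "z - word_shift u \<in> V" "z - word_shift u' \<in> V" using nesting_words[OF Cons.hyps uI False z] by auto
        then show ?thesis by (intro bexI[of _ "z - word_shift u"] bexI[of _ "z - word_shift u'"]) auto
      qed
      then obtain p q where pq: "p \<in> V" "q \<in> V" "word_shift u - word_shift u' = q - p" by blast
      define \<delta> where "\<delta> = word_shift (a # u) - word_shift (b # u')"
      have "\<delta> = L *\<^sub>R (transl F a - transl F b + (word_shift u - word_shift u'))"
        by (simp add: \<delta>_def scaleR_diff_right scaleR_add_right)
      also have "\<dots> = (\<lambda>(a, b, p, q). L *\<^sub>R (transl F a - transl F b + (q - p))) (a, b, p, q)"
        using pq by simp
      finally have "\<delta> \<in> Y" unfolding Y_def using ab pq by (metis (no_types, lifting) SigmaI imageI)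
      show ?thesis
      proof (cases "\<forall>k\<in>K. \<forall>k'\<in>K. k + \<delta> \<noteq> k'")
        case True
        from d(2)[OF True] have "d \<delta> \<le> norm (x - word_shift (a # u) + \<delta> - (y - word_shift (b # u')))"
          using Cons.prems by blast
        then show ?thesis using c(2)[OF \<open>\<delta> \<in> Y\<close>] by (simp add: \<delta>_def)
      next
        case False
        then obtain k k' where "k \<in> K" "k' \<in> K" "k + \<delta> = k'" by blast
        then have "(k + word_shift (a # u)) - word_shift (a # u) \<in> K \<and> (k + word_shift (a # u)) - word_shift (b # u') \<in> K"
          by (simp add: \<delta>_def add_diff_eq)
        then show ?thesis by blast
      qed
    next
      case False
      then have "c \<le> norm ((1/L) *\<^sub>R x - (1/L) *\<^sub>R y)" using parents by blast
      also have "\<dots> = norm ((1/L) *\<^sub>R (x - y))" by (simp only: scaleR_diff_right)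
      also have "\<dots> \<le> norm (x - y)" using scaling by (simp add: divide_le_eq mult_le_cancel_left1)
      finally show ?thesis by simp
    qed
  qed
  then show thesis using that c(1) by blast
qed

text \<open>Magnify until the distance of the two points is of the order of the size of the cells around them; any
common point of these smaller cells is close enough, and it is common to the given cells.\<close>

lemma meeting_words:
  obtains c C where "c > 0" "C > 0"
    "\<forall>u\<in>lists I. \<forall>u'\<in>lists I. \<forall>x y. length u = length u' \<longrightarrow> x - word_shift u \<in> K \<longrightarrow> y - word_shift u' \<in> K \<longrightarrow>
       c \<le> norm (x - y) \<or> (\<exists>z. z - word_shift u \<in> K \<and> z - word_shift u' \<in> K \<and> norm (x - z) + norm (y - z) \<le> C * norm (x - y))"
proof -
  obtain c where c: "c > 0"
    "\<forall>u\<in>lists I. \<forall>u'\<in>lists I. \<forall>x y. length u = length u' \<longrightarrow> x - word_shift u \<in> K \<longrightarrow> y - word_shift u' \<in> K \<longrightarrow>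
       (\<exists>z. z - word_shift u \<in> K \<and> z - word_shift u' \<in> K) \<or> c \<le> norm (x - y)" by (rule separation_words)
  define C where "C = 4 * \<kappa> * L / c"
  have C: "C > 0" unfolding C_def using \<kappa>(1) L_pos c(1) by simp
  have step: "c \<le> norm (x - y) \<or> (\<exists>z. z - word_shift u \<in> K \<and> z - word_shift u' \<in> K \<and> norm (x - z) + norm (y - z) \<le> C * norm (x - y))"
    if "u \<in> lists I" "u' \<in> lists I" "length u = length u'" "x - word_shift u \<in> K" "y - word_shift u' \<in> K" "c / L ^ m \<le> norm (x - y)"
    for u u' x y m
    using that
  proof (induction m arbitrary: u u' x y)
    case 0 then show ?case by simp
  next
    case (Suc m)
    show ?case
    proof (cases "c \<le> norm (x - y)")
      case False
      then obtain z where z: "z - word_shift u \<in> K" "z - word_shift u' \<in> K" using c(2) Suc.prems by blast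
      show ?thesis
      proof (cases "c / L \<le> norm (x - y)")
        case True
        have "norm (x - z) \<le> 2 * \<kappa>" "norm (y - z) \<le> 2 * \<kappa>"
          using K_dist[OF Suc.prems(4) z(1)] K_dist[OF Suc.prems(5) z(2)] by simp_all
        then have "norm (x - z) + norm (y - z) \<le> C * (c / L)"
          using L_pos c(1) by (simp add: C_def)
        also have "\<dots> \<le> C * norm (x - y)" using True C by (intro mult_left_mono) auto
        finally show ?thesis using z by blast
      next
        case small: False
        obtain a k where a: "a \<in> I" "k \<in> K" "L *\<^sub>R (x - word_shift u) = k + L *\<^sub>R transl F a"
          using K_in_parent[OF Suc.prems(4)] .
        obtain b k' where b: "b \<in> I" "k' \<in> K" "L *\<^sub>R (y - word_shift u') = k' + L *\<^sub>R transl F b"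
          using K_in_parent[OF Suc.prems(5)] .
        have "L *\<^sub>R x - word_shift (a # u) = k" using a(3) by (simp add: algebra_simps)
        moreover have "L *\<^sub>R y - word_shift (b # u') = k'" using b(3) by (simp add: algebra_simps)
        moreover have nL: "norm (L *\<^sub>R x - L *\<^sub>R y) = L * norm (x - y)"
          using L_pos by (simp flip: scaleR_diff_right)
        moreover have "c / L ^ m \<le> norm (L *\<^sub>R x - L *\<^sub>R y)"
          using Suc.prems(6) L_pos unfolding nL by (simp add: field_simps)
        ultimately have "c \<le> norm (L *\<^sub>R x - L *\<^sub>R y) \<or> (\<exists>z. z - word_shift (a # u) \<in> K \<and> z - word_shift (b # u') \<in> K \<and>
            norm (L *\<^sub>R x - z) + norm (L *\<^sub>R y - z) \<le> C * norm (L *\<^sub>R x - L *\<^sub>R y))"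
          using Suc.IH[of "a # u" "b # u'" "L *\<^sub>R x" "L *\<^sub>R y"] Suc.prems a b by auto
        moreover have "\<not> c \<le> norm (L *\<^sub>R x - L *\<^sub>R y)" using small L_pos unfolding nL by (simp add: field_simps)
        ultimately obtain z where z: "z - word_shift (a # u) \<in> K" "z - word_shift (b # u') \<in> K"
          "norm (L *\<^sub>R x - z) + norm (L *\<^sub>R y - z) \<le> C * norm (L *\<^sub>R x - L *\<^sub>R y)" by blast
        define z' where "z' = (1/L) *\<^sub>R z"
        have zz: "z = L *\<^sub>R z'" using L_pos by (simp add: z'_def)
        have "z' - word_shift u = (1/L) *\<^sub>R (z - word_shift (a # u)) + transl F a"
          "z' - word_shift u' = (1/L) *\<^sub>R (z - word_shift (b # u')) + transl F b"
          using L_pos by (simp_all add: z'_def scaleR_diff_right scaleR_add_right)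
        then have "z' - word_shift u \<in> K" "z' - word_shift u' \<in> K" using K_child a b z by metis+
        moreover have "norm (x - z') + norm (y - z') \<le> C * norm (x - y)"
        proof -
          have "L * (norm (x - z') + norm (y - z')) \<le> L * (C * norm (x - y))"
            using z(3) L_pos unfolding zz nL by (simp add: distrib_left algebra_simps flip: scaleR_diff_right)
          then show ?thesis using L_pos by simp
        qed
        ultimately show ?thesis by blast
      qed
    qed simp
  qed
  have main: "c \<le> norm (x - y) \<or> (\<exists>z. z - word_shift u \<in> K \<and> z - word_shift u' \<in> K \<and> norm (x - z) + norm (y - z) \<le> C * norm (x - y))"
    if "u \<in> lists I" "u' \<in> lists I" "length u = length u'" "x - word_shift u \<in> K" "y - word_shift u' \<in> K" for u u' x y
  proof (cases "x = y")
    case True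
    then show ?thesis using that by (auto intro!: exI[of _ x])
  next
    case False
    have "(\<lambda>n. c / L ^ n) \<longlonglongrightarrow> 0" using scaling by (intro LIMSEQ_divide_realpow_zero)
    then have "eventually (\<lambda>n. c / L ^ n < norm (x - y)) sequentially"
      using False by (simp add: order_tendsto_iff)
    then obtain m where "c / L ^ m < norm (x - y)" by (auto simp: eventually_sequentially)
    then show ?thesis using step[OF that, of m] by simp
  qed
  show thesis by (rule that[OF c(1) C]) (use main in blast)
qed

end

section \<open>Counting complexes\<close>

lemma power_div_fact_le_exp:
  fixes x :: real
  assumes "x \<ge> 0" shows "x ^ n / fact n \<le> exp x"
proof -
  have s: "(\<lambda>n. x ^ n / fact n) sums exp x"
    using exp_converges[of x] by (simp add: divide_inverse mult.commute)
  have "(\<Sum>k\<in>{n}. x ^ k / fact k) \<le> (\<Sum>k. x ^ k / fact k)"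
    using assms by (intro sum_le_suminf sums_summable[OF s]) auto
  then show ?thesis using sums_unique[OF s] by simp
qed

text \<open>\<open>exp (a * x powr \<beta>)\<close> is at least the \<open>n\<close>th term of its series, where \<open>n * \<beta> \<ge> q\<close>.\<close>

lemma exp_neg_powr_le:
  assumes "a > 0" "\<beta> > 0" "q \<ge> (0::real)"
  obtains C where "C > 0" "\<forall>x\<ge>(0::real). exp (- a * x powr \<beta>) \<le> C * (1 + x) powr (- q)"
proof -
  obtain n :: nat where n: "q / \<beta> \<le> real n" using real_arch_simple by blast
  define C where "C = 2 powr q * (1 + fact n / a ^ n)"
  have C: "C > 0" unfolding C_def using assms(1) by (intro mult_pos_pos add_pos_nonneg) auto
  have "exp (- a * x powr \<beta>) \<le> C * (1 + x) powr (- q)" if x: "x \<ge> 0" for x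
  proof -
    have "exp (- a * x powr \<beta>) * (1 + x) powr q \<le> C"
    proof (cases "x \<le> 1")
      case True
      have "exp (- a * x powr \<beta>) \<le> 1" using assms(1) by simp
      moreover have "(1 + x) powr q \<le> 2 powr q" using True x assms(3) by (intro powr_mono2) auto
      ultimately have "exp (- a * x powr \<beta>) * (1 + x) powr q \<le> 1 * 2 powr q"
        by (intro mult_mono) auto
      also have "\<dots> \<le> C" unfolding C_def using assms(1) by (simp add: distrib_left)
      finally show ?thesis .
    next
      case False
      then have x1: "x > 1" by simp
      have "(1 + x) powr q \<le> (2 * x) powr q" using x1 assms(3) by (intro powr_mono2) auto
      also have "\<dots> = 2 powr q * x powr q" using x1 by (simp add: powr_mult)
      also have "x powr q \<le> x powr (\<beta> * real n)"
        using n x1 assms(2) by (intro powr_mono) (auto simp: field_simps)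
      also have "x powr (\<beta> * real n) = (x powr \<beta>) ^ n"
        using x1 by (simp add: powr_powr[symmetric] powr_realpow)
      also have "\<dots> = (a * x powr \<beta>) ^ n / a ^ n" using assms(1) by (simp add: power_mult_distrib)
      also have "(a * x powr \<beta>) ^ n \<le> fact n * exp (a * x powr \<beta>)"
      proof -
        have "(a * x powr \<beta>) ^ n / fact n \<le> exp (a * x powr \<beta>)"
          using assms(1) by (intro power_div_fact_le_exp) simp
        then show ?thesis by (simp add: field_simps)
      qed
      finally have "(1 + x) powr q \<le> 2 powr q * (fact n * exp (a * x powr \<beta>) / a ^ n)"
        using assms(1) by (simp add: divide_right_mono mult_left_mono)
      then have "exp (- a * x powr \<beta>) * (1 + x) powr q
          \<le> exp (- a * x powr \<beta>) * (2 powr q * (fact n * exp (a * x powr \<beta>) / a ^ n))"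
        by (intro mult_left_mono) auto
      also have "\<dots> = 2 powr q * (fact n / a ^ n)" by (simp add: exp_minus field_simps)
      also have "\<dots> \<le> C" unfolding C_def by (simp add: distrib_left)
      finally show ?thesis .
    qed
    moreover have "(1 + x) powr q > 0" using x by simp
    ultimately show ?thesis by (simp add: powr_minus field_simps)
  qed
  then show thesis using that C by blast
qed

context simple_nested_fractal
begin

abbreviation "N \<equiv> num_maps F"
abbreviation "d \<equiv> fractal_dim F"

lemma card_I: "card I = N" by (simp add: I_def)

lemma N_ge_2: "N \<ge> 2"
proof (rule ccontr)
  assume "\<not> ?thesis"
  then have "I \<subseteq> {1}" by (auto simp: I_def)
  moreover obtain p where "p \<in> V" using V_nonempty by blast
  ultimately show False using essential_partner by (metis in_mono singletonD)
qed

lemma d_pos: "d > 0" using N_ge_2 scaling by (simp add: fractal_dim_def)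

lemma L_powr_d: "L powr d = real N"
  using N_ge_2 scaling by (simp add: fractal_dim_def powr_def)

lemma N_pow: "real N ^ m = L powr (real m * d)"
  using L_pos by (simp add: L_powr_d[symmetric] powr_realpow[symmetric] powr_powr mult.commute)

lemma norm_word_shift_le: "u \<in> lists I \<Longrightarrow> norm (word_shift u) \<le> \<kappa> * L ^ length u"
proof -
  assume "u \<in> lists I"
  then obtain k where "k \<in> K" "0 + word_shift u = (L ^ length u) *\<^sub>R k" using add_word_shift_in_scaled_K zero_in_K by blast
  then show ?thesis using \<kappa>(2)[of k] L_pos by (simp add: mult.commute)
qed

text \<open>The first \<open>j\<close> letters of a word can be chosen in \<open>N ^ j\<close> ways, and the others form the address of a vector
of norm at most \<open>1 + \<kappa>\<close>.\<close>

lemma shifts_count: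
  obtains P where "P > 0"
    "\<forall>W j. finite W \<longrightarrow> W \<subseteq> shifts \<longrightarrow> (\<forall>v\<in>W. norm v \<le> L ^ j) \<longrightarrow> real (card W) \<le> P * real N ^ j"
proof -
  obtain P where P: "P > 0"
    "\<forall>W. finite W \<longrightarrow> W \<subseteq> shifts \<longrightarrow> (\<forall>v\<in>W. norm v \<le> 1 + \<kappa>) \<longrightarrow> real (card W) \<le> P"
    by (rule finite_shifts_bounded_card)
  have "real (card W) \<le> P * real N ^ j" if W: "finite W" "W \<subseteq> shifts" "\<forall>v\<in>W. norm v \<le> L ^ j" for W j
  proof -
    obtain n where n: "n \<ge> j" "\<forall>v\<in>W. \<exists>u\<in>lists I. length u = n \<and> word_shift u = v"
      using shifts_words[OF W(1,2)] by blast
    then obtain wd where wd: "\<And>v. v \<in> W \<Longrightarrow> wd v \<in> lists I \<and> length (wd v) = n \<and> word_shift (wd v) = v" by metis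
    define A where "A = {u. set u \<subseteq> I \<and> length u = j}"
    define f where "f v = (take j (wd v), word_shift (drop j (wd v)))" for v
    define B where "B = (\<lambda>v. word_shift (drop j (wd v))) ` W"
    have split: "word_shift (wd v) = word_shift (take j (wd v)) + (L ^ j) *\<^sub>R word_shift (drop j (wd v))" if "v \<in> W" for v
      using word_shift_append[of "take j (wd v)" "drop j (wd v)"] wd[OF that] n(1) by simp
    have inj: "inj_on f W"
    proof (rule inj_onI)
      fix v v' assume vv: "v \<in> W" "v' \<in> W" "f v = f v'"
      then have "word_shift (wd v) = word_shift (wd v')" using split unfolding f_def by simp
      then show "v = v'" using wd vv by metis
    qed
    have finA: "finite A" unfolding A_def using finite_I by (rule finite_lists_length_eq)
    have takeI: "set (take j (wd v)) \<subseteq> I" "set (drop j (wd v)) \<subseteq> I" "length (take j (wd v)) = j" if "v \<in> W" for v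
      using wd[OF that] n(1) by (auto dest: in_set_takeD in_set_dropD)
    have img: "f ` W \<subseteq> A \<times> B" unfolding f_def A_def B_def using takeI by auto
    have finB: "finite B" unfolding B_def using W(1) by simp
    have "card W \<le> card (A \<times> B)"
      using card_inj_on_le[OF inj img] finA finB by simp
    also have "\<dots> = N ^ j * card B" 
      unfolding card_cartesian_product A_def by (simp add: card_lists_length_eq[OF finite_I] card_I)
    finally have le: "real (card W) \<le> real N ^ j * real (card B)"
      by (metis of_nat_le_iff of_nat_mult of_nat_power)
    have "B \<subseteq> shifts" unfolding B_def shifts_def using takeI(2) by (auto intro!: imageI simp: in_lists_conv_set)
    moreover have "norm b \<le> 1 + \<kappa>" if "b \<in> B" for b
    proof -
      note bB = that
      obtain v where v: "v \<in> W" "b = word_shift (drop j (wd v))" using bB unfolding B_def by auto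
      have "(L ^ j) *\<^sub>R b = v - word_shift (take j (wd v))" using split[OF v(1)] wd[OF v(1)] v(2) by (metis add_diff_cancel_left')
      then have "norm ((L ^ j) *\<^sub>R b) \<le> norm v + norm (word_shift (take j (wd v)))" by (simp add: norm_triangle_ineq4)
      also have "\<dots> \<le> L ^ j + \<kappa> * L ^ j"
        using W(3) v(1) norm_word_shift_le[of "take j (wd v)"] takeI[OF v(1)] by (intro add_mono) (auto simp: in_lists_conv_set)
      finally have "L ^ j * norm b \<le> L ^ j * (1 + \<kappa>)" using L_pos by (simp add: algebra_simps)
      then show ?thesis using L_pos by simp
    qed
    ultimately have "real (card B) \<le> P" using P(2) finB by blast
    then have "real N ^ j * real (card B) \<le> real N ^ j * P" by (intro mult_left_mono) auto
    then show ?thesis using le by (simp add: mult.commute)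
  qed
  then show thesis using that P(1) by blast
qed

lemma shifts_finite_ball: "finite {v\<in>shifts. norm v \<le> R}"
proof -
  obtain P where P: "P > 0" "\<forall>W. finite W \<longrightarrow> W \<subseteq> shifts \<longrightarrow> (\<forall>v\<in>W. norm v \<le> R) \<longrightarrow> real (card W) \<le> P"
    by (rule finite_shifts_bounded_card)
  show ?thesis
  proof (rule finite_if_finite_subsets_card_bdd[of _ "nat \<lfloor>P\<rfloor>", THEN conjunct1])
    fix W assume W: "W \<subseteq> {v\<in>shifts. norm v \<le> R}" "finite W"
    then have "real (card W) \<le> P" using P(2) by blast
    then show "card W \<le> nat \<lfloor>P\<rfloor>" by (simp add: le_nat_floor)
  qed
qed

text \<open>Sum over the shells where \<open>norm v\<close> is of the order of \<open>L ^ (m + j)\<close>. The \<open>j\<close>th shell has at most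
\<open>P * N ^ (m + j)\<close> points, with weights of the order of \<open>L powr (- (d + 1) * j)\<close>; as \<open>N = L powr d\<close>, a geometric
series remains.\<close>

lemma shifts_weight_sum:
  assumes D: "D \<ge> (0::real)"
  obtains C where "C > 0"
    "\<forall>W m. finite W \<longrightarrow> W \<subseteq> shifts \<longrightarrow>
       (\<Sum>v\<in>W. (1 + max 0 (norm v - D) / L ^ m) powr (- (d + 1))) \<le> C * real N ^ m"
proof -
  obtain P where P: "P > 0"
    "\<forall>W j. finite W \<longrightarrow> W \<subseteq> shifts \<longrightarrow> (\<forall>v\<in>W. norm v \<le> L ^ j) \<longrightarrow> real (card W) \<le> P * real N ^ j"
    by (rule shifts_count)
  define b where "b = (L * (1 + D)) powr (d + 1)"
  have b0: "b > 0" unfolding b_def using L_pos D by simp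
  define C where "C = P * b * (1 / (1 - 1/L))"
  have L1: "1 / L < 1" "1 / L > 0" using scaling by auto
  have C0: "C > 0" unfolding C_def using P(1) b0 L1 by simp
  have "(\<Sum>v\<in>W. (1 + max 0 (norm v - D) / L ^ m) powr (- (d + 1))) \<le> C * real N ^ m"
    if W: "finite W" "W \<subseteq> shifts" for W m
  proof -
    define J where "J v = (LEAST j. norm v \<le> L ^ (m + j))" for v :: "real^2"
    have ex: "\<exists>j. norm v \<le> L ^ (m + j)" for v
    proof -
      obtain k where "norm v < L ^ k" using real_arch_pow[OF scaling] by blast
      also have "L ^ k \<le> L ^ (m + k)" using scaling by (intro power_increasing) auto
      finally show ?thesis by (intro exI[of _ k]) simp
    qed
    have J1: "norm v \<le> L ^ (m + J v)" for v unfolding J_def using ex by (rule LeastI_ex)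
    have J2: "L ^ (m + j) < norm v" if "J v = Suc j" for v j
      using not_less_Least[of j "\<lambda>j. norm v \<le> L ^ (m + j)"] that unfolding J_def by simp
    have base: "L ^ J v / (L * (1 + D)) \<le> 1 + max 0 (norm v - D) / L ^ m" for v
    proof (cases "J v")
      case 0
      have "L * (1 + D) \<ge> 1" using scaling D by (metis add.right_neutral add_increasing2 less_eq_real_def mult_ge1_I le_add_same_cancel1)
      then have "L ^ J v / (L * (1 + D)) \<le> 1" using 0 by (simp add: divide_le_eq_1)
      also have "\<dots> \<le> 1 + max 0 (norm v - D) / L ^ m" using L_pos by simp
      finally show ?thesis .
    next
      case (Suc j)
      define Y where "Y = norm v / L ^ m"
      have Lm: "L ^ m \<ge> 1" using scaling by (simp add: one_le_power)
      have "L ^ j < Y" using J2[OF Suc] L_pos by (simp add: Y_def power_add field_simps)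
      then have Yj: "L ^ j \<le> Y" by simp
      have "D / L ^ m \<le> D" using Lm D by (simp add: divide_le_eq mult_left_le mult_le_cancel_left1)
      then have "max 0 (Y - D) \<le> max 0 (norm v - D) / L ^ m"
      proof -
        have "Y - D \<le> (norm v - D) / L ^ m"
          using \<open>D / L ^ m \<le> D\<close> by (simp add: Y_def diff_divide_distrib)
        also have "\<dots> \<le> max 0 (norm v - D) / L ^ m" using L_pos by (intro divide_right_mono) auto
        finally show ?thesis using L_pos by simp
      qed
      moreover have "Y \<le> (1 + D) * (1 + max 0 (Y - D))"
      proof (cases "Y \<le> D")
        case True then show ?thesis using D by (simp add: max_def)
      next
        case False
        have "(1 + D) * (1 + (Y - D)) = 1 + Y + D * (Y - D)" by (simp add: algebra_simps)
        moreover have "D * (Y - D) \<ge> 0" using D False by simp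
        ultimately show ?thesis using False by (simp add: max_def)
      qed
      ultimately have "Y / (1 + D) \<le> 1 + max 0 (norm v - D) / L ^ m"
        using D by (simp add: divide_le_eq mult.commute) (smt (verit) mult_left_mono)
      moreover have "L ^ J v / (L * (1 + D)) \<le> Y / (1 + D)"
        using Suc Yj L_pos D by (simp add: divide_right_mono)
      ultimately show ?thesis by simp
    qed
    have wt: "(1 + max 0 (norm v - D) / L ^ m) powr (- (d + 1)) \<le> b * L powr (- (d + 1) * real (J v))" for v
    proof -
      have "(1 + max 0 (norm v - D) / L ^ m) powr (- (d + 1)) \<le> (L ^ J v / (L * (1 + D))) powr (- (d + 1))"
        using base[of v] L_pos D d_pos by (intro powr_mono2') auto
      also have "\<dots> = b * L powr (- (d + 1) * real (J v))"
      proof -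
        have "(L ^ J v / (L * (1 + D))) powr (- (d + 1)) = (L ^ J v) powr (- (d + 1)) / (L * (1 + D)) powr (- (d + 1))"
          by (rule powr_divide)
        also have "\<dots> = b * (L ^ J v) powr (- (d + 1))"
          unfolding b_def powr_minus[of "L * (1 + D)"] by (simp add: divide_inverse)
        also have "(L ^ J v) powr (- (d + 1)) = L powr (- (d + 1) * real (J v))"
          using L_pos by (simp only: powr_realpow[symmetric] powr_powr mult.commute)
        finally show ?thesis .
      qed
      finally show ?thesis .
    qed
    define S where "S j = {v\<in>W. J v = j}" for j
    have cardS: "real (card (S j)) \<le> P * real N ^ (m + j)" for j
    proof -
      have "finite (S j)" "S j \<subseteq> shifts" "\<forall>v\<in>S j. norm v \<le> L ^ (m + j)"
        using W J1 unfolding S_def by auto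
      then show ?thesis using P(2) by blast
    qed
    define J0 where "J0 = Suc (Max (J ` W))"
    have "(\<Sum>v\<in>W. (1 + max 0 (norm v - D) / L ^ m) powr (- (d + 1)))
        \<le> (\<Sum>v\<in>W. b * L powr (- (d + 1) * real (J v)))" by (intro sum_mono wt)
    also have "\<dots> = (\<Sum>j<J0. \<Sum>v\<in>S j. b * L powr (- (d + 1) * real (J v)))"
      unfolding S_def
    proof (rule sum.group[symmetric])
      show "J ` W \<subseteq> {..<J0}" unfolding J0_def using W(1) by (auto simp: less_Suc_eq_le)
    qed (use W in auto)
    also have "\<dots> = (\<Sum>j<J0. real (card (S j)) * (b * L powr (- (d + 1) * real j)))"
      unfolding S_def by (intro sum.cong refl) simp
    also have "\<dots> \<le> (\<Sum>j<J0. P * real N ^ (m + j) * (b * L powr (- (d + 1) * real j)))"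
      using b0 by (intro sum_mono mult_right_mono cardS) auto
    also have "\<dots> = (\<Sum>j<J0. P * b * real N ^ m * (1/L) ^ j)"
    proof (intro sum.cong refl)
      fix j
      have "real N ^ j * L powr (- (d + 1) * real j) = L powr (- real j)"
        unfolding N_pow powr_add[symmetric] by (simp add: algebra_simps)
      also have "\<dots> = (1/L) ^ j" using L_pos by (simp add: powr_minus powr_realpow power_one_over divide_inverse power_inverse)
      finally show "P * real N ^ (m + j) * (b * L powr (- (d + 1) * real j)) = P * b * real N ^ m * (1/L) ^ j"
        by (simp add: power_add mult_ac)
    qed
    also have "\<dots> = P * b * real N ^ m * (\<Sum>j<J0. (1/L) ^ j)" by (simp add: sum_distrib_left)
    also have "\<dots> \<le> P * b * real N ^ m * (1 / (1 - 1/L))"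
    proof (intro mult_left_mono)
      have "(\<Sum>j<J0. (1/L) ^ j) \<le> (\<Sum>j. (1/L) ^ j)"
        using L1 by (intro sum_le_suminf summable_geometric) auto
      then show "(\<Sum>j<J0. (1/L) ^ j) \<le> 1 / (1 - 1/L)" using L1 by (simp add: suminf_geometric)
    qed (use P b0 in auto)
    finally show ?thesis by (simp add: C_def mult_ac)
  qed
  then show thesis using that C0 by blast
qed

lemma fractal_scale: "fractal F M = (\<lambda>x. (L powi M) *\<^sub>R x) ` K" by (simp add: fractal_def)

lemma word_shift_sum: "word_shift u = (\<Sum>k<length u. L ^ Suc k *\<^sub>R transl F (u ! k))"
proof (induction u)
  case (Cons a u)
  have "(\<Sum>k<length (a # u). L ^ Suc k *\<^sub>R transl F ((a # u) ! k))
      = L *\<^sub>R transl F a + (\<Sum>k<length u. L ^ Suc (Suc k) *\<^sub>R transl F (u ! k))"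
    by (simp add: sum.lessThan_Suc_shift del: sum.lessThan_Suc)
  also have "\<dots> = L *\<^sub>R transl F a + L *\<^sub>R (\<Sum>k<length u. L ^ Suc k *\<^sub>R transl F (u ! k))"
    by (simp add: scaleR_sum_right)
  finally show ?case using Cons by (simp add: scaleR_add_right)
qed simp

lemma complex_shift_sum:
  assumes "length u = n"
  shows "(\<Sum>j = M+1..M + int n. (L powi j) *\<^sub>R transl F (u ! nat (j - M - 1))) = (L powi M) *\<^sub>R word_shift u"
proof -
  have "(\<Sum>j = M+1..M + int n. (L powi j) *\<^sub>R transl F (u ! nat (j - M - 1)))
     = (\<Sum>k<n. (L powi (M + 1 + int k)) *\<^sub>R transl F (u ! k))"
    by (rule sum.reindex_bij_witness[where i = "\<lambda>k. M + 1 + int k" and j = "\<lambda>j. nat (j - M - 1)"]) auto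
  also have "\<dots> = (\<Sum>k<n. (L powi M) *\<^sub>R (L ^ Suc k *\<^sub>R transl F (u ! k)))"
    by (intro sum.cong refl) (use L_pos in \<open>simp add: power_int_add\<close>)
  finally show ?thesis using assms by (simp add: word_shift_sum scaleR_sum_right)
qed

lemma K_subset_scaled: "x \<in> K \<Longrightarrow> \<exists>y\<in>K. x = (L ^ n) *\<^sub>R y"
proof -
  assume "x \<in> K"
  moreover have "word_shift (replicate n 1) = 0" "replicate n 1 \<in> lists I"
    using word_shift_pad[of "[]" n] lists_pad[of "[]" n] by simp_all
  ultimately show ?thesis using add_word_shift_in_scaled_K[of "replicate n 1" x] by simp
qed

lemma fractal_mono: assumes "M \<le> M'" shows "fractal F M \<subseteq> fractal F M'"
proof
  fix x assume "x \<in> fractal F M"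
  then obtain y where y: "y \<in> K" "x = (L powi M) *\<^sub>R y" by (auto simp: fractal_scale)
  obtain z where z: "z \<in> K" "y = (L ^ nat (M' - M)) *\<^sub>R z" using K_subset_scaled[OF y(1)] by blast
  have "M' = M + int (nat (M' - M))" using assms by simp
  then have "L powi M' = L powi M * L ^ nat (M' - M)" using L_pos by (metis power_int_add power_int_of_nat)
  then show "x \<in> fractal F M'" using y z by (auto simp: fractal_scale)
qed

lemma fractal_subset_unbounded: "fractal F M \<subseteq> unbounded_fractal F"
proof -
  have "fractal F M \<subseteq> fractal F (int (nat M))" by (rule fractal_mono) simp
  then show ?thesis unfolding unbounded_fractal_def by blast
qed

lemma unbounded_eq: "x \<in> unbounded_fractal F \<longleftrightarrow> (\<exists>n. x \<in> fractal F (M + int n))"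
proof
  assume "x \<in> unbounded_fractal F"
  then obtain n where n: "x \<in> fractal F (int n)" unfolding unbounded_fractal_def by blast
  have "fractal F (int n) \<subseteq> fractal F (M + int (nat (int n - M)))" by (rule fractal_mono) simp
  then show "\<exists>n. x \<in> fractal F (M + int n)" using n by blast
next
  assume "\<exists>n. x \<in> fractal F (M + int n)"
  then show "x \<in> unbounded_fractal F" using fractal_subset_unbounded by blast
qed

lemma complex_at_word:
  assumes "u \<in> lists I"
  shows "complex_at F M ((L powi M) *\<^sub>R word_shift u) \<subseteq> fractal F (M + int (length u))"
proof
  fix x assume "x \<in> complex_at F M ((L powi M) *\<^sub>R word_shift u)"
  then obtain k where k: "k \<in> K" "x = (L powi M) *\<^sub>R (k + word_shift u)"
    by (auto simp: complex_at_def fractal_scale scaleR_add_right)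
  obtain k' where k': "k' \<in> K" "k + word_shift u = (L ^ length u) *\<^sub>R k'" using add_word_shift_in_scaled_K[OF assms k(1)] by blast
  then show "x \<in> fractal F (M + int (length u))"
    using k(2) L_pos by (auto simp: fractal_scale power_int_add)
qed

lemma complex_shifts_eq: "complex_shifts F M = (\<lambda>v. (L powi M) *\<^sub>R v) ` shifts"
proof
  show "complex_shifts F M \<subseteq> (\<lambda>v. (L powi M) *\<^sub>R v) ` shifts"
  proof
    fix \<nu> assume "\<nu> \<in> complex_shifts F M"
    then obtain J i where i: "J \<ge> M + 1" "\<forall>j\<in>{M+1..J}. i j \<in> I" "\<nu> = (\<Sum>j = M+1..J. (L powi j) *\<^sub>R transl F (i j))"
      unfolding complex_shifts_def I_def by auto
    define n where "n = nat (J - M)"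
    define u where "u = map (\<lambda>k. i (M + 1 + int k)) [0..<n]"
    have J: "J = M + int n" using i(1) by (simp add: n_def)
    have u: "u \<in> lists I" "length u = n" unfolding u_def using i(2) J by auto
    have "\<nu> = (\<Sum>j = M+1..M + int n. (L powi j) *\<^sub>R transl F (u ! nat (j - M - 1)))"
      unfolding i(3) J by (intro sum.cong refl) (auto simp: u_def)
    also have "\<dots> = (L powi M) *\<^sub>R word_shift u" by (rule complex_shift_sum[OF u(2)])
    finally show "\<nu> \<in> (\<lambda>v. (L powi M) *\<^sub>R v) ` shifts" using u(1) unfolding shifts_def by blast
  qed
  show "(\<lambda>v. (L powi M) *\<^sub>R v) ` shifts \<subseteq> complex_shifts F M"
  proof
    fix \<nu> assume "\<nu> \<in> (\<lambda>v. (L powi M) *\<^sub>R v) ` shifts"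
    then obtain u0 where u0: "u0 \<in> lists I" "\<nu> = (L powi M) *\<^sub>R word_shift u0" unfolding shifts_def by auto
    define u where "u = u0 @ [1]"
    have u: "u \<in> lists I" "\<nu> = (L powi M) *\<^sub>R word_shift u" "length u \<ge> 1"
      using u0 lists_pad[of u0 1] word_shift_pad[of u0 1] by (auto simp: u_def)
    have "complex_at F M \<nu> \<subseteq> unbounded_fractal F"
      using complex_at_word[OF u(1), of M] fractal_subset_unbounded u(2) by blast
    moreover have "\<nu> = (\<Sum>j = M+1..M + int (length u). (L powi j) *\<^sub>R transl F (u ! nat (j - M - 1)))"
      unfolding u(2) by (rule complex_shift_sum[symmetric]) simp
    moreover have "\<forall>j\<in>{M+1..M + int (length u)}. u ! nat (j - M - 1) \<in> I"
    proof
      fix j assume "j \<in> {M+1..M + int (length u)}"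
      then have "nat (j - M - 1) < length u" by auto
      then show "u ! nat (j - M - 1) \<in> I" using u(1) nth_mem by blast
    qed
    moreover have "M + int (length u) \<ge> M + 1" using u(3) by simp
    ultimately show "\<nu> \<in> complex_shifts F M"
      unfolding complex_shifts_def I_def[symmetric] mem_Collect_eq
      by (intro conjI exI[of _ "M + int (length u)"] exI[of _ "\<lambda>j. u ! nat (j - M - 1)"])
  qed
qed

lemma zero_in_shifts: "0 \<in> shifts" 
  unfolding shifts_def by (rule image_eqI[of _ _ "[]"]) simp_all

lemma mem_complex_at: "x \<in> complex_at F M ((L powi M) *\<^sub>R v) \<longleftrightarrow> (L powi (- M)) *\<^sub>R x - v \<in> K"
proof -
  have 1: "L powi M * L powi (- M) = 1" using L_pos by (simp add: power_int_minus)
  show ?thesis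
  proof
    assume "x \<in> complex_at F M ((L powi M) *\<^sub>R v)"
    then obtain k where "k \<in> K" "x = (L powi M) *\<^sub>R (k + v)"
      by (auto simp: complex_at_def fractal_scale scaleR_add_right)
    then show "(L powi (- M)) *\<^sub>R x - v \<in> K" using 1 by (simp add: mult.commute)
  next
    assume a: "(L powi (- M)) *\<^sub>R x - v \<in> K"
    have "x = (L powi M) *\<^sub>R ((L powi (- M)) *\<^sub>R x - v) + (L powi M) *\<^sub>R v" using 1 by (simp add: scaleR_diff_right)
    then show "x \<in> complex_at F M ((L powi M) *\<^sub>R v)" using a unfolding complex_at_def fractal_scale by blast
  qed
qed

lemma mem_fractal: "x \<in> fractal F M \<longleftrightarrow> (L powi (- M)) *\<^sub>R x \<in> K"
  using mem_complex_at[of x M 0] by (simp add: complex_at_def)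

lemma unbounded_covered:
  assumes "x \<in> unbounded_fractal F" obtains v where "v \<in> shifts" "x \<in> complex_at F M ((L powi M) *\<^sub>R v)"
proof -
  obtain n where "x \<in> fractal F (M + int n)" using assms unbounded_eq by blast
  then obtain k where k: "k \<in> K" "x = (L powi (M + int n)) *\<^sub>R k" by (auto simp: fractal_scale)
  obtain u where u: "u \<in> lists I" "(L ^ n) *\<^sub>R k - word_shift u \<in> K" using scaled_K_covered[OF k(1)] by blast
  have "(L powi (- M)) *\<^sub>R x = (L ^ n) *\<^sub>R k" using k(2) L_pos by (simp add: power_int_add power_int_minus)
  then have "x \<in> complex_at F M ((L powi M) *\<^sub>R word_shift u)" using u(2) mem_complex_at by simp
  then show thesis using that u(1) unfolding shifts_def by blast
qed

lemma complex_subset_unbounded: "v \<in> shifts \<Longrightarrow> complex_at F M ((L powi M) *\<^sub>R v) \<subseteq> unbounded_fractal F"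
proof -
  assume "v \<in> shifts"
  then have "(L powi M) *\<^sub>R v \<in> complex_shifts F M" unfolding complex_shifts_eq by (rule imageI)
  then show ?thesis unfolding complex_shifts_def by simp
qed

lemma complexes_meet_in_vertices:
  assumes "v \<in> shifts" "v' \<in> shifts" "v \<noteq> v'"
    "x \<in> complex_at F M ((L powi M) *\<^sub>R v)" "x \<in> complex_at F M ((L powi M) *\<^sub>R v')"
  shows "(L powi (- M)) *\<^sub>R x - v \<in> V"
proof -
  obtain u u' where u: "u \<in> lists I" "u' \<in> lists I" "length u = length u'" "word_shift u = v" "word_shift u' = v'"
    using assms(1,2) by (rule shifts_words_pair)
  then have "u \<noteq> u'" using assms(3) by auto
  then show ?thesis using nesting_words[OF u(3,1,2)] assms(4,5) u(4,5) unfolding mem_complex_at by blast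
qed

end

section \<open>Good labelings on all levels and the projection\<close>

lemma diameter_scaleR_image_le:
  fixes S :: "'a::real_normed_vector set"
  assumes "bounded S" "r > 0" shows "diameter ((*\<^sub>R) r ` S) \<le> r * diameter S"
proof (rule diameter_le)
  show "(*\<^sub>R) r ` S \<noteq> {} \<or> 0 \<le> r * diameter S" using assms by (simp add: diameter_ge_0)
  fix x y assume "x \<in> (*\<^sub>R) r ` S" "y \<in> (*\<^sub>R) r ` S"
  then obtain u v where uv: "u \<in> S" "v \<in> S" "x = r *\<^sub>R u" "y = r *\<^sub>R v" by auto
  have "norm (x - y) = r * dist u v" using assms(2) uv by (simp add: dist_norm flip: scaleR_diff_right)
  also have "\<dots> \<le> r * diameter S" using assms diameter_bounded_bound[OF assms(1) uv(1,2)] by simp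
  finally show "norm (x - y) \<le> r * diameter S" .
qed

lemma hausdorff_premeasure_scaleR_le:
  fixes A :: "(real^2) set"
  assumes "r > 0" "s > 0"
  shows "ennreal (r powr (- s)) * hausdorff_premeasure s (r * \<delta>) ((*\<^sub>R) r ` A) \<le> hausdorff_premeasure s \<delta> A"
  unfolding hausdorff_premeasure_def[of s \<delta> A]
proof (rule INF_greatest)
  fix W :: "nat \<Rightarrow> (real^2) set"
  assume "W \<in> {U. A \<subseteq> (\<Union>n. U n) \<and> (\<forall>n. bounded (U n) \<and> diameter (U n) \<le> \<delta>)}"
  then have W: "A \<subseteq> (\<Union>n. W n)" "\<And>n. bounded (W n)" "\<And>n. diameter (W n) \<le> \<delta>" by auto
  define W' where "W' n = (*\<^sub>R) r ` W n" for n
  have diam: "diameter (W' n) \<le> r * diameter (W n)" for n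
    unfolding W'_def by (rule diameter_scaleR_image_le[OF W(2) assms(1)])
  have "(*\<^sub>R) r ` A \<subseteq> (\<Union>n. W' n)" using image_mono[OF W(1), of "(*\<^sub>R) r"] by (simp only: W'_def image_UN)
  moreover have "bounded (W' n)" for n unfolding W'_def using W(2) by (rule bounded_scaling)
  moreover have "diameter (W' n) \<le> r * \<delta>" for n
    using order_trans[OF diam[of n], of "r * \<delta>"] W(3)[of n] assms(1) by simp
  ultimately have mem: "W' \<in> {U. (*\<^sub>R) r ` A \<subseteq> (\<Union>n. U n) \<and> (\<forall>n. bounded (U n) \<and> diameter (U n) \<le> r * \<delta>)}"
    by simp
  have "hausdorff_premeasure s (r * \<delta>) ((*\<^sub>R) r ` A) \<le> (\<Sum>n. ennreal (diameter (W' n) powr s))"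
    unfolding hausdorff_premeasure_def by (rule INF_lower[OF mem])
  also have "\<dots> \<le> (\<Sum>n. ennreal (r powr s) * ennreal (diameter (W n) powr s))"
  proof (intro suminf_le)
    fix n
    have "diameter (W' n) powr s \<le> (r * diameter (W n)) powr s"
      using assms(2) diam by (intro powr_mono2) (auto simp: W'_def diameter_ge_0 W(2) bounded_scaling)
    also have "\<dots> = r powr s * diameter (W n) powr s"
      using assms(1) by (intro powr_mult)
    finally show "ennreal (diameter (W' n) powr s) \<le> ennreal (r powr s) * ennreal (diameter (W n) powr s)"
      by (simp add: ennreal_mult'[symmetric] ennreal_leI)
  qed auto
  also have "\<dots> = ennreal (r powr s) * (\<Sum>n. ennreal (diameter (W n) powr s))" by simp
  finally have "ennreal (r powr (- s)) * hausdorff_premeasure s (r * \<delta>) ((*\<^sub>R) r ` A)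
      \<le> ennreal (r powr (- s)) * (ennreal (r powr s) * (\<Sum>n. ennreal (diameter (W n) powr s)))"
    by (rule mult_left_mono) simp
  also have "\<dots> = (\<Sum>n. ennreal (diameter (W n) powr s))"
    using assms(1) by (simp add: mult.assoc[symmetric] ennreal_mult'[symmetric] powr_add[symmetric])
  finally show "ennreal (r powr (- s)) * hausdorff_premeasure s (r * \<delta>) ((*\<^sub>R) r ` A)
      \<le> (\<Sum>n. ennreal (diameter (W n) powr s))" .
qed

lemma hausdorff_outer_scaleR_le:
  fixes A :: "(real^2) set"
  assumes "r > 0" "s > 0"
  shows "ennreal (r powr (- s)) * hausdorff_outer s ((*\<^sub>R) r ` A) \<le> hausdorff_outer s A"
  unfolding hausdorff_outer_def[of s "(*\<^sub>R) r ` A"] SUP_mult_left_ennreal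
proof (rule SUP_least)
  fix \<delta> :: real assume \<delta>: "\<delta> \<in> {0<..}"
  have "ennreal (r powr (- s)) * hausdorff_premeasure s \<delta> ((*\<^sub>R) r ` A) \<le> hausdorff_premeasure s (\<delta> / r) A"
    using hausdorff_premeasure_scaleR_le[OF assms, of "\<delta> / r" A] assms(1) by simp
  also have "\<dots> \<le> hausdorff_outer s A"
    unfolding hausdorff_outer_def using \<delta> assms(1) by (intro SUP_upper) auto
  finally show "ennreal (r powr (- s)) * hausdorff_premeasure s \<delta> ((*\<^sub>R) r ` A) \<le> hausdorff_outer s A" .
qed

lemma hausdorff_outer_scaleR:
  fixes A :: "(real^2) set"
  assumes l: "r > 0" and s: "s > 0"
  shows "hausdorff_outer s A = ennreal (r powr (- s)) * hausdorff_outer s ((*\<^sub>R) r ` A)"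
proof (rule antisym[OF _ hausdorff_outer_scaleR_le[OF assms]])
  have "(*\<^sub>R) (1/r) ` (*\<^sub>R) r ` A = A" using l by (simp add: image_image)
  then have "ennreal ((1/r) powr (- s)) * hausdorff_outer s A \<le> hausdorff_outer s ((*\<^sub>R) r ` A)"
    using hausdorff_outer_scaleR_le[of "1/r" s "(*\<^sub>R) r ` A"] l s by simp
  then have "ennreal (r powr (- s)) * (ennreal ((1/r) powr (- s)) * hausdorff_outer s A)
      \<le> ennreal (r powr (- s)) * hausdorff_outer s ((*\<^sub>R) r ` A)"
    by (rule mult_left_mono) simp
  moreover have "r powr (- s) * (1/r) powr (- s) = 1"
    using l by (simp add: powr_mult[symmetric])
  ultimately show "hausdorff_outer s A \<le> ennreal (r powr (- s)) * hausdorff_outer s ((*\<^sub>R) r ` A)"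
    by (simp add: mult.assoc[symmetric] ennreal_mult'[symmetric])
qed

lemma sets_hausdorff_measure: "sets (hausdorff_measure s :: (real^2) measure) = sets borel"
  unfolding hausdorff_measure_def using sets.sets_measure_of_eq[of "borel :: (real^2) measure"] by simp

lemma space_hausdorff_measure: "space (hausdorff_measure s :: (real^2) measure) = UNIV"
  unfolding hausdorff_measure_def by (simp add: space_measure_of_conv)

lemma borel_scaleR_image:
  fixes A :: "(real^2) set"
  assumes "r > 0" "A \<in> sets borel" shows "(*\<^sub>R) r ` A \<in> sets borel"
proof -
  have "(*\<^sub>R) r ` A = (*\<^sub>R) (1/r) -` A \<inter> space borel"
    using assms(1) by (auto simp: image_iff intro!: bexI[of _ "(1/r) *\<^sub>R _"])
  also have "\<dots> \<in> sets borel" using assms(2) by (intro measurable_sets[of _ borel borel]) auto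
  finally show ?thesis .
qed

text \<open>If the outer measure were no measure on the Borel sets, \<open>measure_of\<close> would return zero on both sides;
otherwise the scaling of the outer measure is inherited.\<close>

lemma emeasure_hausdorff_scaleR:
  fixes A :: "(real^2) set"
  assumes l: "r > 0" and s: "s > 0" and A: "A \<in> sets borel"
  shows "emeasure (hausdorff_measure s) A = ennreal (r powr (- s)) * emeasure (hausdorff_measure s) ((*\<^sub>R) r ` A)"
proof -
  have *: "sigma_sets UNIV (sets (borel :: (real^2) measure)) = sets borel"
    using sets.sigma_sets_eq[of "borel :: (real^2) measure"] by simp
  show ?thesis
    unfolding hausdorff_measure_def emeasure_measure_of_conv *
    using hausdorff_outer_scaleR[OF l s, of A] A borel_scaleR_image[OF l A] by simp
qed

context simple_nested_fractal
begin

abbreviation "\<mu> \<equiv> fractal_measure F"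

lemma fractal_borel: "fractal F M \<in> sets borel"
proof -
  have "compact (fractal F M)" unfolding fractal_scale
    by (intro compact_scaling attractor_K(1))
  then show ?thesis using compact_imp_closed borel_closed by blast
qed

lemma unbounded_fractal_borel: "unbounded_fractal F \<in> sets borel"
  unfolding unbounded_fractal_def by (intro sets.countable_UN) (use fractal_borel in auto)

lemma fractal_measure_sets: "sets \<mu> = sets (restrict_space borel (unbounded_fractal F))"
  unfolding fractal_measure_def by (simp add: sets_restrict_space sets_hausdorff_measure)

lemma fractal_measure_space: "space \<mu> = unbounded_fractal F"
  using sets_eq_imp_space_eq[OF fractal_measure_sets] by (simp add: space_restrict_space)

lemma unbounded_fractal_scale: "(*\<^sub>R) (L powi k) ` unbounded_fractal F = unbounded_fractal F"
proof -
  have *: "(*\<^sub>R) (L powi k) ` fractal F M = fractal F (k + M)" for M k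
    using L_pos by (auto simp: fractal_scale image_image power_int_add)
  have sub: "(*\<^sub>R) (L powi k) ` unbounded_fractal F \<subseteq> unbounded_fractal F" for k
    unfolding unbounded_fractal_def image_UN * using fractal_subset_unbounded unbounded_fractal_def by auto
  have "x \<in> (*\<^sub>R) (L powi k) ` unbounded_fractal F" if "x \<in> unbounded_fractal F" for x
  proof -
    have "(L powi (- k)) *\<^sub>R x \<in> unbounded_fractal F" using sub[of "- k"] that by blast
    moreover have "x = (L powi k) *\<^sub>R ((L powi (- k)) *\<^sub>R x)" using L_pos by (simp add: power_int_minus)
    ultimately show ?thesis by blast
  qed
  then show ?thesis using sub by blast
qed

lemma fractal_measure_emeasure:
  assumes "A \<in> sets \<mu>"
  shows "emeasure \<mu> A = 1 / emeasure (hausdorff_measure d) K * emeasure (hausdorff_measure d) A"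
proof -
  have "A \<subseteq> unbounded_fractal F" using sets.sets_into_space[OF assms] by (simp add: fractal_measure_space)
  then show ?thesis unfolding fractal_measure_def
    by (simp add: emeasure_restrict_space space_hausdorff_measure sets_hausdorff_measure unbounded_fractal_borel)
qed

lemma sets_fractal_measure_iff: "A \<in> sets \<mu> \<longleftrightarrow> A \<subseteq> unbounded_fractal F \<and> A \<in> sets borel"
  unfolding fractal_measure_sets using unbounded_fractal_borel
  by (simp add: sets_restrict_space_iff)

lemma fractal_measure_scale:
  assumes "A \<in> sets \<mu>"
  shows "(*\<^sub>R) (L powi k) ` A \<in> sets \<mu>"
    "emeasure \<mu> A = ennreal ((L powi k) powr (- d)) * emeasure \<mu> ((*\<^sub>R) (L powi k) ` A)"
proof -
  have l: "L powi k > 0" using L_pos by simp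
  have A: "A \<in> sets borel" "A \<subseteq> unbounded_fractal F" using assms sets_fractal_measure_iff by auto
  have "(*\<^sub>R) (L powi k) ` A \<subseteq> unbounded_fractal F" using A(2) unbounded_fractal_scale[of k] by blast
  then show S: "(*\<^sub>R) (L powi k) ` A \<in> sets \<mu>"
    using borel_scaleR_image[OF l A(1)] sets_fractal_measure_iff by simp
  show "emeasure \<mu> A = ennreal ((L powi k) powr (- d)) * emeasure \<mu> ((*\<^sub>R) (L powi k) ` A)"
    unfolding fractal_measure_emeasure[OF assms] fractal_measure_emeasure[OF S]
    using emeasure_hausdorff_scaleR[OF l d_pos A(1)] by (simp add: mult_ac)
qed

lemma measurable_scale: "(*\<^sub>R) (L powi k) \<in> measurable \<mu> \<mu>"
proof -
  have "(*\<^sub>R) (L powi k) \<in> measurable (restrict_space borel (unbounded_fractal F)) (restrict_space borel (unbounded_fractal F))"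
    by (rule measurable_restrict_space3) (use unbounded_fractal_scale[of k] in auto)
  then show ?thesis using measurable_cong_sets[OF fractal_measure_sets fractal_measure_sets] by simp
qed

lemma distr_fractal_measure:
  "distr \<mu> \<mu> ((*\<^sub>R) (L powi k)) = density \<mu> (\<lambda>_. ennreal ((L powi k) powr (- d)))"
proof (rule measure_eqI)
  fix A assume "A \<in> sets (distr \<mu> \<mu> ((*\<^sub>R) (L powi k)))"
  then have A: "A \<in> sets \<mu>" by simp
  let ?T = "(*\<^sub>R) (L powi k) :: real^2 \<Rightarrow> real^2"
  define B where "B = ?T -` A \<inter> space \<mu>"
  have B: "B \<in> sets \<mu>" unfolding B_def using measurable_scale A by (rule measurable_sets)
  have "?T ` B = A"
  proof
    show "A \<subseteq> ?T ` B"
    proof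
      fix x assume x: "x \<in> A"
      then have "x \<in> unbounded_fractal F" using A sets_fractal_measure_iff by blast
      then have "x \<in> ?T ` unbounded_fractal F" using unbounded_fractal_scale[of k] by simp
      then show "x \<in> ?T ` B" using x unfolding B_def fractal_measure_space by blast
    qed
  qed (auto simp: B_def)
  then have "emeasure \<mu> B = ennreal ((L powi k) powr (- d)) * emeasure \<mu> A"
    using fractal_measure_scale(2)[OF B, of k] by simp
  then show "emeasure (distr \<mu> \<mu> ?T) A = emeasure (density \<mu> (\<lambda>_. ennreal ((L powi k) powr (- d)))) A"
    using A measurable_scale by (simp add: emeasure_distr B_def emeasure_density nn_integral_cmult_indicator)
qed simp

text \<open>The scaling factor of the measure cancels between the integral and the normalization.\<close>

lemma barycenter_scale: "barycenter F M = (L powi k) *\<^sub>R barycenter F (M - k)"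
proof -
  let ?T = "(*\<^sub>R) (L powi k) :: real^2 \<Rightarrow> real^2"
  let ?A = "fractal F (M - k)" and ?c = "(L powi k) powr (- d)"
  have l: "L powi k > 0" using L_pos by simp
  have TA: "?T ` ?A = fractal F M" using L_pos by (auto simp: fractal_scale image_image power_int_diff)
  have sets: "?A \<in> sets \<mu>" "fractal F M \<in> sets \<mu>"
    using sets_fractal_measure_iff fractal_borel fractal_subset_unbounded by auto
  have mu: "measure \<mu> ?A = ?c * measure \<mu> (fractal F M)"
    unfolding measure_def using fractal_measure_scale(2)[OF sets(1), of k] TA by (simp add: enn2real_mult)
  define f where "f x = indicator (fractal F M) x *\<^sub>R x" for x :: "real^2"
  have id: "(\<lambda>x. x) \<in> borel_measurable \<mu>"
    unfolding measurable_cong_sets[OF fractal_measure_sets refl] by (simp add: measurable_restrict_space1)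
  have f: "f \<in> borel_measurable \<mu>" unfolding f_def
    using id sets(2) by (intro borel_measurable_scaleR borel_measurable_indicator) auto
  have "?c *\<^sub>R (LINT x|\<mu>. f x) = (LINT x|density \<mu> (\<lambda>_. ennreal ?c). f x)"
    using f by (simp add: integral_density)
  also have "\<dots> = (LINT x|\<mu>. f (?T x))"
    unfolding distr_fractal_measure[symmetric] by (rule integral_distr[OF measurable_scale f])
  also have "\<dots> = (LINT x|\<mu>. (L powi k) *\<^sub>R (indicator ?A x *\<^sub>R x))"
  proof (intro Bochner_Integration.integral_cong refl)
    fix x
    have "?T x \<in> fractal F M \<longleftrightarrow> x \<in> ?A"
      using L_pos unfolding mem_fractal by (simp add: power_int_add[symmetric])
    then show "f (?T x) = (L powi k) *\<^sub>R (indicator ?A x *\<^sub>R x)"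
      by (auto simp: f_def indicator_def)
  qed
  also have "\<dots> = (L powi k) *\<^sub>R (LINT x:?A|\<mu>. x)"
    unfolding set_lebesgue_integral_def by (rule Bochner_Integration.integral_scaleR_right)
  finally have I: "?c *\<^sub>R (LINT x:fractal F M|\<mu>. x) = (L powi k) *\<^sub>R (LINT x:?A|\<mu>. x)"
    by (simp add: set_lebesgue_integral_def f_def)
  have c: "?c > 0" using l L_pos(2) by simp
  have "(L powi k) *\<^sub>R barycenter F (M - k) = (1 / (?c * measure \<mu> (fractal F M))) *\<^sub>R ((L powi k) *\<^sub>R (LINT x:?A|\<mu>. x))"
    unfolding barycenter_def mu by simp
  also have "\<dots> = (1 / (?c * measure \<mu> (fractal F M))) *\<^sub>R (?c *\<^sub>R (LINT x:fractal F M|\<mu>. x))"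
    unfolding I ..
  also have "\<dots> = barycenter F M" unfolding barycenter_def using c by simp
  finally show ?thesis by simp
qed

lemma vertices_scale: "vertices F M = (*\<^sub>R) (L powi k) ` vertices F (M - k)"
  using L_pos by (auto simp: vertices_def image_image power_int_diff)

lemma shifts_scale: "complex_shifts F M = (*\<^sub>R) (L powi k) ` complex_shifts F (M - k)"
  using L_pos by (auto simp: complex_shifts_eq image_image power_int_diff)

lemma vertices_at_scale: "vertices_at F M ((L powi k) *\<^sub>R \<nu>) = (*\<^sub>R) (L powi k) ` vertices_at F (M - k) \<nu>"
  unfolding vertices_at_def vertices_scale[of M k] by (simp add: image_image scaleR_add_right)

lemma rotations_scale:
  assumes "R \<in> rotations F (M - k)"
  shows "(\<lambda>x. (L powi k) *\<^sub>R R ((1 / L powi k) *\<^sub>R x)) \<in> rotations F M"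
proof -
  have l: "L powi k \<noteq> 0" using L_pos by simp
  obtain Q where Q: "rotation_matrix Q" "R = (\<lambda>x. barycenter F (M - k) + Q *v (x - barycenter F (M - k)))"
    and V: "R ` vertices F (M - k) = vertices F (M - k)"
    using assms unfolding rotations_def by blast
  have "(\<lambda>x. (L powi k) *\<^sub>R R ((1 / L powi k) *\<^sub>R x)) = (\<lambda>x. barycenter F M + Q *v (x - barycenter F M))"
  proof
    fix x
    have "x - barycenter F M = (L powi k) *\<^sub>R ((1 / L powi k) *\<^sub>R x - barycenter F (M - k))"
      unfolding barycenter_scale[of M k] using l L_pos(2) by (simp add: scaleR_diff_right)
    then show "(L powi k) *\<^sub>R R ((1 / L powi k) *\<^sub>R x) = barycenter F M + Q *v (x - barycenter F M)"
      unfolding Q(2) by (simp add: scaleR_add_right barycenter_scale[of M k, symmetric] matrix_vector_mult_scaleR)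
  qed
  moreover have "(\<lambda>x. (L powi k) *\<^sub>R R ((1 / L powi k) *\<^sub>R x)) ` vertices F M = vertices F M"
  proof -
    have "(\<lambda>x. (L powi k) *\<^sub>R R ((1 / L powi k) *\<^sub>R x)) ` vertices F M
      = (*\<^sub>R) (L powi k) ` R ` vertices F (M - k)"
      unfolding vertices_scale[of M k] using l L_pos(2) by (simp add: image_image)
    then show ?thesis using V vertices_scale[of M k] by simp
  qed
  ultimately show ?thesis using Q(1) unfolding rotations_def by blast
qed

lemma good_labeling_scale:
  assumes "good_labeling F (M - k) l"
  shows "good_labeling F M (\<lambda>x. l ((1 / L powi k) *\<^sub>R x))"
  unfolding good_labeling_def
proof (intro conjI ballI)
  let ?s = "L powi k"
  have s: "?s \<noteq> 0" using L_pos by simp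
  let ?l = "\<lambda>x. l ((1 / ?s) *\<^sub>R x)"
  have l: "l \<in> all_vertices F (M - k) \<rightarrow> {1..card V}" "bij_betw l (vertices F (M - k)) {1..card V}"
    "\<forall>\<nu>\<in>complex_shifts F (M - k). \<exists>R. rotation_fits F (M - k) l \<nu> R"
    using assms unfolding good_labeling_def by auto
  have "all_vertices F M = (*\<^sub>R) ?s ` all_vertices F (M - k)"
    unfolding all_vertices_def shifts_scale[of M k] image_UN
    by (simp add: vertices_at_scale)
  then show "?l \<in> all_vertices F M \<rightarrow> {1..card V}" using l(1) s by auto
  have "bij_betw ((*\<^sub>R) (1 / ?s)) (vertices F M) (vertices F (M - k))"
    unfolding vertices_scale[of M k] using s
    by (intro bij_betwI[where g = "(*\<^sub>R) ?s"]) auto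
  from bij_betw_trans[OF this l(2)]
  show "bij_betw ?l (vertices F M) {1..card V}" by (simp add: comp_def)
  fix \<nu> assume "\<nu> \<in> complex_shifts F M"
  then obtain \<nu>' where \<nu>': "\<nu>' \<in> complex_shifts F (M - k)" "\<nu> = ?s *\<^sub>R \<nu>'" unfolding shifts_scale[of M k] by auto
  obtain R where R: "R \<in> rotations F (M - k)" "\<forall>v\<in>vertices_at F (M - k) \<nu>'. l v = l (R (v - \<nu>'))"
    using l(3) \<nu>'(1) unfolding rotation_fits_def by blast
  show "\<exists>R. rotation_fits F M ?l \<nu> R"
    unfolding rotation_fits_def
  proof (intro exI conjI ballI)
    show "(\<lambda>x. ?s *\<^sub>R R ((1 / ?s) *\<^sub>R x)) \<in> rotations F M" by (rule rotations_scale[OF R(1)])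
    fix v assume "v \<in> vertices_at F M \<nu>"
    then obtain v' where v': "v' \<in> vertices_at F (M - k) \<nu>'" "v = ?s *\<^sub>R v'"
      unfolding \<nu>'(2) vertices_at_scale by auto
    have "(1 / ?s) *\<^sub>R (v - \<nu>) = v' - \<nu>'" using s L_pos(2) by (simp add: v'(2) \<nu>'(2) scaleR_diff_right)
    then show "?l v = ?l (?s *\<^sub>R R ((1 / ?s) *\<^sub>R (v - \<nu>)))" using R(2) v' s by simp
  qed
qed

text \<open>The property provides a labeling on one level; scaling transports it, with its rotations, to every other
level.\<close>

lemma good_labeling_labeling:
  assumes "good_labeling_property F" shows "good_labeling F M (labeling F M)"
proof -
  obtain M0 l where "good_labeling F M0 l" using assms unfolding good_labeling_property_def by blast
  then have "good_labeling F (M - (M - M0)) l" by simp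
  from good_labeling_scale[OF this] have "\<exists>l. good_labeling F M l" by blast
  then show ?thesis unfolding labeling_def by (rule someI_ex)
qed

lemma rotation_affine_isometry: assumes "R \<in> rotations F M" shows "affine_isometry R"
proof -
  obtain Q where Q: "rotation_matrix Q" "R = (\<lambda>x. barycenter F M + Q *v (x - barycenter F M))"
    using assms unfolding rotations_def by blast
  have "orthogonal_transformation ((*v) Q)"
    using Q(1) unfolding rotation_matrix_def orthogonal_transformation_matrix by simp
  moreover have "R x - R y = Q *v (x - y)" for x y
    unfolding Q(2) by (simp add: matrix_vector_mult_diff_distrib)
  ultimately show ?thesis unfolding affine_isometry_def by blast
qed

lemma affine_isometry_scale:
  assumes "affine_isometry R" "s \<noteq> 0" shows "affine_isometry (\<lambda>x. (1 / s) *\<^sub>R R (s *\<^sub>R x))"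
proof -
  obtain A where A: "orthogonal_transformation A" "\<forall>x y. R x - R y = A (x - y)"
    using assms unfolding affine_isometry_def by blast
  have "(1 / s) *\<^sub>R R (s *\<^sub>R x) - (1 / s) *\<^sub>R R (s *\<^sub>R y) = A (x - y)" for x y
  proof -
    have "(1 / s) *\<^sub>R R (s *\<^sub>R x) - (1 / s) *\<^sub>R R (s *\<^sub>R y) = (1 / s) *\<^sub>R (R (s *\<^sub>R x) - R (s *\<^sub>R y))"
      by (simp only: scaleR_diff_right)
    also have "\<dots> = (1 / s) *\<^sub>R A (s *\<^sub>R (x - y))" using A(2) by (simp add: scaleR_diff_right)
    finally show ?thesis using assms(2)
      by (simp add: linear_scale[OF orthogonal_transformation_linear[OF A(1)]])
  qed
  then show ?thesis using A(1) unfolding affine_isometry_def by blast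
qed

text \<open>Rescaled to level \<open>0\<close>, the map permutes the essential fixed points.\<close>

lemma vertices_isometry:
  assumes R: "affine_isometry R" "R ` vertices F M \<subseteq> vertices F M"
  shows "R ` fractal F M = fractal F M"
    "(\<And>v. v \<in> vertices F M \<Longrightarrow> R v = v) \<Longrightarrow> x \<in> fractal F M \<Longrightarrow> R x = x"
proof -
  let ?s = "L powi M"
  have s: "?s \<noteq> 0" using L_pos by simp
  define T where "T x = (1 / ?s) *\<^sub>R R (?s *\<^sub>R x)" for x
  have T: "affine_isometry T" unfolding T_def by (rule affine_isometry_scale[OF R(1) s])
  have RT: "R (?s *\<^sub>R x) = ?s *\<^sub>R T x" for x using s L_pos(2) by (simp add: T_def)
  have "T v \<in> V" if "v \<in> V" for v
  proof -
    have "?s *\<^sub>R v \<in> vertices F M" unfolding vertices_def using that by (rule imageI)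
    then have "R (?s *\<^sub>R v) \<in> vertices F M" using R(2) by blast
    then have "?s *\<^sub>R T v \<in> vertices F M" unfolding RT .
    then show ?thesis using s by (auto simp: vertices_def)
  qed
  then have "T ` K = K" by (rule isometry_image_K[OF T])
  have "R ` fractal F M = (\<lambda>x. ?s *\<^sub>R x) ` T ` K" unfolding fractal_scale by (simp add: image_image RT)
  then show "R ` fractal F M = fractal F M" using \<open>T ` K = K\<close> by (simp add: fractal_scale)
  show "R x = x" if fixed: "\<And>v. v \<in> vertices F M \<Longrightarrow> R v = v" and x: "x \<in> fractal F M"
  proof -
    have "T v = v" if "v \<in> V" for v
    proof -
      have "?s *\<^sub>R v \<in> vertices F M" unfolding vertices_def using that by (rule imageI)
      then have "R (?s *\<^sub>R v) = ?s *\<^sub>R v" by (rule fixed)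
      then show ?thesis using s L_pos(2) by (simp add: T_def)
    qed
    moreover obtain k where k: "k \<in> K" "x = ?s *\<^sub>R k" using x by (auto simp: fractal_scale)
    ultimately have "T k = k" using isometry_fixing_vertices[OF T] by blast
    then show ?thesis using RT k(2) by simp
  qed
qed

abbreviation "complexv M v \<equiv> complex_at F M ((L powi M) *\<^sub>R v)"

lemma complexes_meet_at_vertex:
  assumes "v \<in> shifts" "v' \<in> shifts" "v \<noteq> v'" "x \<in> complexv M v" "x \<in> complexv M v'"
  shows "x - (L powi M) *\<^sub>R v \<in> vertices F M"
proof -
  have "(L powi (- M)) *\<^sub>R x - v \<in> V" by (rule complexes_meet_in_vertices[OF assms])
  moreover have "x - (L powi M) *\<^sub>R v = (L powi M) *\<^sub>R ((L powi (- M)) *\<^sub>R x - v)"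
    using L_pos by (simp add: scaleR_diff_right power_int_minus)
  ultimately show ?thesis unfolding vertices_def by blast
qed

text \<open>A point of two complexes is a vertex of both, and either choice projects it to the vertex of \<open>fractal F M\<close>
that has its label. So the arbitrary choices in \<open>fractal_proj\<close> do not matter.\<close>

lemma projection_on_complex:
  assumes glp: "good_labeling_property F" and v: "v \<in> shifts"
  obtains R where "affine_isometry R" "R ` vertices F M = vertices F M"
    "\<forall>x\<in>complexv M v. fractal_proj F M x = R (x - (L powi M) *\<^sub>R v)"
    "\<forall>x\<in>vertices_at F M ((L powi M) *\<^sub>R v). labeling F M x = labeling F M (R (x - (L powi M) *\<^sub>R v))"
proof -
  let ?l = "labeling F M"
  have gl: "good_labeling F M ?l" by (rule good_labeling_labeling[OF glp])
  then have bij: "inj_on ?l (vertices F M)" and ex: "\<And>\<nu>. \<nu> \<in> complex_shifts F M \<Longrightarrow> \<exists>R. rotation_fits F M ?l \<nu> R"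
    unfolding good_labeling_def bij_betw_def by auto
  define Rot where "Rot \<nu> = (SOME R. rotation_fits F M ?l \<nu> R)" for \<nu>
  have fits: "rotation_fits F M ?l \<nu> (Rot \<nu>)" if "\<nu> \<in> complex_shifts F M" for \<nu>
    unfolding Rot_def using ex[OF that] by (rule someI_ex)
  have RV: "Rot \<nu> ` vertices F M = vertices F M" if "\<nu> \<in> complex_shifts F M" for \<nu>
    using fits[OF that] unfolding rotation_fits_def rotations_def by blast
  let ?\<nu> = "(L powi M) *\<^sub>R v"
  have \<nu>: "?\<nu> \<in> complex_shifts F M" unfolding complex_shifts_eq using v by blast
  have proj: "fractal_proj F M x = Rot ?\<nu> (x - ?\<nu>)" if x: "x \<in> complexv M v" for x
  proof -
    define \<nu>0 where "\<nu>0 = (SOME \<nu>. \<nu> \<in> complex_shifts F M \<and> x \<in> complex_at F M \<nu>)"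
    have "\<nu>0 \<in> complex_shifts F M \<and> x \<in> complex_at F M \<nu>0"
      unfolding \<nu>0_def by (rule someI[of _ ?\<nu>]) (use \<nu> x in simp)
    then have \<nu>0: "\<nu>0 \<in> complex_shifts F M" "x \<in> complex_at F M \<nu>0" by auto
    have p: "fractal_proj F M x = Rot \<nu>0 (x - \<nu>0)" unfolding fractal_proj_def \<nu>0_def Rot_def by (simp add: Let_def)
    obtain v0 where v0: "v0 \<in> shifts" "\<nu>0 = (L powi M) *\<^sub>R v0" using \<nu>0(1) unfolding complex_shifts_eq by blast
    show ?thesis
    proof (cases "v0 = v")
      case True then show ?thesis using p v0 by simp
    next
      case False
      have xv: "x - ?\<nu> \<in> vertices F M" "x - \<nu>0 \<in> vertices F M"
        using complexes_meet_at_vertex[OF v v0(1) _ x] complexes_meet_at_vertex[OF v0(1) v False _ x]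
          \<nu>0(2) False unfolding v0(2) by auto
      then have "x \<in> vertices_at F M ?\<nu>" "x \<in> vertices_at F M \<nu>0"
        unfolding vertices_at_def by (auto intro!: image_eqI[of x _ "x - _"])
      then have "?l x = ?l (Rot ?\<nu> (x - ?\<nu>))" "?l x = ?l (Rot \<nu>0 (x - \<nu>0))"
        using fits[OF \<nu>] fits[OF \<nu>0(1)] unfolding rotation_fits_def by blast+
      then have "?l (Rot ?\<nu> (x - ?\<nu>)) = ?l (Rot \<nu>0 (x - \<nu>0))" by simp
      moreover have "Rot ?\<nu> (x - ?\<nu>) \<in> vertices F M" "Rot \<nu>0 (x - \<nu>0) \<in> vertices F M"
        using RV[OF \<nu>] RV[OF \<nu>0(1)] xv by blast+
      ultimately show ?thesis using p inj_onD[OF bij] by simp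
    qed
  qed
  show thesis
  proof (rule that[OF _ RV[OF \<nu>]])
    show "affine_isometry (Rot ?\<nu>)"
      using fits[OF \<nu>] rotation_affine_isometry unfolding rotation_fits_def by blast
    show "\<forall>x\<in>complexv M v. fractal_proj F M x = Rot ?\<nu> (x - ?\<nu>)" using proj by blast
    show "\<forall>x\<in>vertices_at F M ?\<nu>. ?l x = ?l (Rot ?\<nu> (x - ?\<nu>))"
      using fits[OF \<nu>] unfolding rotation_fits_def by blast
  qed
qed

lemma complexv_minus: "x \<in> complexv M v \<longleftrightarrow> x - (L powi M) *\<^sub>R v \<in> fractal F M"
  unfolding complex_at_def by (auto intro!: image_eqI[of x _ "x - (L powi M) *\<^sub>R v"])

lemma projection_in_fractal:
  assumes glp: "good_labeling_property F" and v: "v \<in> shifts" and x: "x \<in> complexv M v"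
  shows "fractal_proj F M x \<in> fractal F M"
proof -
  obtain R where R: "affine_isometry R" "R ` vertices F M = vertices F M"
    "\<forall>x\<in>complexv M v. fractal_proj F M x = R (x - (L powi M) *\<^sub>R v)"
    by (rule projection_on_complex[OF glp v, of M])
  have "R ` fractal F M = fractal F M" using vertices_isometry(1)[OF R(1)] R(2) by simp
  then show ?thesis using R(3) x complexv_minus by auto
qed

lemma projection_dist:
  assumes glp: "good_labeling_property F" and v: "v \<in> shifts" and x: "x \<in> complexv M v" "y \<in> complexv M v"
  shows "norm (fractal_proj F M x - fractal_proj F M y) = norm (x - y)"
proof -
  obtain R where R: "affine_isometry R" "\<forall>x\<in>complexv M v. fractal_proj F M x = R (x - (L powi M) *\<^sub>R v)"
    by (rule projection_on_complex[OF glp v, of M])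
  then show ?thesis using x affine_isometry_dist[OF R(1), of "x - (L powi M) *\<^sub>R v" "y - (L powi M) *\<^sub>R v"]
    by (simp add: dist_norm)
qed

lemma projection_surj:
  assumes glp: "good_labeling_property F" and v: "v \<in> shifts" and y: "y \<in> fractal F M"
  obtains y' where "y' \<in> complexv M v" "fractal_proj F M y' = y"
proof -
  obtain R where R: "affine_isometry R" "R ` vertices F M = vertices F M"
    "\<forall>x\<in>complexv M v. fractal_proj F M x = R (x - (L powi M) *\<^sub>R v)"
    by (rule projection_on_complex[OF glp v, of M])
  have "y \<in> R ` fractal F M" using vertices_isometry(1)[OF R(1)] R(2) y by simp
  then obtain z where z: "z \<in> fractal F M" "R z = y" by blast
  have "z + (L powi M) *\<^sub>R v \<in> complexv M v" using z(1) by (simp add: complexv_minus)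
  then show thesis using R(3) z(2) that[of "z + (L powi M) *\<^sub>R v"] by simp
qed

lemma fractal_complexv: "complex_at F M 0 = fractal F M" by (simp add: complex_at_def)

text \<open>The rotation chosen for \<open>fractal F M\<close> itself preserves the labels of its vertices, which are pairwise
different, so it fixes them.\<close>

lemma projection_id:
  assumes glp: "good_labeling_property F" and x: "x \<in> fractal F M"
  shows "fractal_proj F M x = x"
proof -
  obtain R where R: "affine_isometry R" "R ` vertices F M = vertices F M"
    "\<forall>x\<in>complexv M 0. fractal_proj F M x = R (x - (L powi M) *\<^sub>R 0)"
    "\<forall>x\<in>vertices_at F M ((L powi M) *\<^sub>R 0). labeling F M x = labeling F M (R (x - (L powi M) *\<^sub>R 0))"
    by (rule projection_on_complex[OF glp zero_in_shifts, of M])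
  have inj: "inj_on (labeling F M) (vertices F M)"
    using good_labeling_labeling[OF glp] unfolding good_labeling_def bij_betw_def by blast
  have fixv: "R v = v" if "v \<in> vertices F M" for v
  proof -
    have "labeling F M v = labeling F M (R v)" using R(4) that by (simp add: vertices_at_def)
    moreover have "R v \<in> vertices F M" using R(2) that by blast
    ultimately show ?thesis using inj that by (metis inj_onD)
  qed
  have "R x = x" by (rule vertices_isometry(2)[OF R(1) _ fixv x]) (simp_all add: R(2))
  then show ?thesis using R(3) x by (simp add: fractal_complexv)
qed

lemma projection_vertex:
  assumes glp: "good_labeling_property F" and v: "v \<in> shifts" "v' \<in> shifts" "v \<noteq> v'"
    and x: "x \<in> complexv M v" "x \<in> complexv M v'"
  shows "fractal_proj F M x \<in> vertices F M"
proof -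
  obtain R where R: "R ` vertices F M = vertices F M"
    "\<forall>x\<in>complexv M v. fractal_proj F M x = R (x - (L powi M) *\<^sub>R v)"
    by (rule projection_on_complex[OF glp v(1), of M])
  then show ?thesis using complexes_meet_at_vertex[OF v x] x by auto
qed

lemma infinite_K: "infinite K"
proof
  assume "finite K"
  then have "K = {} \<or> (\<exists>a. K = {a})" using connected_finite_iff_sing[OF connected_K] by simp
  then obtain a where a: "V \<subseteq> {a}" using V_subset_K by auto
  then have "card V \<le> card {a}" by (intro card_mono) auto
  then show False using card_essential by simp
qed

text \<open>A complex with two different vectors would consist of vertices, and the attractor is infinite.\<close>

lemma complexv_inj:
  assumes "v \<in> shifts" "v' \<in> shifts" "complexv M v = complexv M v'" shows "v = v'"
proof (rule ccontr)
  assume ne: "v \<noteq> v'"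
  have "K \<subseteq> V"
  proof
    fix k assume k: "k \<in> K"
    define x where "x = (L powi M) *\<^sub>R (k + v)"
    have x: "(L powi (- M)) *\<^sub>R x = k + v" using L_pos by (simp add: x_def power_int_minus)
    then have "x \<in> complexv M v" using k by (simp add: mem_complex_at)
    then show "k \<in> V" using complexes_meet_in_vertices[OF assms(1,2) ne, of x M] assms(3) x by simp
  qed
  then show False using infinite_K finite_V finite_subset by blast
qed

lemma finite_complexes_at_point: "finite {v\<in>shifts. x \<in> complexv M v}"
proof (rule finite_subset[OF _ shifts_finite_ball])
  show "{v\<in>shifts. x \<in> complexv M v} \<subseteq> {v\<in>shifts. norm v \<le> norm ((L powi (- M)) *\<^sub>R x) + \<kappa>}"
  proof clarify
    fix v assume "x \<in> complexv M v"
    then have "norm ((L powi (- M)) *\<^sub>R x - v) \<le> \<kappa>" using \<kappa>(2) mem_complex_at by blast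
    then show "norm v \<le> norm ((L powi (- M)) *\<^sub>R x) + \<kappa>"
      using norm_triangle_ineq2[of v "(L powi (- M)) *\<^sub>R x"] by (simp add: norm_minus_commute)
  qed
qed

lemma complex_rank_eq: "complex_rank F M x = card {v\<in>shifts. x \<in> complexv M v}"
proof -
  have "{\<Delta> \<in> complexes F M. x \<in> \<Delta>} = complexv M ` {v\<in>shifts. x \<in> complexv M v}"
    unfolding complexes_def complex_shifts_eq by auto
  moreover have "inj_on (complexv M) {v\<in>shifts. x \<in> complexv M v}"
    using complexv_inj by (intro inj_onI) auto
  ultimately show ?thesis unfolding complex_rank_def by (simp add: card_image)
qed

text \<open>By \<open>meeting_words\<close> either the distance is of the order of the size of a complex, or the two complexes have a
common point nearby. The projection fixes this point and is isometric on the complex of \<open>y\<close>.\<close>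

lemma projection_dist_le:
  assumes glp: "good_labeling_property F"
  obtains C where "C > 0"
    "\<forall>M. \<forall>x\<in>fractal F M. \<forall>y\<in>unbounded_fractal F. norm (x - fractal_proj F M y) \<le> C * norm (x - y)"
proof -
  obtain c C where cC: "c > 0" "C > 0"
    "\<forall>u\<in>lists I. \<forall>u'\<in>lists I. \<forall>x y. length u = length u' \<longrightarrow> x - word_shift u \<in> K \<longrightarrow> y - word_shift u' \<in> K \<longrightarrow>
       c \<le> norm (x - y) \<or> (\<exists>z. z - word_shift u \<in> K \<and> z - word_shift u' \<in> K \<and> norm (x - z) + norm (y - z) \<le> C * norm (x - y))"
    by (rule meeting_words)
  define D where "D = max C (2 * \<kappa> / c)"
  have "norm (x - fractal_proj F M y) \<le> D * norm (x - y)"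
    if x: "x \<in> fractal F M" and y: "y \<in> unbounded_fractal F" for x y M
  proof -
    let ?s = "L powi M" and ?i = "L powi (- M)"
    have s: "?s > 0" "?i > 0" "?i * ?s = 1" using L_pos by (simp_all add: power_int_minus)
    obtain v where v: "v \<in> shifts" "y \<in> complexv M v" using unbounded_covered[OF y] .
    obtain u u' where u: "u \<in> lists I" "u' \<in> lists I" "length u = length u'" "word_shift u = 0" "word_shift u' = v"
      using zero_in_shifts v(1) by (rule shifts_words_pair)
    have xK: "?i *\<^sub>R x - word_shift u \<in> K" using x u(4) by (simp add: mem_fractal)
    have yK: "?i *\<^sub>R y - word_shift u' \<in> K" using v(2) u(5) by (simp add: mem_complex_at)
    have n: "norm (?i *\<^sub>R x - ?i *\<^sub>R y) = ?i * norm (x - y)" for x y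
      using s by (simp flip: scaleR_diff_right)
    from cC(3) u(1-3) xK yK consider "c \<le> norm (?i *\<^sub>R x - ?i *\<^sub>R y)" |
      z where "z - word_shift u \<in> K" "z - word_shift u' \<in> K" "norm (?i *\<^sub>R x - z) + norm (?i *\<^sub>R y - z) \<le> C * norm (?i *\<^sub>R x - ?i *\<^sub>R y)"
      by blast
    then show ?thesis
    proof cases
      case 1
      have "fractal_proj F M y \<in> fractal F M" by (rule projection_in_fractal[OF glp v])
      then have "?i *\<^sub>R fractal_proj F M y \<in> K" "?i *\<^sub>R x \<in> K" using x mem_fractal by auto
      then have "?i * norm (x - fractal_proj F M y) \<le> 2 * \<kappa>" using K_dist n by metis
      also have "\<dots> = (2 * \<kappa> / c) * c" using cC by simp
      also have "\<dots> \<le> D * (?i * norm (x - y))"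
        using 1 \<kappa>(1) cC(1,2) unfolding n by (intro mult_mono) (auto simp: D_def max_def)
      finally show ?thesis using s by (simp add: mult.left_commute)
    next
      case (2 z)
      define z' where "z' = ?s *\<^sub>R z"
      have z: "z = ?i *\<^sub>R z'" using s by (simp add: z'_def)
      have zv: "z' \<in> complexv M 0" "z' \<in> complexv M v" using 2 u unfolding mem_complex_at z by auto
      have "?i * (norm (x - z') + norm (y - z')) \<le> ?i * (C * norm (x - y))"
        using 2(3) unfolding z n by (simp add: distrib_left mult.left_commute)
      then have le: "norm (x - z') + norm (y - z') \<le> C * norm (x - y)" using s by simp
      have "fractal_proj F M z' = z'" using projection_id[OF glp] zv(1) fractal_complexv by simp
      then have "norm (x - fractal_proj F M y) \<le> norm (x - z') + norm (fractal_proj F M z' - fractal_proj F M y)"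
        using norm_triangle_ineq[of "x - z'" "z' - fractal_proj F M y"] by simp
      also have "norm (fractal_proj F M z' - fractal_proj F M y) = norm (y - z')"
        using projection_dist[OF glp v(1) zv(2) v(2)] by (simp add: norm_minus_commute)
      also have "norm (x - z') + norm (y - z') \<le> D * norm (x - y)"
        using le by (rule order_trans) (simp add: D_def mult_right_mono)
      finally show ?thesis .
    qed
  qed
  moreover have "D > 0" using cC by (simp add: D_def max_def)
  ultimately show thesis using that by blast
qed

end

section \<open>The reflected heat kernel\<close>

lemma infsum_ennreal_le:
  fixes f :: "'a \<Rightarrow> ennreal"
  assumes "\<And>A'. finite A' \<Longrightarrow> A' \<subseteq> A \<Longrightarrow> sum f A' \<le> B"
  shows "infsum f A \<le> B"
  by (subst nonneg_infsum_complete) (use assms in \<open>auto intro!: SUP_least\<close>)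

lemma infsum_ennreal_ge:
  fixes f :: "'a \<Rightarrow> ennreal"
  assumes "finite A'" "A' \<subseteq> A" shows "sum f A' \<le> infsum f A"
  by (subst nonneg_infsum_complete) (use assms in \<open>auto intro!: SUP_upper\<close>)

context simple_nested_fractal
begin

lemma proj_fiber_member:
  assumes "y' \<in> proj_fiber F M y"
  shows "y' \<in> unbounded_fractal F" "fractal_proj F M y' = y"
  using assms unfolding proj_fiber_def by auto

text \<open>Weighting a point of the fiber by its rank amounts to counting it once in each complex that contains it, and
each complex contains at most one point of the fiber.\<close>

lemma fiber_sum_le:
  assumes glp: "good_labeling_property F"
    and A: "finite A" "A \<subseteq> proj_fiber F M y"
    and \<Phi>: "\<And>v y'. v \<in> shifts \<Longrightarrow> y' \<in> A \<Longrightarrow> y' \<in> complexv M v \<Longrightarrow> \<phi> y' \<le> \<Phi> v"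
    and B: "\<And>W. finite W \<Longrightarrow> W \<subseteq> shifts \<Longrightarrow> sum \<Phi> W \<le> B"
  shows "(\<Sum>y'\<in>A. \<phi> y' * real (complex_rank F M y')) \<le> B"
proof -
  define N' where "N' y' = {v\<in>shifts. y' \<in> complexv M v}" for y'
  have finN: "finite (N' y')" for y' unfolding N'_def by (rule finite_complexes_at_point)
  have inj: "inj_on snd (Sigma A N')"
  proof (rule inj_onI)
    fix p q assume pq: "p \<in> Sigma A N'" "q \<in> Sigma A N'" "snd p = snd q"
    obtain y1 v where p: "p = (y1, v)" by (cases p)
    obtain y2 where q: "q = (y2, v)" using pq(3) p by (cases q) auto
    have m: "y1 \<in> A" "y2 \<in> A" "v \<in> shifts" "y1 \<in> complexv M v" "y2 \<in> complexv M v"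
      using pq(1,2) unfolding p q N'_def by auto
    have "norm (y1 - y2) = norm (fractal_proj F M y1 - fractal_proj F M y2)"
      using projection_dist[OF glp m(3,4,5)] by simp
    also have "\<dots> = 0" using m(1,2) A(2) proj_fiber_member(2) by (metis diff_self norm_zero subsetD)
    finally show "p = q" using p q by simp
  qed
  have "(\<Sum>y'\<in>A. \<phi> y' * real (complex_rank F M y')) = (\<Sum>y'\<in>A. \<Sum>v\<in>N' y'. \<phi> y')"
    by (intro sum.cong refl) (simp add: complex_rank_eq N'_def)
  also have "\<dots> = (\<Sum>(y', v)\<in>Sigma A N'. \<phi> y')" using A(1) finN by (intro sum.Sigma) auto
  also have "\<dots> \<le> (\<Sum>(y', v)\<in>Sigma A N'. \<Phi> v)"
    by (intro sum_mono) (auto simp: N'_def intro: \<Phi>)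
  also have "\<dots> = (\<Sum>p\<in>Sigma A N'. \<Phi> (snd p))" by (intro sum.cong) auto
  also have "\<dots> = sum \<Phi> (snd ` Sigma A N')" by (simp add: sum.reindex[OF inj])
  also have "\<dots> \<le> B"
    by (intro B) (use A(1) finN in \<open>auto simp: N'_def\<close>)
  finally show ?thesis .
qed

lemma complex_rank_ge_1: assumes "y \<in> unbounded_fractal F" shows "complex_rank F M y \<ge> 1"
proof -
  obtain v where "v \<in> shifts" "y \<in> complexv M v" using unbounded_covered[OF assms] .
  then have "{v\<in>shifts. y \<in> complexv M v} \<noteq> {}" by blast
  then have "card {v\<in>shifts. y \<in> complexv M v} > 0" using finite_complexes_at_point by (simp add: card_gt_0_iff)
  then show ?thesis by (simp add: complex_rank_eq)
qed

lemma reflected_density_le: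
  assumes glp: "good_labeling_property F"
    and pos: "\<And>y'. y' \<in> unbounded_fractal F \<Longrightarrow> g t x y' \<ge> 0"
    and \<Phi>: "\<And>v y'. v \<in> shifts \<Longrightarrow> y' \<in> proj_fiber F M y \<Longrightarrow> y' \<in> complexv M v \<Longrightarrow> g t x y' \<le> \<Phi> v"
    and B: "\<And>W. finite W \<Longrightarrow> W \<subseteq> shifts \<Longrightarrow> sum \<Phi> W \<le> B"
  shows "reflected_density F g M t x y \<le> ennreal B"
proof -
  have le: "(\<Sum>y'\<in>A. ennreal (g t x y') * of_nat (complex_rank F M y')) \<le> ennreal B"
    if A: "finite A" "A \<subseteq> proj_fiber F M y" for A
  proof -
    have p: "g t x y' \<ge> 0" if "y' \<in> A" for y' using that A(2) proj_fiber_member(1) pos by blast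
    have "(\<Sum>y'\<in>A. ennreal (g t x y') * of_nat (complex_rank F M y'))
       = (\<Sum>y'\<in>A. ennreal (g t x y' * real (complex_rank F M y')))"
      using p by (intro sum.cong refl) (simp add: ennreal_mult ennreal_of_nat_eq_real_of_nat)
    also have "\<dots> = ennreal (\<Sum>y'\<in>A. g t x y' * real (complex_rank F M y'))"
      using p by (intro sum_ennreal) simp
    also have "\<dots> \<le> ennreal B"
      by (intro ennreal_leI fiber_sum_le[OF glp A, where \<Phi> = \<Phi>]) (use A(2) \<Phi> B in blast)+
    finally show ?thesis .
  qed
  have le1: "(\<Sum>y'\<in>A. ennreal (g t x y')) \<le> ennreal B" if A: "finite A" "A \<subseteq> proj_fiber F M y" for A
  proof -
    have "(\<Sum>y'\<in>A. ennreal (g t x y')) \<le> (\<Sum>y'\<in>A. ennreal (g t x y') * of_nat (complex_rank F M y'))"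
    proof (intro sum_mono)
      fix y' assume "y' \<in> A"
      then have "1 \<le> complex_rank F M y'" using A(2) proj_fiber_member(1) complex_rank_ge_1 by blast
      then have "(1::ennreal) \<le> of_nat (complex_rank F M y')" by (metis of_nat_1 of_nat_mono)
      then have "ennreal (g t x y') * 1 \<le> ennreal (g t x y') * of_nat (complex_rank F M y')"
        by (intro mult_left_mono) auto
      then show "ennreal (g t x y') \<le> ennreal (g t x y') * of_nat (complex_rank F M y')" by simp
    qed
    also have "\<dots> \<le> ennreal B" by (rule le[OF A])
    finally show ?thesis .
  qed
  show ?thesis unfolding reflected_density_def
    using infsum_ennreal_le[of "proj_fiber F M y", OF le] infsum_ennreal_le[of "proj_fiber F M y", OF le1] by simp
qed

text \<open>Every complex contains a point of the fiber. A point that arises from several complexes is a vertex, and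
there the rank makes up for the coincidence.\<close>

lemma reflected_density_ge:
  assumes glp: "good_labeling_property F" and y: "y \<in> fractal F M"
    and W: "finite W" "W \<subseteq> shifts" and c: "c \<ge> 0"
    and g: "\<And>v y'. v \<in> W \<Longrightarrow> y' \<in> complexv M v \<Longrightarrow> fractal_proj F M y' = y \<Longrightarrow> c \<le> g t x y'"
  shows "ennreal (c * real (card W)) \<le> reflected_density F g M t x y"
proof -
  have "\<exists>y'. y' \<in> complexv M v \<and> fractal_proj F M y' = y" if "v \<in> W" for v
    using projection_surj[OF glp _ y] that W(2) by blast
  then obtain f where f: "\<And>v. v \<in> W \<Longrightarrow> f v \<in> complexv M v \<and> fractal_proj F M (f v) = y" by metis
  have fib: "f ` W \<subseteq> proj_fiber F M y"
  proof
    fix y' assume "y' \<in> f ` W"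
    then obtain v where v: "v \<in> W" "y' = f v" by blast
    then show "y' \<in> proj_fiber F M y"
      unfolding proj_fiber_def using f[OF v(1)] complex_subset_unbounded[of v M] W(2) by auto
  qed
  define n where "n y' = card {v\<in>W. f v = y'}" for y'
  have cg: "c \<le> g t x y'" if "y' \<in> f ` W" for y' using that f g by blast
  have card_eq: "real (card W) = (\<Sum>y'\<in>f ` W. real (n y'))"
    using sum.image_gen[OF W(1), of "\<lambda>_. 1::real" f] by (simp add: n_def)
  have key: "ennreal (c * real (card W)) \<le> (\<Sum>y'\<in>f ` W. ennreal (g t x y') * r y')"
    if r: "\<And>y'. y' \<in> f ` W \<Longrightarrow> of_nat (n y') \<le> r y'" for r :: "real^2 \<Rightarrow> ennreal"
  proof -
    have "ennreal (c * real (card W)) = (\<Sum>y'\<in>f ` W. ennreal (c * real (n y')))"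
      unfolding card_eq sum_distrib_left using c by (intro sum_ennreal[symmetric]) simp
    also have "\<dots> = (\<Sum>y'\<in>f ` W. ennreal c * of_nat (n y'))"
      using c by (simp add: ennreal_mult ennreal_of_nat_eq_real_of_nat)
    also have "\<dots> \<le> (\<Sum>y'\<in>f ` W. ennreal (g t x y') * r y')"
      by (intro sum_mono mult_mono r ennreal_leI cg) auto
    finally show ?thesis .
  qed
  show ?thesis
  proof (cases "y \<in> vertices F M")
    case True
    have "of_nat (n y') \<le> (of_nat (complex_rank F M y') :: ennreal)" for y'
    proof -
      have "n y' \<le> card {v\<in>shifts. y' \<in> complexv M v}"
        unfolding n_def by (rule card_mono[OF finite_complexes_at_point]) (use W(2) f in auto)
      then show ?thesis unfolding complex_rank_eq by (rule of_nat_mono)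
    qed
    then have "ennreal (c * real (card W)) \<le> (\<Sum>y'\<in>f ` W. ennreal (g t x y') * of_nat (complex_rank F M y'))"
      by (intro key)
    also have "\<dots> \<le> (\<Sum>\<^sub>\<infinity>y'\<in>proj_fiber F M y. ennreal (g t x y') * of_nat (complex_rank F M y'))"
      using W(1) fib by (intro infsum_ennreal_ge) auto
    finally show ?thesis using True by (simp add: reflected_density_def)
  next
    case False
    have "of_nat (n y') \<le> (1 :: ennreal)" if y': "y' \<in> f ` W" for y'
    proof -
      obtain v where v: "v \<in> W" "y' = f v" using y' by blast
      have "{v\<in>W. f v = y'} \<subseteq> {v}"
      proof
        fix v' assume v': "v' \<in> {v\<in>W. f v = y'}"
        show "v' \<in> {v}"
        proof (rule ccontr)
          assume "v' \<notin> {v}"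
          then have "v \<noteq> v'" by auto
          then have "fractal_proj F M y' \<in> vertices F M"
            using projection_vertex[OF glp, of v v' y' M] v v' f[OF v(1)] f[of v'] W(2) by auto
          then show False using False f[OF v(1)] v(2) by simp
        qed
      qed
      then have "n y' \<le> card {v}" unfolding n_def by (intro card_mono) auto
      then show ?thesis by (metis card.empty card_insert_disjoint empty_iff finite.emptyI of_nat_1 of_nat_mono One_nat_def)
    qed
    then have "ennreal (c * real (card W)) \<le> (\<Sum>y'\<in>f ` W. ennreal (g t x y') * 1)" by (intro key)
    also have "\<dots> \<le> (\<Sum>\<^sub>\<infinity>y'\<in>proj_fiber F M y. ennreal (g t x y') * 1)"
      using W(1) fib by (intro infsum_ennreal_ge) auto
    finally show ?thesis using False by (simp add: reflected_density_def)
  qed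
qed

lemma density_le_reflected_density:
  assumes glp: "good_labeling_property F" and y: "y \<in> fractal F M" and pos: "g t x y \<ge> 0"
  shows "ennreal (g t x y) \<le> reflected_density F g M t x y"
proof -
  have "ennreal (g t x y * real (card {0::real^2})) \<le> reflected_density F g M t x y"
  proof (rule reflected_density_ge[OF glp y])
    fix v y' assume "v \<in> {0::real^2}" "y' \<in> complexv M v" "fractal_proj F M y' = y"
    then have "y' \<in> fractal F M" "fractal_proj F M y' = y" using fractal_complexv by auto
    then show "g t x y \<le> g t x y'" using projection_id[OF glp] by simp
  qed (use zero_in_shifts pos in auto)
  then show ?thesis by simp
qed

lemma powi_nat: "L powi int M = L ^ M" by simp

lemma scale_bracket:
  assumes "dw > 0" "s \<ge> L powr (real M * dw)"
  obtains m :: nat where "L powr (real (M + m) * dw) \<le> s" "s \<le> L powr (real (M + m + 1) * dw)"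
proof -
  have ex: "\<exists>m::nat. s \<le> L powr (real (M + m + 1) * dw)"
  proof -
    have "1 < L powr dw" using scaling assms(1) by (rule gr_one_powr)
    then obtain k where k: "s < (L powr dw) ^ k" using real_arch_pow by blast
    also have "\<dots> = L powr (real k * dw)"
      using L_pos by (simp add: powr_realpow[symmetric] powr_powr mult.commute)
    also have "\<dots> \<le> L powr (real (M + k + 1) * dw)"
      using scaling assms(1) by (intro powr_mono mult_right_mono) auto
    finally show ?thesis by (intro exI[of _ k]) simp
  qed
  define m where "m = (LEAST m::nat. s \<le> L powr (real (M + m + 1) * dw))"
  have 1: "s \<le> L powr (real (M + m + 1) * dw)" unfolding m_def using ex by (rule LeastI_ex)
  have 2: "L powr (real (M + m) * dw) \<le> s"
  proof (cases m)
    case 0 then show ?thesis using assms(2) by simp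
  next
    case (Suc k)
    have "\<not> s \<le> L powr (real (M + k + 1) * dw)"
      using not_less_Least[of k "\<lambda>m. s \<le> L powr (real (M + m + 1) * dw)"] Suc unfolding m_def by simp
    then show ?thesis using Suc by (simp add: add.commute)
  qed
  show thesis by (rule that[OF 2 1])
qed

lemma powr_neg_scale:
  assumes "dw > 0" "L powr (a * dw) \<le> s"
  shows "s powr (- d / dw) \<le> L powr (- a * d)"
proof -
  have "s powr (- d / dw) \<le> (L powr (a * dw)) powr (- d / dw)"
    using assms d_pos L_pos by (intro powr_mono2') auto
  also have "\<dots> = L powr (- a * d)" using assms(1) by (simp add: powr_powr field_simps)
  finally show ?thesis .
qed

lemma powr_neg_scale_ge:
  assumes "dw > 0" "0 < s" "s \<le> L powr (a * dw)"
  shows "L powr (- a * d) \<le> s powr (- d / dw)"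
proof -
  have "L powr (- a * d) = (L powr (a * dw)) powr (- d / dw)" using assms(1) by (simp add: powr_powr field_simps)
  also have "\<dots> \<le> s powr (- d / dw)" using assms d_pos by (intro powr_mono2') auto
  finally show ?thesis .
qed

lemma complex_dist_ge:
  assumes "x \<in> fractal F (int M)" "y' \<in> complexv (int M) v"
  shows "L ^ M * max 0 (norm v - 2 * \<kappa>) \<le> norm (x - y')"
proof -
  obtain k k' where k: "k \<in> K" "x = L ^ M *\<^sub>R k" "k' \<in> K" "y' = L ^ M *\<^sub>R (k' + v)"
    using assms by (auto simp: complex_at_def fractal_scale scaleR_add_right)
  have "norm v - 2 * \<kappa> \<le> norm (k - (k' + v))"
    using K_dist[OF k(1,3)] norm_triangle_ineq2[of v "k - k'"]
    by (simp add: norm_minus_commute diff_diff_eq2 algebra_simps)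
  then have "max 0 (norm v - 2 * \<kappa>) \<le> norm (k - (k' + v))" by simp
  then have "L ^ M * max 0 (norm v - 2 * \<kappa>) \<le> L ^ M * norm (k - (k' + v))"
    using L_pos by (intro mult_left_mono) auto
  also have "\<dots> = norm (x - y')" using k L_pos by (simp flip: scaleR_diff_right)
  finally show ?thesis .
qed

text \<open>Half of the exponent is spent on \<open>norm (x - y)\<close>, which is at most a constant times the distance of \<open>x\<close> to
any copy of \<open>y\<close>. The other half makes the sum over the complexes converge, by \<open>shifts_weight_sum\<close>.\<close>

lemma reflected_density_upper:
  assumes glp: "good_labeling_property F"
    and pos: "dw > 0" "\<gamma> > 0" "K3 > 0" "K4 > 0"
    and nonneg: "\<And>t x y. t > 0 \<Longrightarrow> x \<in> unbounded_fractal F \<Longrightarrow> y \<in> unbounded_fractal F \<Longrightarrow> g t x y \<ge> 0"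
    and upper: "\<And>t x y. t > 0 \<Longrightarrow> x \<in> unbounded_fractal F \<Longrightarrow> y \<in> unbounded_fractal F \<Longrightarrow>
      g t x y \<le> K3 * t powr (- d / dw) * exp (- K4 * (norm (x - y) powr dw / t) powr \<gamma>)"
  obtains C c where "C > 0" "c > 0"
    "\<forall>M m s x y. x \<in> fractal F (int M) \<longrightarrow> y \<in> fractal F (int M) \<longrightarrow> 0 < s \<longrightarrow> s \<le> L powr (real (M + m) * dw) \<longrightarrow>
       reflected_density F g (int M) s x y
         \<le> ennreal (C * real N ^ m * s powr (- d / dw) * exp (- c * (norm (x - y) powr dw / s) powr \<gamma>))"
proof -
  obtain C0 where C0: "C0 > 0"
    "\<forall>M. \<forall>x\<in>fractal F M. \<forall>y\<in>unbounded_fractal F. norm (x - fractal_proj F M y) \<le> C0 * norm (x - y)"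
    by (rule projection_dist_le[OF glp])
  have "K4 / 2 > 0" "dw * \<gamma> > 0" "d + 1 \<ge> 0" using pos d_pos by auto
  from exp_neg_powr_le[OF this]
  obtain C1 where C1: "C1 > 0" "\<forall>x\<ge>0. exp (- (K4 / 2) * x powr (dw * \<gamma>)) \<le> C1 * (1 + x) powr (- (d + 1))" .
  have "2 * \<kappa> \<ge> 0" using \<kappa>(1) by simp
  from shifts_weight_sum[OF this]
  obtain C2 where C2: "C2 > 0" "\<forall>W m. finite W \<longrightarrow> W \<subseteq> shifts \<longrightarrow>
       (\<Sum>v\<in>W. (1 + max 0 (norm v - 2 * \<kappa>) / L ^ m) powr (- (d + 1))) \<le> C2 * real N ^ m" .
  define c where "c = K4 / 2 * (1 / C0) powr (dw * \<gamma>)"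
  define C where "C = K3 * C1 * C2"
  have "C > 0" unfolding C_def using pos C1 C2 by simp
  moreover have "c > 0" unfolding c_def using pos C0 by simp
  moreover have "reflected_density F g (int M) s x y
         \<le> ennreal (C * real N ^ m * s powr (- d / dw) * exp (- c * (norm (x - y) powr dw / s) powr \<gamma>))"
    if x: "x \<in> fractal F (int M)" and y: "y \<in> fractal F (int M)" and s: "0 < s" "s \<le> L powr (real (M + m) * dw)"
    for M m s x y
  proof -
    have xU: "x \<in> unbounded_fractal F" using x fractal_subset_unbounded by blast
    define E where "E = exp (- c * (norm (x - y) powr dw / s) powr \<gamma>)"
    define X where "X v = max 0 (norm v - 2 * \<kappa>)" for v :: "real^2"
    define \<Phi> where "\<Phi> v = K3 * s powr (- d / dw) * E * (C1 * (1 + X v / L ^ m) powr (- (d + 1)))" for v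
    have X0: "X v \<ge> 0" for v by (simp add: X_def)
    have "reflected_density F g (int M) s x y \<le> ennreal (K3 * s powr (- d / dw) * E * C1 * (C2 * real N ^ m))"
    proof (rule reflected_density_le[OF glp, where \<Phi> = \<Phi>])
      show "g s x y' \<ge> 0" if "y' \<in> unbounded_fractal F" for y' using nonneg s xU that by blast
      show "sum \<Phi> W \<le> K3 * s powr (- d / dw) * E * C1 * (C2 * real N ^ m)" if W: "finite W" "W \<subseteq> shifts" for W
      proof -
        have "sum \<Phi> W = K3 * s powr (- d / dw) * E * C1 * (\<Sum>v\<in>W. (1 + X v / L ^ m) powr (- (d + 1)))"
          unfolding \<Phi>_def by (simp add: sum_distrib_left mult.assoc)
        also have "\<dots> \<le> K3 * s powr (- d / dw) * E * C1 * (C2 * real N ^ m)"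
          using C2(2) W pos C1 unfolding X_def E_def by (intro mult_left_mono) auto
        finally show ?thesis .
      qed
      fix v y' assume v: "v \<in> shifts" "y' \<in> proj_fiber F (int M) y" "y' \<in> complexv (int M) v"
      have y'U: "y' \<in> unbounded_fractal F" and py: "fractal_proj F (int M) y' = y"
        using proj_fiber_member[OF v(2)] by auto
      define r where "r = norm (x - y')"
      have r0: "r \<ge> 0" by (simp add: r_def)
      have r1: "norm (x - y) / C0 \<le> r" using C0(2) x y'U py C0(1) by (auto simp: r_def divide_le_eq mult.commute)
      have r2: "L ^ M * X v \<le> r" unfolding r_def X_def by (rule complex_dist_ge[OF x v(3)])
      define q where "q = (r powr dw / s) powr \<gamma>"
      \<comment> \<open>the exponent controls the distance of \<open>x\<close> and \<open>y\<close>\<close>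
      have e1: "(1 / C0) powr (dw * \<gamma>) * (norm (x - y) powr dw / s) powr \<gamma> \<le> q"
      proof -
        have "(1 / C0) powr (dw * \<gamma>) * (norm (x - y) powr dw / s) powr \<gamma>
          = ((norm (x - y) / C0) powr dw / s) powr \<gamma>"
          using C0(1) s by (simp add: powr_powr[symmetric] powr_mult[symmetric] powr_divide)
        also have "\<dots> \<le> q" unfolding q_def
          using r1 pos s C0 by (intro powr_mono2 divide_right_mono) auto
        finally show ?thesis .
      qed
      \<comment> \<open>the exponent controls the distance of the complex\<close>
      have e2: "(X v / L ^ m) powr (dw * \<gamma>) \<le> q"
      proof -
        have "(X v / L ^ m) powr dw = (L ^ M * X v) powr dw / L powr (real (M + m) * dw)"
          using L_pos X0[of v]
          by (simp add: powr_divide powr_mult powr_realpow[symmetric] powr_powr distrib_right powr_add)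
        also have "\<dots> \<le> r powr dw / L powr (real (M + m) * dw)"
          using r2 pos X0[of v] L_pos by (intro divide_right_mono powr_mono2) auto
        also have "\<dots> \<le> r powr dw / s" using s L_pos by (intro divide_left_mono mult_pos_pos) auto
        finally have "((X v / L ^ m) powr dw) powr \<gamma> \<le> q" unfolding q_def using pos by (intro powr_mono2) auto
        then show ?thesis by (simp add: powr_powr)
      qed
      have "exp (- K4 * q) = exp (- (K4 / 2) * q) * exp (- (K4 / 2) * q)" by (simp add: exp_add[symmetric])
      also have "\<dots> \<le> E * exp (- (K4 / 2) * (X v / L ^ m) powr (dw * \<gamma>))"
        unfolding E_def c_def using e1 e2 pos by (intro mult_mono) (auto simp: mult.assoc)
      also have "\<dots> \<le> E * (C1 * (1 + X v / L ^ m) powr (- (d + 1)))"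
        using C1(2) X0[of v] L_pos by (intro mult_left_mono) (auto simp: E_def)
      finally have "K3 * s powr (- d / dw) * exp (- K4 * q) \<le> \<Phi> v"
        unfolding \<Phi>_def using pos by (simp add: mult.assoc mult_left_mono)
      then show "g s x y' \<le> \<Phi> v" using upper[OF s(1) xU y'U] unfolding q_def r_def by simp
    qed
    then show ?thesis by (simp add: C_def E_def mult_ac)
  qed
  ultimately show thesis using that by blast
qed

lemma card_word_shift_words: "card (word_shift ` {u. set u \<subseteq> I \<and> length u = m}) = N ^ m"
proof -
  have "inj_on word_shift {u. set u \<subseteq> I \<and> length u = m}"
    by (intro inj_onI word_shift_inj) (auto simp: in_lists_conv_set)
  then show ?thesis by (simp add: card_image card_lists_length_eq[OF finite_I] card_I)
qed

text \<open>When \<open>s\<close> is of the order of \<open>L powr ((M + m) * dw)\<close>, all the \<open>N ^ m\<close> complexes in \<open>fractal F (M + m)\<close> are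
within the diffusion range of \<open>x\<close>.\<close>

lemma reflected_density_lower:
  assumes glp: "good_labeling_property F"
    and pos: "dw > 0" "\<gamma> > 0" "K1 > 0" "K2 > 0"
    and lower: "\<And>t x y. t > 0 \<Longrightarrow> x \<in> unbounded_fractal F \<Longrightarrow> y \<in> unbounded_fractal F \<Longrightarrow>
      K1 * t powr (- d / dw) * exp (- K2 * (norm (x - y) powr dw / t) powr \<gamma>) \<le> g t x y"
  obtains c where "c > 0"
    "\<forall>M s x y. x \<in> fractal F (int M) \<longrightarrow> y \<in> fractal F (int M) \<longrightarrow> L powr (real M * dw) \<le> s \<longrightarrow>
       ennreal (c * L powr (- real M * d)) \<le> reflected_density F g (int M) s x y"
proof -
  define e where "e = exp (- K2 * ((2 * \<kappa>) powr dw) powr \<gamma>)"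
  define c where "c = K1 * e / L powr d"
  have c0: "c > 0" unfolding c_def e_def using pos L_pos by simp
  have "ennreal (c * L powr (- real M * d)) \<le> reflected_density F g (int M) s x y"
    if x: "x \<in> fractal F (int M)" and y: "y \<in> fractal F (int M)" and s: "L powr (real M * dw) \<le> s" for M s x y
  proof -
    obtain m :: nat where m: "L powr (real (M + m) * dw) \<le> s" "s \<le> L powr (real (M + m + 1) * dw)"
      using scale_bracket[OF pos(1) s] .
    have s0: "s > 0" using m(1) L_pos by (metis less_le_trans powr_gt_zero)
    define W where "W = word_shift ` {u. set u \<subseteq> I \<and> length u = m}"
    define c' where "c' = K1 * L powr (- real (M + m + 1) * d) * e"
    have W: "finite W" "W \<subseteq> shifts"
      unfolding W_def shifts_def using finite_lists_length_eq[OF finite_I] by (auto simp: in_lists_conv_set)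
    have cardW: "card W = N ^ m" unfolding W_def by (rule card_word_shift_words)
    have "ennreal (c' * real (card W)) \<le> reflected_density F g (int M) s x y"
    proof (rule reflected_density_ge[OF glp y W])
      show "c' \<ge> 0" unfolding c'_def e_def using pos by simp
      fix v y' assume v: "v \<in> W" "y' \<in> complexv (int M) v"
      obtain u where u: "u \<in> lists I" "length u = m" "v = word_shift u" using v(1) unfolding W_def by (auto simp: in_lists_conv_set)
      have y': "y' \<in> fractal F (int (M + m))" using complex_at_word[OF u(1), of "int M"] v(2) u by auto
      have x': "x \<in> fractal F (int (M + m))" using fractal_mono[of "int M" "int (M + m)"] x by auto
      obtain k k' where k: "k \<in> K" "x = L ^ (M + m) *\<^sub>R k" "k' \<in> K" "y' = L ^ (M + m) *\<^sub>R k'"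
        using x' y' unfolding fractal_scale powi_nat by auto
      have "norm (x - y') = L ^ (M + m) * norm (k - k')" using k L_pos by (simp flip: scaleR_diff_right)
      then have n: "norm (x - y') \<le> L ^ (M + m) * (2 * \<kappa>)" using K_dist[OF k(1,3)] L_pos by simp
      have "norm (x - y') powr dw \<le> (L ^ (M + m) * (2 * \<kappa>)) powr dw" using n pos by (intro powr_mono2) auto
      also have "\<dots> = L powr (real (M + m) * dw) * (2 * \<kappa>) powr dw"
        using L_pos \<kappa>(1) by (simp only: powr_mult powr_realpow[symmetric] powr_powr)
      also have "\<dots> \<le> s * (2 * \<kappa>) powr dw" using m(1) by (intro mult_right_mono) auto
      finally have "norm (x - y') powr dw / s \<le> (2 * \<kappa>) powr dw" using s0 by (simp add: divide_le_eq mult.commute)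
      then have "(norm (x - y') powr dw / s) powr \<gamma> \<le> ((2 * \<kappa>) powr dw) powr \<gamma>"
        using pos s0 by (intro powr_mono2) auto
      then have "e \<le> exp (- K2 * (norm (x - y') powr dw / s) powr \<gamma>)" unfolding e_def using pos by simp
      moreover have "L powr (- real (M + m + 1) * d) \<le> s powr (- d / dw)"
        by (rule powr_neg_scale_ge[OF pos(1) s0 m(2)])
      ultimately have "c' \<le> K1 * s powr (- d / dw) * exp (- K2 * (norm (x - y') powr dw / s) powr \<gamma>)"
        unfolding c'_def using pos by (intro mult_mono) (auto simp: e_def)
      also have "\<dots> \<le> g s x y'"
        by (rule lower[OF s0]) (use x y' fractal_subset_unbounded in blast)+
      finally show "c' \<le> g s x y'" .
    qed
    moreover have "c' * real (card W) = c * L powr (- real M * d)"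
    proof -
      have eq: "- real (M + m + 1) * d + real m * d = - d + - real M * d" by (simp add: algebra_simps)
      have "L powr (- real (M + m + 1) * d) * L powr (real m * d) = L powr (- d + - real M * d)"
        by (simp only: powr_add[symmetric] eq)
      also have "\<dots> = L powr (- real M * d) / L powr d"
        by (simp only: powr_add powr_minus divide_inverse mult.commute)
      finally have "L powr (- real (M + m + 1) * d) * L powr (real m * d) = L powr (- real M * d) / L powr d" .
      then show ?thesis unfolding c'_def c_def cardW of_nat_power N_pow by (simp add: field_simps)
    qed
    ultimately show ?thesis by simp
  qed
  then show thesis using that c0 by blast
qed

end

section \<open>The law of the stable subordinator\<close>

lemma half_less_half_powr:
  assumes "\<alpha> < 1" shows "(1/2::real) < (1/2) powr \<alpha>"
proof -
  have "(1/2) powr 1 < (1/2 :: real) powr \<alpha>" using assms by (intro powr_less_mono') auto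
  then show ?thesis by simp
qed

lemma one_minus_exp_ge:
  fixes x :: real assumes "0 \<le> x" "x \<le> 1" shows "x / 2 \<le> 1 - exp (- x)"
proof -
  have "exp (- x) \<le> 1 / (1 + x)"
    using exp_ge_add_one_self[of x] assms by (simp add: exp_minus field_simps)
  also have "\<dots> \<le> 1 - x / 2"
  proof -
    have "x * x \<le> x" using assms mult_left_le[of x x] by simp
    then have "1 \<le> (1 - x / 2) * (1 + x)" by (simp add: algebra_simps)
    then show ?thesis using assms by (simp add: divide_le_eq)
  qed
  finally show ?thesis by simp
qed

definition subordinator_law :: "(real \<Rightarrow> real) \<Rightarrow> real measure" where
  "subordinator_law h = density lborel (\<lambda>s. ennreal (h s) * indicator {0<..} s)"

context
  fixes \<alpha> t :: real and h :: "real \<Rightarrow> real"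
  assumes alpha: "0 < \<alpha>" "\<alpha> < 1" and t: "t > 0" and dens: "stable_subordinator_density \<alpha> t h"
begin

abbreviation "\<L> \<equiv> subordinator_law h"

lemma h_measurable [measurable]: "h \<in> borel_measurable borel"
  and h_nonneg: "s > 0 \<Longrightarrow> h s \<ge> 0"
  and h_laplace: "u > 0 \<Longrightarrow> (\<integral>\<^sup>+s\<in>{0<..}. ennreal (exp (- u * s) * h s) \<partial>lborel) = ennreal (exp (- t * u powr \<alpha>))"
  using dens unfolding stable_subordinator_density_def by auto

lemma space_law [simp]: "space \<L> = UNIV" and sets_law [simp, measurable_cong]: "sets \<L> = sets borel"
  unfolding subordinator_law_def by simp_all

lemma nn_integral_law:
  assumes [measurable]: "f \<in> borel_measurable borel"
  shows "(\<integral>\<^sup>+s. f s \<partial>\<L>) = (\<integral>\<^sup>+s\<in>{0<..}. f s * ennreal (h s) \<partial>lborel)"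
  unfolding subordinator_law_def
  by (subst nn_integral_density) (auto intro!: nn_integral_cong simp: mult_ac)

lemma AE_law_pos: "AE s in \<L>. s > 0"
  unfolding subordinator_law_def
  by (subst AE_density) (auto simp: indicator_def)

lemma laplace_law:
  assumes "u > 0" shows "(\<integral>\<^sup>+s. ennreal (exp (- u * s)) \<partial>\<L>) = ennreal (exp (- t * u powr \<alpha>))"
proof -
  have "(\<integral>\<^sup>+s. ennreal (exp (- u * s)) \<partial>\<L>) = (\<integral>\<^sup>+s\<in>{0<..}. ennreal (exp (- u * s)) * ennreal (h s) \<partial>lborel)"
    by (rule nn_integral_law) simp
  also have "\<dots> = (\<integral>\<^sup>+s\<in>{0<..}. ennreal (exp (- u * s) * h s) \<partial>lborel)"
    by (intro nn_integral_cong) (auto simp: indicator_def ennreal_mult h_nonneg)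
  finally show ?thesis using h_laplace[OF assms] by simp
qed

text \<open>Let \<open>u\<close> tend to \<open>0\<close> in the Laplace transform.\<close>

lemma prob_space_law: "prob_space \<L>"
proof
  define u where "u n = (1/2::real) ^ n" for n :: nat
  have u0: "u n > 0" for n by (simp add: u_def)
  have ulim: "u \<longlonglongrightarrow> 0" unfolding u_def by (intro LIMSEQ_power_zero) simp
  define f where "f n s = (if s > 0 then ennreal (exp (- u n * s)) else 0)" for n s
  have [measurable]: "f n \<in> borel_measurable borel" for n unfolding f_def by measurable
  have dec: "u (Suc n) \<le> u n" for n by (simp add: u_def)
  have inc: "incseq f"
  proof (rule incseq_SucI, rule le_funI)
    fix n s show "f n s \<le> f (Suc n) s"
      using dec[of n] by (auto simp: f_def intro!: ennreal_leI mult_right_mono)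
  qed
  have sup: "(SUP n. f n s) = (if s > 0 then 1 else 0)" for s
  proof (cases "s > 0")
    case True
    have "(\<lambda>n. exp (- u n * s)) \<longlonglongrightarrow> exp (- 0 * s)" by (intro tendsto_intros ulim)
    then have "(\<lambda>n. ennreal (exp (- u n * s))) \<longlonglongrightarrow> ennreal (exp (- 0 * s))" by (rule tendsto_ennrealI)
    then have "(\<lambda>n. f n s) \<longlonglongrightarrow> ennreal 1" unfolding f_def using True by simp
    moreover have "(\<lambda>n. f n s) \<longlonglongrightarrow> (SUP n. f n s)"
      using inc by (intro LIMSEQ_SUP) (simp add: incseq_def le_fun_def)
    ultimately show ?thesis using True LIMSEQ_unique by fastforce
  qed (simp add: f_def)
  have int: "(\<integral>\<^sup>+s. f n s \<partial>\<L>) = ennreal (exp (- t * u n powr \<alpha>))" for n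
  proof -
    have "(\<integral>\<^sup>+s. f n s \<partial>\<L>) = (\<integral>\<^sup>+s. ennreal (exp (- u n * s)) \<partial>\<L>)"
      by (intro nn_integral_cong_AE) (use AE_law_pos in eventually_elim, simp add: f_def)
    then show ?thesis using laplace_law[OF u0] by simp
  qed
  have "emeasure \<L> (space \<L>) = (\<integral>\<^sup>+s. 1 \<partial>\<L>)" by simp
  also have "\<dots> = (\<integral>\<^sup>+s. (SUP n. f n s) \<partial>\<L>)"
    unfolding sup by (intro nn_integral_cong_AE) (use AE_law_pos in eventually_elim, simp)
  also have "\<dots> = (SUP n. \<integral>\<^sup>+s. f n s \<partial>\<L>)"
    by (rule nn_integral_monotone_convergence_SUP[OF inc]) simp
  also have "\<dots> = (SUP n. ennreal (exp (- t * u n powr \<alpha>)))" unfolding int ..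
  also have "\<dots> = 1"
  proof (rule LIMSEQ_unique[OF LIMSEQ_SUP])
    show "incseq (\<lambda>n. ennreal (exp (- t * u n powr \<alpha>)))"
    proof (intro incseq_SucI ennreal_leI)
      fix n
      have "u (Suc n) powr \<alpha> \<le> u n powr \<alpha>"
        using dec alpha(1) u0[of "Suc n"] by (intro powr_mono2) simp_all
      then show "exp (- t * u n powr \<alpha>) \<le> exp (- t * u (Suc n) powr \<alpha>)" using t by simp
    qed
    have "(\<lambda>n. u n powr \<alpha>) \<longlonglongrightarrow> 0"
    proof -
      have "u n powr \<alpha> = ((1/2) powr \<alpha>) ^ n" for n
        by (simp add: u_def powr_realpow[symmetric] powr_powr mult.commute)
      moreover have "(1/2 :: real) powr \<alpha> < 1" using alpha(1) by (simp add: powr_def ln_div)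
      ultimately show ?thesis by (simp add: LIMSEQ_power_zero)
    qed
    then have "(\<lambda>n. exp (- t * u n powr \<alpha>)) \<longlonglongrightarrow> exp (- t * 0)" by (intro tendsto_intros)
    then show "(\<lambda>n. ennreal (exp (- t * u n powr \<alpha>))) \<longlonglongrightarrow> 1"
      using tendsto_ennrealI by fastforce
  qed
  finally show "emeasure \<L> (space \<L>) = 1" .
qed

lemma nn_integral_one_minus_exp:
  assumes u: "u > 0"
  shows "(\<integral>\<^sup>+s. ennreal (1 - exp (- u * s)) \<partial>\<L>) = ennreal (1 - exp (- t * u powr \<alpha>))"
proof -
  interpret prob_space \<L> by (rule prob_space_law)
  have "(\<integral>\<^sup>+s. ennreal (1 - exp (- u * s)) \<partial>\<L>) + (\<integral>\<^sup>+s. ennreal (exp (- u * s)) \<partial>\<L>)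
    = (\<integral>\<^sup>+s. ennreal (1 - exp (- u * s)) + ennreal (exp (- u * s)) \<partial>\<L>)"
    by (intro nn_integral_add[symmetric]) auto
  also have "\<dots> = (\<integral>\<^sup>+s. 1 \<partial>\<L>)"
  proof (intro nn_integral_cong_AE, use AE_law_pos in eventually_elim)
    fix s :: real assume "s > 0"
    then have "exp (- u * s) \<le> 1" using u by simp
    then show "ennreal (1 - exp (- u * s)) + ennreal (exp (- u * s)) = 1"
      by (simp add: ennreal_plus[symmetric] del: ennreal_plus)
  qed
  also have "\<dots> = 1" using emeasure_space_1 by simp
  finally have eq: "(\<integral>\<^sup>+s. ennreal (1 - exp (- u * s)) \<partial>\<L>) + ennreal (exp (- t * u powr \<alpha>)) = 1"
    using laplace_law[OF u] by simp
  have "1 = ennreal (1 - exp (- t * u powr \<alpha>)) + ennreal (exp (- t * u powr \<alpha>))"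
    using t by (simp add: ennreal_plus[symmetric] del: ennreal_plus)
  then have "(\<integral>\<^sup>+s. ennreal (1 - exp (- u * s)) \<partial>\<L>) + ennreal (exp (- t * u powr \<alpha>))
      = ennreal (1 - exp (- t * u powr \<alpha>)) + ennreal (exp (- t * u powr \<alpha>))"
    using eq by simp
  then show ?thesis by (metis ennreal_add_diff_cancel_right ennreal_neq_top)
qed

lemma nn_integral_one_minus_exp_le:
  assumes "u > 0"
  shows "(\<integral>\<^sup>+s. ennreal (1 - exp (- u * s)) \<partial>\<L>) \<le> ennreal (t * u powr \<alpha>)"
  unfolding nn_integral_one_minus_exp[OF assms]
  using exp_ge_add_one_self[of "- t * u powr \<alpha>"] by (intro ennreal_leI) simp

text \<open>Markov's inequality for \<open>1 - exp (- x / s)\<close>, which is at least \<open>1/2\<close> for \<open>x \<ge> s\<close>.\<close>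

lemma emeasure_tail_le:
  assumes s: "s > 0"
  shows "emeasure \<L> {s..} \<le> ennreal (2 * t * s powr (- \<alpha>))"
proof -
  have e1: "exp (- 1) \<le> (1/2 :: real)" using exp_ge_add_one_self[of 1] by (simp add: exp_minus field_simps)
  have "emeasure \<L> {s..} = (\<integral>\<^sup>+x. indicator {s..} x \<partial>\<L>)" by simp
  also have "\<dots> \<le> (\<integral>\<^sup>+x. ennreal 2 * ennreal (1 - exp (- (1/s) * x)) \<partial>\<L>)"
  proof (intro nn_integral_mono_AE, use AE_law_pos in eventually_elim)
    fix x :: real assume x: "x > 0"
    show "indicator {s..} x \<le> ennreal 2 * ennreal (1 - exp (- (1/s) * x))"
    proof (cases "s \<le> x")
      case True
      then have "exp (- (1/s) * x) \<le> exp (- 1)" using s by (simp add: field_simps)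
      moreover have "1 \<le> 2 * (1 - a)" if "a \<le> b" "b \<le> 1/2" for a b :: real using that by simp
      ultimately have "1 \<le> 2 * (1 - exp (- (1/s) * x))" using e1 by blast
      then have "ennreal 1 \<le> ennreal (2 * (1 - exp (- (1/s) * x)))" by (rule ennreal_leI)
      also have "\<dots> = ennreal 2 * ennreal (1 - exp (- (1/s) * x))" by (rule ennreal_mult') simp
      finally show ?thesis using True by (simp only: indicator_def) simp
    qed simp
  qed
  also have "\<dots> = ennreal 2 * (\<integral>\<^sup>+x. ennreal (1 - exp (- (1/s) * x)) \<partial>\<L>)"
    by (rule nn_integral_cmult) simp
  also have "\<dots> \<le> ennreal 2 * ennreal (t * (1/s) powr \<alpha>)"
    using s by (intro mult_left_mono nn_integral_one_minus_exp_le) auto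
  also have "\<dots> = ennreal (2 * t * s powr (- \<alpha>))"
  proof -
    have "ennreal 2 * ennreal (t * (1/s) powr \<alpha>) = ennreal (2 * (t * (1/s) powr \<alpha>))"
      by (rule ennreal_mult'[symmetric]) simp
    moreover have "(1/s) powr \<alpha> = s powr (- \<alpha>)" using s by (simp add: powr_divide powr_minus_divide)
    ultimately show ?thesis by (simp only: mult.assoc)
  qed
  finally show ?thesis .
qed

text \<open>Chernoff's bound with the parameter \<open>1 / (2 * s)\<close>; the exponent is negative by \<open>half_less_half_powr\<close>.\<close>

lemma emeasure_small_le:
  assumes s: "s > 0" and ts: "s powr \<alpha> \<le> t"
  shows "emeasure \<L> {..<s} \<le> ennreal (exp (1/2 - (1/2) powr \<alpha>))"
proof -
  have "emeasure \<L> {..<s} = (\<integral>\<^sup>+x. indicator {..<s} x \<partial>\<L>)" by simp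
  also have "\<dots> \<le> (\<integral>\<^sup>+x. ennreal (exp (1/2)) * ennreal (exp (- (1/(2 * s)) * x)) \<partial>\<L>)"
  proof (intro nn_integral_mono)
    fix x :: real
    show "indicator {..<s} x \<le> ennreal (exp (1/2)) * ennreal (exp (- (1/(2 * s)) * x))"
    proof (cases "x < s")
      case True
      have "x / (2 * s) \<le> 1/2" using True s by (simp add: field_simps)
      then have "0 \<le> 1/2 + (- (1/(2 * s)) * x)" by simp
      then have "1 \<le> exp (1/2 + (- (1/(2 * s)) * x))" by simp
      then have "ennreal 1 \<le> ennreal (exp (1/2) * exp (- (1/(2 * s)) * x))" unfolding exp_add[symmetric] by (rule ennreal_leI)
      then show ?thesis using True by (simp add: ennreal_mult')
    qed simp
  qed
  also have "\<dots> = ennreal (exp (1/2)) * (\<integral>\<^sup>+x. ennreal (exp (- (1/(2 * s)) * x)) \<partial>\<L>)"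
    by (rule nn_integral_cmult) simp
  also have "\<dots> = ennreal (exp (1/2)) * ennreal (exp (- t * (1/(2 * s)) powr \<alpha>))"
    using s by (subst laplace_law) auto
  also have "\<dots> = ennreal (exp (1/2 - t * (1/(2 * s)) powr \<alpha>))"
    by (simp add: ennreal_mult'[symmetric] exp_add[symmetric])
  also have "\<dots> \<le> ennreal (exp (1/2 - (1/2) powr \<alpha>))"
  proof (intro ennreal_leI)
    have "(1/2) powr \<alpha> = s powr \<alpha> * (1/(2 * s)) powr \<alpha>"
      using s by (subst powr_mult[symmetric]) auto
    also have "\<dots> \<le> t * (1/(2 * s)) powr \<alpha>" using ts by (intro mult_right_mono) auto
    finally show "exp (1/2 - t * (1/(2 * s)) powr \<alpha>) \<le> exp (1/2 - (1/2) powr \<alpha>)" by simp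
  qed
  finally show ?thesis .
qed

lemma emeasure_large_ge:
  assumes s: "s > 0" and ts: "s powr \<alpha> \<le> t"
  shows "emeasure \<L> {s..} \<ge> ennreal (1 - exp (1/2 - (1/2) powr \<alpha>))"
proof -
  interpret prob_space \<L> by (rule prob_space_law)
  have "prob {..<s} \<le> exp (1/2 - (1/2) powr \<alpha>)"
    using emeasure_small_le[OF assms] by (simp add: emeasure_eq_measure)
  moreover have "{s..} = space \<L> - {..<s}" by auto
  then have "prob {s..} = 1 - prob {..<s}" using prob_compl[of "{..<s}"] by simp
  ultimately show ?thesis by (simp add: emeasure_eq_measure)
qed

text \<open>The expectation of \<open>1 - exp (- \<epsilon> * x / s)\<close> is of the order of \<open>\<epsilon> powr \<alpha>\<close> times \<open>t * s powr (- \<alpha>)\<close>. The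
contribution of \<open>x < s\<close> carries the smaller factor \<open>\<epsilon>\<close> instead, and that of \<open>x \<ge> A * s\<close> the factor
\<open>A powr (- \<alpha>)\<close>; the window has to provide the rest.\<close>

lemma emeasure_window_ge:
  assumes e: "0 < \<epsilon>" "\<epsilon> \<le> 1" and A: "A > 0" and s: "s > 0" and ts: "t \<le> s powr \<alpha>"
    and small: "2 * \<epsilon> + 2 * A powr (- \<alpha>) \<le> \<epsilon> powr \<alpha> / 4"
  shows "ennreal (\<epsilon> powr \<alpha> / 4 * t * s powr (- \<alpha>)) \<le> emeasure \<L> {s..A * s}"
proof -
  interpret prob_space \<L> by (rule prob_space_law)
  define \<tau> where "\<tau> = t * s powr (- \<alpha>)"
  have \<tau>: "0 < \<tau>" "\<tau> \<le> 1" unfolding \<tau>_def using t s ts by (auto simp: powr_minus field_simps)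
  define u where "u = \<epsilon> / s"
  have u: "u > 0" unfolding u_def using e s by simp
  have tu: "t * u powr \<alpha> = \<epsilon> powr \<alpha> * \<tau>"
    unfolding u_def \<tau>_def using e s by (simp add: powr_divide powr_minus field_simps)
  have e\<alpha>: "\<epsilon> powr \<alpha> \<le> 1" using powr_mono2[of \<alpha> \<epsilon> 1] e alpha by simp
  have "ennreal (\<epsilon> powr \<alpha> * \<tau> / 2) \<le> ennreal (1 - exp (- t * u powr \<alpha>))"
  proof (rule ennreal_leI)
    have "\<epsilon> powr \<alpha> * \<tau> \<le> 1" using e\<alpha> \<tau> by (simp add: mult_le_one)
    then show "\<epsilon> powr \<alpha> * \<tau> / 2 \<le> 1 - exp (- t * u powr \<alpha>)"
      using one_minus_exp_ge[of "\<epsilon> powr \<alpha> * \<tau>"] \<tau> e tu by simp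
  qed
  also have "\<dots> = (\<integral>\<^sup>+x. ennreal (1 - exp (- u * x)) \<partial>\<L>)" by (rule nn_integral_one_minus_exp[OF u, symmetric])
  also have "\<dots> \<le> (\<integral>\<^sup>+x. ennreal (2 * \<epsilon>) * ennreal (1 - exp (- (1/s) * x)) + (indicator {s..A * s} x + indicator {A * s..} x) \<partial>\<L>)"
  proof (intro nn_integral_mono_AE, use AE_law_pos in eventually_elim)
    fix x :: real assume x: "x > 0"
    show "ennreal (1 - exp (- u * x)) \<le> ennreal (2 * \<epsilon>) * ennreal (1 - exp (- (1/s) * x)) + (indicator {s..A * s} x + indicator {A * s..} x)"
    proof (cases "x < s")
      case True
      have "1 - exp (- u * x) \<le> u * x" using exp_ge_add_one_self[of "- u * x"] by simp
      also have "\<dots> = 2 * \<epsilon> * ((x / s) / 2)" by (simp add: u_def)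
      also have "\<dots> \<le> 2 * \<epsilon> * (1 - exp (- (x / s)))"
        using one_minus_exp_ge[of "x / s"] True x s e by (intro mult_left_mono) auto
      finally have "ennreal (1 - exp (- u * x)) \<le> ennreal (2 * \<epsilon> * (1 - exp (- (1/s) * x)))"
        by (intro ennreal_leI) simp
      then show ?thesis using e by (simp add: ennreal_mult' add_increasing2)
    next
      case False
      then have "(1::ennreal) \<le> indicator {s..A * s} x + indicator {A * s..} x" by (auto simp: indicator_def)
      moreover have "ennreal (1 - exp (- u * x)) \<le> ennreal 1" by (intro ennreal_leI) simp
      ultimately have "ennreal (1 - exp (- u * x)) \<le> indicator {s..A * s} x + indicator {A * s..} x"
        by (metis ennreal_1 order_trans)
      then show ?thesis by (rule add_increasing[OF zero_le])
    qed
  qed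
  also have "\<dots> = ennreal (2 * \<epsilon>) * (\<integral>\<^sup>+x. ennreal (1 - exp (- (1/s) * x)) \<partial>\<L>)
      + (emeasure \<L> {s..A * s} + emeasure \<L> {A * s..})"
    by (simp add: nn_integral_add nn_integral_cmult)
  also have "\<dots> \<le> ennreal (2 * \<epsilon>) * ennreal (t * (1/s) powr \<alpha>) + (emeasure \<L> {s..A * s} + ennreal (2 * t * (A * s) powr (- \<alpha>)))"
    using s A by (intro add_mono mult_left_mono nn_integral_one_minus_exp_le emeasure_tail_le order_refl) auto
  also have "\<dots> = ennreal (2 * \<epsilon> * \<tau> + prob {s..A * s} + 2 * A powr (- \<alpha>) * \<tau>)"
  proof -
    have h: "t * (1/s) powr \<alpha> = \<tau>" "2 * t * (A * s) powr (- \<alpha>) = 2 * A powr (- \<alpha>) * \<tau>"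
      unfolding \<tau>_def using A s by (simp_all add: powr_divide powr_mult powr_minus field_simps)
    have "ennreal (2 * \<epsilon>) * ennreal \<tau> = ennreal (2 * \<epsilon> * \<tau>)" using e by (simp add: ennreal_mult')
    moreover have "0 \<le> 2 * \<epsilon> * \<tau>" "0 \<le> 2 * A powr (- \<alpha>) * \<tau>" using e \<tau> by simp_all
    ultimately show ?thesis unfolding h by (simp add: emeasure_eq_measure ennreal_plus add.assoc)
  qed
  finally have "\<epsilon> powr \<alpha> * \<tau> / 2 \<le> 2 * \<epsilon> * \<tau> + prob {s..A * s} + 2 * A powr (- \<alpha>) * \<tau>"
    using e \<tau> by (subst (asm) ennreal_le_iff) auto
  moreover have "(2 * \<epsilon> + 2 * A powr (- \<alpha>)) * \<tau> \<le> \<epsilon> powr \<alpha> / 4 * \<tau>"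
    using small \<tau> by (intro mult_right_mono) auto
  ultimately have "\<epsilon> powr \<alpha> / 4 * \<tau> \<le> prob {s..A * s}" by (simp add: algebra_simps)
  then show ?thesis unfolding \<tau>_def by (simp add: emeasure_eq_measure mult.assoc)
qed


text \<open>In units of \<open>t powr (1 / \<alpha>)\<close>, the negative power is dominated by \<open>1\<close> plus a sum of multiples of the
exponentials \<open>exp (- 2 ^ k * x)\<close>, with expectations given by the Laplace transform.\<close>

lemma nn_integral_neg_powr_le:
  assumes \<delta>: "\<delta> > 0"
    and C: "C > 0" "\<forall>x\<ge>0. exp (- 1 * x powr \<alpha>) \<le> C * (1 + x) powr (- (\<delta> + 1))"
  shows "(\<integral>\<^sup>+s. ennreal (s powr (- \<delta>)) \<partial>\<L>) \<le> ennreal ((1 + exp 1 * 2 powr \<delta> * C * 2) * t powr (- \<delta> / \<alpha>))"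
proof -
  interpret prob_space \<L> by (rule prob_space_law)
  define \<sigma> where "\<sigma> = t powr (1 / \<alpha>)"
  have \<sigma>: "\<sigma> > 0" unfolding \<sigma>_def using t by simp
  have t\<sigma>: "t = \<sigma> powr \<alpha>" unfolding \<sigma>_def using t alpha by (simp add: powr_powr)
  define b where "b k = exp 1 * 2 powr (real (Suc k) * \<delta>)" for k :: nat
  define f where "f k s = ennreal (b k) * ennreal (exp (- (2 ^ k / \<sigma>) * s))" for k s
  have [measurable]: "f k \<in> borel_measurable borel" for k unfolding f_def by measurable
  have "(\<integral>\<^sup>+s. ennreal (s powr (- \<delta>)) \<partial>\<L>) \<le> (\<integral>\<^sup>+s. ennreal (\<sigma> powr (- \<delta>)) * (1 + (\<Sum>k. f k s)) \<partial>\<L>)"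
  proof (intro nn_integral_mono_AE, use AE_law_pos in eventually_elim)
    fix s :: real assume s: "s > 0"
    define x where "x = s / \<sigma>"
    have x: "x > 0" "s = x * \<sigma>" using s \<sigma> by (auto simp: x_def)
    have sx: "s powr (- \<delta>) = \<sigma> powr (- \<delta>) * x powr (- \<delta>)" using x \<sigma> by (simp add: powr_mult)
    have "ennreal (x powr (- \<delta>)) \<le> 1 + (\<Sum>k. f k s)"
    proof (cases "x \<ge> 1")
      case True
      then have "x powr (- \<delta>) \<le> x powr 0" using \<delta> by (intro powr_mono) auto
      then have "ennreal (x powr (- \<delta>)) \<le> 1" using x by (simp add: ennreal_le_1)
      then show ?thesis by (metis add.right_neutral add_mono zero_le)
    next
      case False
      define k where "k = (LEAST k. (1/2) ^ Suc k < x)"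
      have "\<exists>n. (1/2) ^ n < x" using x real_arch_pow_inv[of x "1/2"] by simp
      then obtain n where "(1/2) ^ n < x" by blast
      moreover have "(1/2::real) ^ Suc n \<le> (1/2) ^ n" by simp
      ultimately have "\<exists>k. (1/2) ^ Suc k < x" by (intro exI[of _ n]) linarith
      then have k1: "(1/2) ^ Suc k < x" unfolding k_def by (rule LeastI_ex)
      have k2: "x \<le> (1/2) ^ k"
      proof (cases k)
        case 0 then show ?thesis using False by simp
      next
        case (Suc j)
        have "\<not> (1/2) ^ Suc j < x" using not_less_Least[of j "\<lambda>k. (1/2) ^ Suc k < x"] Suc unfolding k_def by simp
        then show ?thesis using Suc by simp
      qed
      have "x powr (- \<delta>) \<le> ((1/2) ^ Suc k) powr (- \<delta>)"
        using k1 \<delta> by (intro powr_mono2') (auto simp del: power_Suc)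
      also have "\<dots> = 2 powr (real (Suc k) * \<delta>)"
        by (simp add: power_one_over powr_divide powr_minus_divide powr_realpow[symmetric] powr_powr del: power_Suc of_nat_Suc)
      finally have p: "x powr (- \<delta>) \<le> 2 powr (real (Suc k) * \<delta>)" .
      have "2 ^ k * x \<le> 1" using k2 by (simp add: power_one_over field_simps)
      then have "1 \<le> exp (1 - 2 ^ k * x)" by simp
      then have e: "1 \<le> exp 1 * exp (- (2 ^ k * x))" by (simp add: exp_add[symmetric])
      have "x powr (- \<delta>) * 1 \<le> 2 powr (real (Suc k) * \<delta>) * (exp 1 * exp (- (2 ^ k * x)))"
        by (intro mult_mono p e) auto
      also have "\<dots> = b k * exp (- (2 ^ k / \<sigma>) * s)" using x \<sigma> by (simp add: b_def)
      finally have "ennreal (x powr (- \<delta>)) \<le> f k s"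
        unfolding f_def by (simp add: ennreal_mult'[symmetric] ennreal_leI b_def)
      also have "\<dots> = (\<Sum>k\<in>{k}. f k s)" by simp
      also have "\<dots> \<le> (\<Sum>k. f k s)" by (rule sum_le_suminf) auto
      also have "\<dots> \<le> 1 + (\<Sum>k. f k s)" by (simp add: add_increasing)
      finally show ?thesis .
    qed
    then show "ennreal (s powr (- \<delta>)) \<le> ennreal (\<sigma> powr (- \<delta>)) * (1 + (\<Sum>k. f k s))"
      unfolding sx by (simp add: ennreal_mult mult_left_mono)
  qed
  also have "\<dots> = ennreal (\<sigma> powr (- \<delta>)) * (\<integral>\<^sup>+s. 1 + (\<Sum>k. f k s) \<partial>\<L>)"
    by (rule nn_integral_cmult) measurable
  also have "(\<integral>\<^sup>+s. 1 + (\<Sum>k. f k s) \<partial>\<L>) = (\<integral>\<^sup>+s. 1 \<partial>\<L>) + (\<integral>\<^sup>+s. (\<Sum>k. f k s) \<partial>\<L>)"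
    by (rule nn_integral_add) measurable
  also have "(\<integral>\<^sup>+s. 1 \<partial>\<L>) = 1" using emeasure_space_1 by simp
  also have "(\<integral>\<^sup>+s. (\<Sum>k. f k s) \<partial>\<L>) = (\<Sum>k. \<integral>\<^sup>+s. f k s \<partial>\<L>)"
    by (rule nn_integral_suminf) measurable
  also have "\<dots> \<le> (\<Sum>k. ennreal (exp 1 * 2 powr \<delta> * C * (1/2) ^ k))"
  proof (intro suminf_le)
    fix k
    have "(\<integral>\<^sup>+s. f k s \<partial>\<L>) = ennreal (b k) * (\<integral>\<^sup>+s. ennreal (exp (- (2 ^ k / \<sigma>) * s)) \<partial>\<L>)"
      unfolding f_def by (rule nn_integral_cmult) measurable
    also have "\<dots> = ennreal (b k) * ennreal (exp (- t * (2 ^ k / \<sigma>) powr \<alpha>))"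
      using \<sigma> by (subst laplace_law) auto
    also have "- t * (2 ^ k / \<sigma>) powr \<alpha> = - 1 * (2 ^ k) powr \<alpha>"
      unfolding t\<sigma> using \<sigma> by (simp add: powr_divide)
    also have "ennreal (b k) * ennreal (exp (- 1 * (2 ^ k) powr \<alpha>)) = ennreal (b k * exp (- 1 * (2 ^ k) powr \<alpha>))"
      by (simp add: ennreal_mult' b_def)
    also have "\<dots> \<le> ennreal (exp 1 * 2 powr \<delta> * C * (1/2) ^ k)"
    proof (rule ennreal_leI)
      have "exp (- 1 * (2 ^ k) powr \<alpha>) \<le> C * (1 + 2 ^ k) powr (- (\<delta> + 1))" using C(2) by simp
      also have "\<dots> \<le> C * (2 ^ k) powr (- (\<delta> + 1))" using C(1) \<delta> by (intro mult_left_mono powr_mono2') auto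
      finally have "b k * exp (- 1 * (2 ^ k) powr \<alpha>) \<le> b k * (C * (2 ^ k) powr (- (\<delta> + 1)))"
        by (intro mult_left_mono) (auto simp: b_def)
      also have "\<dots> = exp 1 * C * (2 powr (real (Suc k) * \<delta>) * 2 powr (real k * (- (\<delta> + 1))))"
        by (simp add: b_def powr_realpow[symmetric] powr_powr)
      also have "2 powr (real (Suc k) * \<delta>) * 2 powr (real k * (- (\<delta> + 1))) = 2 powr (\<delta> + - real k)"
        unfolding powr_add[symmetric] by (simp add: algebra_simps)
      also have "\<dots> = 2 powr \<delta> * (1/2) ^ k"
      proof -
        have "(2::real) powr (\<delta> + - real k) = 2 powr \<delta> / 2 powr real k" by (simp add: powr_diff)
        also have "\<dots> = 2 powr \<delta> * (1/2) ^ k" by (simp add: powr_realpow power_one_over)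
        finally show ?thesis .
      qed
      finally show "b k * exp (- 1 * (2 ^ k) powr \<alpha>) \<le> exp 1 * 2 powr \<delta> * C * (1/2) ^ k" by (simp add: mult_ac)
    qed
    finally show "(\<integral>\<^sup>+s. f k s \<partial>\<L>) \<le> ennreal (exp 1 * 2 powr \<delta> * C * (1/2) ^ k)" .
  qed auto
  also have "(\<Sum>k. ennreal (exp 1 * 2 powr \<delta> * C * (1/2) ^ k)) = ennreal (exp 1 * 2 powr \<delta> * C * 2)"
  proof (rule suminf_ennreal_eq)
    have "(\<lambda>k. (1/2::real) ^ k) sums 2" using geometric_sums[of "1/2::real"] by simp
    then show "(\<lambda>k. exp 1 * 2 powr \<delta> * C * (1/2) ^ k) sums (exp 1 * 2 powr \<delta> * C * 2)" by (rule sums_mult)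
  qed (use C in simp)
  also have "ennreal (\<sigma> powr (- \<delta>)) * (1 + ennreal (exp 1 * 2 powr \<delta> * C * 2))
    = ennreal ((1 + exp 1 * 2 powr \<delta> * C * 2) * t powr (- \<delta> / \<alpha>))"
  proof -
    have "\<sigma> powr (- \<delta>) = t powr (- \<delta> / \<alpha>)" unfolding \<sigma>_def by (simp add: powr_powr)
    moreover have "1 + ennreal (exp 1 * 2 powr \<delta> * C * 2) = ennreal (1 + exp 1 * 2 powr \<delta> * C * 2)"
      using C(1) by (simp add: ennreal_plus)
    moreover have "ennreal (t powr (- \<delta> / \<alpha>)) * ennreal (1 + exp 1 * 2 powr \<delta> * C * 2)
        = ennreal (t powr (- \<delta> / \<alpha>) * (1 + exp 1 * 2 powr \<delta> * C * 2))"
      by (rule ennreal_mult'[symmetric]) simp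
    ultimately show ?thesis by (simp only: mult.commute)
  qed
  finally show ?thesis by (simp add: mult_left_mono add_left_mono)
qed

text \<open>Up to a constant the integrand is at most \<open>\<rho> powr (- \<delta>) * min 1 (s / \<rho>)\<close>, and the minimum is comparable with
\<open>1 - exp (- s / \<rho>)\<close>.\<close>

lemma nn_integral_off_diagonal_le:
  assumes \<delta>: "\<delta> > 0" and \<rho>: "\<rho> > 0"
    and C: "C > 0" "\<forall>x\<ge>0. exp (- c * x powr \<gamma>) \<le> C * (1 + x) powr (- (\<delta> + 1))" and c: "c > 0"
  shows "(\<integral>\<^sup>+s. ennreal (s powr (- \<delta>) * exp (- c * (\<rho> / s) powr \<gamma>)) \<partial>\<L>) \<le> ennreal (2 * (1 + C) * t * \<rho> powr (- \<delta> - \<alpha>))"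
proof -
  have e1: "exp (- 1) \<le> (1/2 :: real)" using exp_ge_add_one_self[of 1] by (simp add: exp_minus field_simps)
  have "(\<integral>\<^sup>+s. ennreal (s powr (- \<delta>) * exp (- c * (\<rho> / s) powr \<gamma>)) \<partial>\<L>)
     \<le> (\<integral>\<^sup>+s. ennreal (2 * (1 + C) * \<rho> powr (- \<delta>)) * ennreal (1 - exp (- (1/\<rho>) * s)) \<partial>\<L>)"
  proof (intro nn_integral_mono_AE, use AE_law_pos in eventually_elim)
    fix s :: real assume s: "s > 0"
    have "s powr (- \<delta>) * exp (- c * (\<rho> / s) powr \<gamma>) \<le> 2 * (1 + C) * \<rho> powr (- \<delta>) * (1 - exp (- (s / \<rho>)))"
    proof (cases "\<rho> \<le> s")
      case True
      have "s powr (- \<delta>) * exp (- c * (\<rho> / s) powr \<gamma>) \<le> \<rho> powr (- \<delta>) * 1"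
        using True \<rho> \<delta> c by (intro mult_mono powr_mono2') auto
      moreover have "exp (- (s / \<rho>)) \<le> exp (- 1)" using True \<rho> by simp
      then have "1/2 \<le> 1 - exp (- (s / \<rho>))" using e1 by linarith
      then have "2 * (1 + C) * \<rho> powr (- \<delta>) * (1/2) \<le> 2 * (1 + C) * \<rho> powr (- \<delta>) * (1 - exp (- (s / \<rho>)))"
        using C(1) by (intro mult_left_mono) auto
      moreover have "\<rho> powr (- \<delta>) \<le> (1 + C) * \<rho> powr (- \<delta>)" using C(1) by (simp add: distrib_right)
      ultimately show ?thesis by linarith
    next
      case False
      have "exp (- c * (\<rho> / s) powr \<gamma>) \<le> C * (1 + \<rho> / s) powr (- (\<delta> + 1))" using C(2) \<rho> s by simp
      also have "\<dots> \<le> C * (\<rho> / s) powr (- (\<delta> + 1))" using C(1) \<rho> s \<delta> by (intro mult_left_mono powr_mono2') auto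
      finally have "s powr (- \<delta>) * exp (- c * (\<rho> / s) powr \<gamma>) \<le> s powr (- \<delta>) * (C * (\<rho> / s) powr (- (\<delta> + 1)))"
        by (intro mult_left_mono) auto
      also have "\<dots> = C * \<rho> powr (- \<delta>) * (s / \<rho>)"
      proof -
        have "s powr (- \<delta>) * (\<rho> / s) powr (- (\<delta> + 1)) = \<rho> powr (- (\<delta> + 1)) * (s powr (- \<delta>) * s powr (\<delta> + 1))"
          using \<rho> s by (simp only: powr_divide powr_minus) (simp add: field_simps)
        also have "s powr (- \<delta>) * s powr (\<delta> + 1) = s" using s by (simp add: powr_add[symmetric])
        also have "\<rho> powr (- (\<delta> + 1)) = \<rho> powr (- \<delta>) / \<rho>" using \<rho> by (simp add: powr_diff)
        finally show ?thesis by (simp add: mult.left_commute)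
      qed
      also have "\<dots> \<le> (1 + C) * \<rho> powr (- \<delta>) * (2 * (1 - exp (- (s / \<rho>))))"
        using one_minus_exp_ge[of "s / \<rho>"] False \<rho> s C(1) by (intro mult_mono mult_right_mono) auto
      finally show ?thesis by (simp add: algebra_simps)
    qed
    then show "ennreal (s powr (- \<delta>) * exp (- c * (\<rho> / s) powr \<gamma>)) \<le> ennreal (2 * (1 + C) * \<rho> powr (- \<delta>)) * ennreal (1 - exp (- (1/\<rho>) * s))"
      using C(1) by (simp add: ennreal_mult'[symmetric] ennreal_leI)
  qed
  also have "\<dots> = ennreal (2 * (1 + C) * \<rho> powr (- \<delta>)) * (\<integral>\<^sup>+s. ennreal (1 - exp (- (1/\<rho>) * s)) \<partial>\<L>)"
    by (rule nn_integral_cmult) measurable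
  also have "\<dots> \<le> ennreal (2 * (1 + C) * \<rho> powr (- \<delta>)) * ennreal (t * (1/\<rho>) powr \<alpha>)"
    using \<rho> by (intro mult_left_mono nn_integral_one_minus_exp_le) auto
  also have "\<dots> = ennreal (2 * (1 + C) * t * \<rho> powr (- \<delta> - \<alpha>))"
  proof -
    have "\<rho> powr (- \<delta>) * (1/\<rho>) powr \<alpha> = \<rho> powr (- \<delta> - \<alpha>)"
      using \<rho> by (simp add: powr_divide powr_diff)
    then have "2 * (1 + C) * \<rho> powr (- \<delta>) * (t * (1/\<rho>) powr \<alpha>) = 2 * (1 + C) * t * \<rho> powr (- \<delta> - \<alpha>)"
      by (simp add: mult_ac)
    moreover have "ennreal (2 * (1 + C) * \<rho> powr (- \<delta>)) * ennreal (t * (1/\<rho>) powr \<alpha>)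
        = ennreal (2 * (1 + C) * \<rho> powr (- \<delta>) * (t * (1/\<rho>) powr \<alpha>))"
      using C(1) by (intro ennreal_mult'[symmetric]) simp
    ultimately show ?thesis by (simp only:)
  qed
  finally show ?thesis .
qed

lemma subordinate_ge:
  assumes "\<And>s. s > 0 \<Longrightarrow> s \<in> S \<Longrightarrow> ennreal B \<le> G s" and [measurable]: "S \<in> sets borel"
  shows "ennreal B * emeasure \<L> S \<le> (\<integral>\<^sup>+s\<in>{0<..}. G s * ennreal (h s) \<partial>lborel)"
proof -
  have "ennreal B * emeasure \<L> S = (\<integral>\<^sup>+s. ennreal B * indicator S s \<partial>\<L>)"
    by (simp add: nn_integral_cmult_indicator)
  also have "\<dots> = (\<integral>\<^sup>+s\<in>{0<..}. (ennreal B * indicator S s) * ennreal (h s) \<partial>lborel)"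
    by (rule nn_integral_law) measurable
  also have "\<dots> \<le> (\<integral>\<^sup>+s\<in>{0<..}. G s * ennreal (h s) \<partial>lborel)"
    using assms(1) by (intro nn_integral_mono) (auto simp: indicator_def intro!: mult_right_mono)
  finally show ?thesis .
qed

lemma subordinate_le:
  assumes "\<And>s. 0 < s \<Longrightarrow> s \<le> T \<Longrightarrow> G s \<le> ennreal C * ennreal (f s)" "\<And>s. T \<le> s \<Longrightarrow> 0 < s \<Longrightarrow> G s \<le> ennreal B"
    and [measurable]: "f \<in> borel_measurable borel"
  shows "(\<integral>\<^sup>+s\<in>{0<..}. G s * ennreal (h s) \<partial>lborel)
    \<le> ennreal C * (\<integral>\<^sup>+s. ennreal (f s) \<partial>\<L>) + ennreal B * emeasure \<L> {T..}"
proof -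
  have "(\<integral>\<^sup>+s\<in>{0<..}. G s * ennreal (h s) \<partial>lborel)
      \<le> (\<integral>\<^sup>+s\<in>{0<..}. (ennreal C * ennreal (f s) + ennreal B * indicator {T..} s) * ennreal (h s) \<partial>lborel)"
  proof (intro nn_integral_mono)
    fix s :: real
    show "G s * ennreal (h s) * indicator {0<..} s
      \<le> (ennreal C * ennreal (f s) + ennreal B * indicator {T..} s) * ennreal (h s) * indicator {0<..} s"
    proof (cases "s > 0")
      case True
      have "G s \<le> ennreal C * ennreal (f s) + ennreal B * indicator {T..} s"
      proof (cases "T \<le> s")
        case T: True
        then have "G s \<le> ennreal B * indicator {T..} s" using assms(2) True by simp
        then show ?thesis by (rule add_increasing[OF zero_le])
      next
        case False
        then show ?thesis using assms(1)[OF True] by simp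
      qed
      then show ?thesis by (intro mult_right_mono) auto
    qed simp
  qed
  also have "\<dots> = (\<integral>\<^sup>+s. ennreal C * ennreal (f s) + ennreal B * indicator {T..} s \<partial>\<L>)"
    by (rule nn_integral_law[symmetric]) measurable
  also have "\<dots> = (\<integral>\<^sup>+s. ennreal C * ennreal (f s) \<partial>\<L>) + (\<integral>\<^sup>+s. ennreal B * indicator {T..} s \<partial>\<L>)"
    by (rule nn_integral_add) measurable
  also have "\<dots> = ennreal C * (\<integral>\<^sup>+s. ennreal (f s) \<partial>\<L>) + ennreal B * emeasure \<L> {T..}"
    by (simp add: nn_integral_cmult nn_integral_cmult_indicator)
  finally show ?thesis .
qed

end

lemma window_constants:
  assumes "0 < \<alpha>" "\<alpha> < (1::real)"
  obtains \<epsilon> A :: real where "0 < \<epsilon>" "\<epsilon> \<le> 1" "A > 0" "2 * \<epsilon> + 2 * A powr (- \<alpha>) \<le> \<epsilon> powr \<alpha> / 4"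
proof -
  define \<epsilon> :: real where "\<epsilon> = (1/16) powr (1 / (1 - \<alpha>))"
  have e: "\<epsilon> > 0" "\<epsilon> \<le> 1"
    using powr_mono2[of "1 / (1 - \<alpha>)" "1/16" 1] assms by (auto simp: \<epsilon>_def)
  have "\<epsilon> powr (1 - \<alpha>) = 1/16" unfolding \<epsilon>_def using assms by (simp add: powr_powr)
  moreover have "\<epsilon> powr \<alpha> * \<epsilon> powr (1 - \<alpha>) = \<epsilon>" using e by (simp add: powr_add[symmetric])
  ultimately have e2: "\<epsilon> = \<epsilon> powr \<alpha> / 16" by (metis mult.right_neutral times_divide_eq_right)
  define A where "A = (\<epsilon> powr \<alpha> / 16) powr (- 1 / \<alpha>)"
  have A: "A > 0" using e by (simp add: A_def)
  have "A powr (- \<alpha>) = \<epsilon> powr \<alpha> / 16" unfolding A_def using assms e by (simp add: powr_powr)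
  then have "2 * \<epsilon> + 2 * A powr (- \<alpha>) \<le> \<epsilon> powr \<alpha> / 4" using e2 by linarith
  then show thesis using that e A by blast
qed

section \<open>The reflected stable density\<close>

context simple_nested_fractal
begin

text \<open>The bound of \<open>reflected_density_upper\<close> at the scale of \<open>s\<close>: the number of complexes compensates for the decay
of \<open>s powr (- d / dw)\<close> after the time scale of level \<open>M\<close>.\<close>

lemma reflected_density_upper_large:
  assumes pos: "dw > 0" "C > 0" "c > 0"
    and upper: "\<forall>M m s x y. x \<in> fractal F (int M) \<longrightarrow> y \<in> fractal F (int M) \<longrightarrow> 0 < s \<longrightarrow> s \<le> L powr (real (M + m) * dw) \<longrightarrow>
       reflected_density F g (int M) s x y
         \<le> ennreal (C * real N ^ m * s powr (- d / dw) * exp (- c * (norm (x - y) powr dw / s) powr \<gamma>))"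
    and x: "x \<in> fractal F (int M)" and y: "y \<in> fractal F (int M)" and s: "L powr (real M * dw) \<le> s"
  shows "reflected_density F g (int M) s x y \<le> ennreal (C * real N * L powr (- real M * d))"
proof -
  obtain m :: nat where m: "L powr (real (M + m) * dw) \<le> s" "s \<le> L powr (real (M + m + 1) * dw)"
    using scale_bracket[OF pos(1) s] .
  have s0: "s > 0" using m(1) L_pos by (metis less_le_trans powr_gt_zero)
  have "reflected_density F g (int M) s x y
      \<le> ennreal (C * real N ^ (m + 1) * s powr (- d / dw) * exp (- c * (norm (x - y) powr dw / s) powr \<gamma>))"
    using upper x y s0 m(2) by (metis add.assoc)
  also have "\<dots> \<le> ennreal (C * real N * L powr (- real M * d))"
  proof (rule ennreal_leI)
    have "exp (- c * (norm (x - y) powr dw / s) powr \<gamma>) \<le> 1" using pos by simp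
    then have "C * real N ^ (m + 1) * s powr (- d / dw) * exp (- c * (norm (x - y) powr dw / s) powr \<gamma>)
        \<le> C * real N ^ (m + 1) * L powr (- real (M + m) * d) * 1"
      using powr_neg_scale[OF pos(1) m(1)] pos by (intro mult_mono) auto
    also have "\<dots> = C * real N * (L powr (real m * d) * L powr (- real (M + m) * d))"
      by (simp add: N_pow[symmetric])
    also have "L powr (real m * d) * L powr (- real (M + m) * d) = L powr (- real M * d)"
      by (simp add: powr_add[symmetric] algebra_simps)
    finally show "C * real N ^ (m + 1) * s powr (- d / dw) * exp (- c * (norm (x - y) powr dw / s) powr \<gamma>)
        \<le> C * real N * L powr (- real M * d)" .
  qed
  finally show ?thesis .
qed

text \<open>Below, \<open>P\<close> is the common order of both densities for small \<open>t\<close>. The range \<open>s \<ge> T\<close> contributes at most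
a multiple of \<open>t * T powr (- \<delta> - \<alpha>)\<close>, which \<open>P\<close> dominates since the distance of \<open>x\<close> and \<open>y\<close> is of the order
of \<open>L\<^sup>M\<close> at most. The lower bound by the free density with the constant \<open>1\<close> holds for every \<open>t\<close>, as \<open>y\<close> is one
of its own copies.\<close>

lemma reflected_stable_density_bounds:
  fixes \<eta> :: "real \<Rightarrow> real \<Rightarrow> real"
  assumes glp: "good_labeling_property F"
    and pos: "dw > 0" "\<gamma> > 0" "K1 > 0" "K2 > 0" "K3 > 0" "K4 > 0"
    and lower: "\<And>t x y. t > 0 \<Longrightarrow> x \<in> unbounded_fractal F \<Longrightarrow> y \<in> unbounded_fractal F \<Longrightarrow>
      K1 * t powr (- d / dw) * exp (- K2 * (norm (x - y) powr dw / t) powr \<gamma>) \<le> g t x y"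
    and upper: "\<And>t x y. t > 0 \<Longrightarrow> x \<in> unbounded_fractal F \<Longrightarrow> y \<in> unbounded_fractal F \<Longrightarrow>
      g t x y \<le> K3 * t powr (- d / dw) * exp (- K4 * (norm (x - y) powr dw / t) powr \<gamma>)"
    and alpha: "0 < \<alpha>" "\<alpha> < 1"
    and dens: "\<And>t. t > 0 \<Longrightarrow> stable_subordinator_density \<alpha> t (\<eta> t)"
  shows "\<exists>B1 B2 B3 B4 :: real. B1 > 0 \<and> B2 > 0 \<and> B3 > 0 \<and> B4 > 0 \<and>
    (\<forall>M :: nat. \<forall>x \<in> fractal F (int M). \<forall>y \<in> fractal F (int M). \<forall>t :: real.
      (0 < t \<and> t < L powr (\<alpha> * real M * dw) \<longrightarrow>
         ennreal B1 * stable_density g \<eta> t x y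
           \<le> reflected_stable_density F g \<eta> (int M) t x y \<and>
         reflected_stable_density F g \<eta> (int M) t x y
           \<le> ennreal B2 * stable_density g \<eta> t x y) \<and>
      (t \<ge> L powr (\<alpha> * real M * dw) \<longrightarrow>
         ennreal (B3 * L powr (- real M * d))
           \<le> reflected_stable_density F g \<eta> (int M) t x y \<and>
         reflected_stable_density F g \<eta> (int M) t x y
           \<le> ennreal (B4 * L powr (- real M * d))))"
proof -
  define \<delta> where "\<delta> = d / dw"
  have \<delta>: "\<delta> > 0" unfolding \<delta>_def using d_pos pos by simp
  have nonneg: "g t x y \<ge> 0" if "t > 0" "x \<in> unbounded_fractal F" "y \<in> unbounded_fractal F" for t x y
    using lower[OF that] pos by (meson exp_ge_zero less_imp_le mult_nonneg_nonneg order_trans powr_ge_zero)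
  obtain C c where C: "C > 0" "c > 0"
    and up: "\<forall>M m s x y. x \<in> fractal F (int M) \<longrightarrow> y \<in> fractal F (int M) \<longrightarrow> 0 < s \<longrightarrow> s \<le> L powr (real (M + m) * dw) \<longrightarrow>
       reflected_density F g (int M) s x y
         \<le> ennreal (C * real N ^ m * s powr (- d / dw) * exp (- c * (norm (x - y) powr dw / s) powr \<gamma>))"
    by (rule reflected_density_upper[OF glp pos(1,2,5,6) nonneg upper])
  obtain c' where c': "c' > 0"
    and low: "\<forall>M s x y. x \<in> fractal F (int M) \<longrightarrow> y \<in> fractal F (int M) \<longrightarrow> L powr (real M * dw) \<le> s \<longrightarrow>
       ennreal (c' * L powr (- real M * d)) \<le> reflected_density F g (int M) s x y"
    by (rule reflected_density_lower[OF glp pos(1-4) lower])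
  have \<delta>1: "\<delta> + 1 \<ge> 0" using \<delta> by simp
  obtain Ca where Ca: "Ca > 0" "\<forall>x\<ge>0. exp (- 1 * x powr \<alpha>) \<le> Ca * (1 + x) powr (- (\<delta> + 1))"
    by (rule exp_neg_powr_le[OF zero_less_one alpha(1) \<delta>1])
  obtain Cg where Cg: "Cg > 0" "\<forall>x\<ge>0. exp (- c * x powr \<gamma>) \<le> Cg * (1 + x) powr (- (\<delta> + 1))"
    by (rule exp_neg_powr_le[OF C(2) pos(2) \<delta>1])
  obtain \<epsilon> A where eA: "0 < \<epsilon>" "\<epsilon> \<le> 1" "A > 0" "2 * \<epsilon> + 2 * A powr (- \<alpha>) \<le> \<epsilon> powr \<alpha> / 4"
    by (rule window_constants[OF alpha])
  define C1 where "C1 = 1 + exp 1 * 2 powr \<delta> * Ca * 2"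
  define C4 where "C4 = C1 + 2 * (1 + Cg)"
  define C3 where "C3 = C * real N"
  define D where "D = max 1 ((2 * \<kappa>) powr dw)"
  define cl where "cl = K1 * A powr (- \<delta>) * exp (- K2) * (\<epsilon> powr \<alpha> / 4)"
  define B2 where "B2 = (C * C4 + 2 * C3 * D powr (\<delta> + \<alpha>)) / cl"
  define B3 where "B3 = c' * (1 - exp (1/2 - (1/2) powr \<alpha>))"
  define B4 where "B4 = C * C1 + C3"
  have N0: "real N > 0" using N_ge_2 by simp
  have C1: "C1 > 0" unfolding C1_def using Ca(1) by (intro add_pos_pos) auto
  have C4: "C4 > 0" unfolding C4_def using C1 Cg(1) by simp
  have C3: "C3 > 0" unfolding C3_def using C N0 by simp
  have D: "D \<ge> 1" unfolding D_def by simp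
  have cl: "cl > 0" unfolding cl_def using pos eA by simp
  have B2: "B2 > 0" unfolding B2_def using C C3 C4 cl D by (intro divide_pos_pos add_pos_pos mult_pos_pos) auto
  have half: "(1/2::real) < (1/2) powr \<alpha>" by (rule half_less_half_powr[OF alpha(2)])
  have B3: "B3 > 0" unfolding B3_def using c' half by simp
  have B4: "B4 > 0" unfolding B4_def using C C1 C3 by (simp add: add_pos_pos)
  show ?thesis
  proof (rule exI[of _ 1], rule exI[of _ B2], rule exI[of _ B3], rule exI[of _ B4], intro conjI allI ballI impI)
    fix M :: nat and x y :: "real^2" and t :: real
    assume x: "x \<in> fractal F (int M)" and y: "y \<in> fractal F (int M)"
    have xU: "x \<in> unbounded_fractal F" "y \<in> unbounded_fractal F" using x y fractal_subset_unbounded by blast+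
    define T where "T = L powr (real M * dw)"
    have T: "T > 0" unfolding T_def using L_pos by simp
    have T\<delta>: "T powr (- \<delta>) = L powr (- real M * d)"
      unfolding T_def \<delta>_def using pos(1) by (simp add: powr_powr)
    have T\<alpha>: "L powr (\<alpha> * real M * dw) = T powr \<alpha>" unfolding T_def by (simp add: powr_powr mult_ac)
    define G where "G s = reflected_density F g (int M) s x y" for s
    have refl_eq: "reflected_stable_density F g \<eta> (int M) t x y = (\<integral>\<^sup>+s\<in>{0<..}. G s * ennreal (\<eta> t s) \<partial>lborel)"
      unfolding reflected_stable_density_def G_def ..
    have stab_eq: "stable_density g \<eta> t x y = (\<integral>\<^sup>+s\<in>{0<..}. ennreal (g s x y) * ennreal (\<eta> t s) \<partial>lborel)"
      unfolding stable_density_def ..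
    define \<rho> where "\<rho> = norm (x - y) powr dw"
    have \<rho>: "\<rho> \<ge> 0" by (simp add: \<rho>_def)
    define f where "f s = s powr (- \<delta>) * exp (- c * (\<rho> / s) powr \<gamma>)" for s
    have [measurable]: "f \<in> borel_measurable borel" unfolding f_def by measurable
    have G1: "G s \<le> ennreal C * ennreal (f s)" if "0 < s" "s \<le> T" for s
    proof -
      have "G s \<le> ennreal (C * real N ^ 0 * s powr (- d / dw) * exp (- c * (norm (x - y) powr dw / s) powr \<gamma>))"
        unfolding G_def using up x y that unfolding T_def by (metis add.right_neutral)
      also have "\<dots> = ennreal C * ennreal (f s)"
        using C by (simp add: f_def \<rho>_def \<delta>_def ennreal_mult'[symmetric] mult.assoc)
      finally show ?thesis .
    qed
    have G2: "G s \<le> ennreal (C3 * T powr (- \<delta>))" if "T \<le> s" for s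
      unfolding G_def C3_def T\<delta> using reflected_density_upper_large[OF pos(1) C up x y] that unfolding T_def by simp
    have G3: "ennreal (c' * T powr (- \<delta>)) \<le> G s" if "T \<le> s" for s
      unfolding G_def T\<delta> using low x y that unfolding T_def by blast
    show "ennreal 1 * stable_density g \<eta> t x y \<le> reflected_stable_density F g \<eta> (int M) t x y"
      unfolding refl_eq stab_eq ennreal_1 mult_1
    proof (intro nn_integral_mono)
      fix s :: real
      show "ennreal (g s x y) * ennreal (\<eta> t s) * indicator {0<..} s \<le> G s * ennreal (\<eta> t s) * indicator {0<..} s"
      proof (cases "s > 0")
        case True
        then have "ennreal (g s x y) \<le> G s"
          unfolding G_def using density_le_reflected_density[OF glp y] nonneg xU by blast
        then show ?thesis by (intro mult_right_mono) auto
      qed simp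
    qed
    have int_f0: "(\<integral>\<^sup>+s. ennreal (f s) \<partial>subordinator_law (\<eta> t)) \<le> ennreal (C1 * t powr (- \<delta> / \<alpha>))" if t: "t > 0"
    proof -
      have "(\<integral>\<^sup>+s. ennreal (f s) \<partial>subordinator_law (\<eta> t)) \<le> (\<integral>\<^sup>+s. ennreal (s powr (- \<delta>)) \<partial>subordinator_law (\<eta> t))"
        using C by (intro nn_integral_mono ennreal_leI) (simp add: f_def mult_left_le)
      also have "\<dots> \<le> ennreal (C1 * t powr (- \<delta> / \<alpha>))"
        unfolding C1_def by (rule nn_integral_neg_powr_le[OF alpha t dens[OF t] \<delta> Ca])
      finally show ?thesis .
    qed
    {
      assume tT: "0 < t \<and> t < L powr (\<alpha> * real M * dw)"
      then have t: "t > 0" and tT': "t \<le> T powr \<alpha>" unfolding T\<alpha> by auto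
      define \<sigma> where "\<sigma> = max \<rho> (t powr (1 / \<alpha>))"
      have \<sigma>: "\<sigma> > 0" unfolding \<sigma>_def using t by (simp add: less_max_iff_disj)
      have t\<sigma>: "t \<le> \<sigma> powr \<alpha>"
      proof -
        have "t = (t powr (1 / \<alpha>)) powr \<alpha>" using t alpha by (simp add: powr_powr)
        also have "\<dots> \<le> \<sigma> powr \<alpha>" unfolding \<sigma>_def using alpha by (intro powr_mono2) auto
        finally show ?thesis .
      qed
      define P where "P = t * \<sigma> powr (- \<delta> - \<alpha>)"
      have P: "P > 0" unfolding P_def using t \<sigma> by simp
      have int_f: "(\<integral>\<^sup>+s. ennreal (f s) \<partial>subordinator_law (\<eta> t)) \<le> ennreal (C4 * P)"
      proof (cases "\<rho> \<le> t powr (1 / \<alpha>)")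
        case True
        then have s: "\<sigma> = t powr (1 / \<alpha>)" unfolding \<sigma>_def by simp
        have "P = t powr 1 * t powr ((- \<delta> - \<alpha>) / \<alpha>)" unfolding P_def s using t by (simp add: powr_powr)
        also have "\<dots> = t powr (- \<delta> / \<alpha>)" unfolding powr_add[symmetric] using alpha by (simp add: field_simps)
        finally have "t powr (- \<delta> / \<alpha>) = P" by simp
        moreover have "C1 * P \<le> C4 * P" using P Cg(1) unfolding C4_def by (intro mult_right_mono) auto
        ultimately show ?thesis using int_f0[OF t] by (metis ennreal_leI order_trans)
      next
        case False
        then have s: "\<sigma> = \<rho>" "\<rho> > 0" unfolding \<sigma>_def using t by (auto intro: le_less_trans[of 0 "t powr (1/\<alpha>)"])
        have "(\<integral>\<^sup>+s. ennreal (f s) \<partial>subordinator_law (\<eta> t)) \<le> ennreal (2 * (1 + Cg) * t * \<rho> powr (- \<delta> - \<alpha>))"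
          unfolding f_def by (rule nn_integral_off_diagonal_le[OF alpha t dens[OF t] \<delta> s(2) Cg C(2)])
        also have "\<dots> \<le> ennreal (C4 * P)"
        proof (rule ennreal_leI)
          have "2 * (1 + Cg) * t * \<rho> powr (- \<delta> - \<alpha>) = 2 * (1 + Cg) * P" unfolding P_def s(1) by simp
          also have "\<dots> \<le> C4 * P" using P C1 unfolding C4_def by (intro mult_right_mono) auto
          finally show "2 * (1 + Cg) * t * \<rho> powr (- \<delta> - \<alpha>) \<le> C4 * P" .
        qed
        finally show ?thesis .
      qed
      \<comment> \<open>both \<open>t powr (1 / \<alpha>)\<close> and \<open>\<rho>\<close> are at most of the order of \<open>T\<close>\<close>
      have \<sigma>T: "\<sigma> \<le> D * T"
      proof -
        have "t powr (1 / \<alpha>) \<le> (T powr \<alpha>) powr (1 / \<alpha>)" using tT' t alpha by (intro powr_mono2) auto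
        also have "\<dots> = T" using T alpha by (simp add: powr_powr)
        also have "\<dots> \<le> D * T" using D T by simp
        finally have 1: "t powr (1 / \<alpha>) \<le> D * T" .
        obtain k k' where k: "k \<in> K" "x = L ^ M *\<^sub>R k" "k' \<in> K" "y = L ^ M *\<^sub>R k'"
          using x y unfolding fractal_scale powi_nat by auto
        have "norm (x - y) = L ^ M * norm (k - k')" using k L_pos by (simp flip: scaleR_diff_right)
        then have "norm (x - y) \<le> L ^ M * (2 * \<kappa>)" using K_dist[OF k(1,3)] L_pos by simp
        then have "\<rho> \<le> (L ^ M * (2 * \<kappa>)) powr dw" unfolding \<rho>_def using pos by (intro powr_mono2) auto
        also have "\<dots> = T * (2 * \<kappa>) powr dw"
          using L_pos \<kappa>(1) by (simp only: T_def powr_mult powr_realpow[symmetric] powr_powr)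
        also have "\<dots> \<le> D * T" unfolding D_def using T by (simp add: mult.commute mult_left_mono)
        finally show ?thesis using 1 unfolding \<sigma>_def by simp
      qed
      have TP: "t * (T powr (- \<delta>) * T powr (- \<alpha>)) \<le> D powr (\<delta> + \<alpha>) * P"
      proof -
        have "(D * T) powr (- \<delta> - \<alpha>) \<le> \<sigma> powr (- \<delta> - \<alpha>)"
          using \<sigma>T \<sigma> \<delta> alpha by (intro powr_mono2') auto
        then have "D powr (\<delta> + \<alpha>) * (D * T) powr (- \<delta> - \<alpha>) \<le> D powr (\<delta> + \<alpha>) * \<sigma> powr (- \<delta> - \<alpha>)"
          by (intro mult_left_mono) auto
        moreover have "D powr (\<delta> + \<alpha>) * (D * T) powr (- \<delta> - \<alpha>) = T powr (- \<delta> - \<alpha>)"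
        proof -
          have "D powr (\<delta> + \<alpha>) * D powr (- \<delta> - \<alpha>) = 1" using D by (simp add: powr_add[symmetric])
          then show ?thesis using D T by (simp add: powr_mult mult.assoc[symmetric])
        qed
        moreover have "T powr (- \<delta>) * T powr (- \<alpha>) = T powr (- \<delta> - \<alpha>)" by (simp add: powr_add[symmetric])
        ultimately have "T powr (- \<delta>) * T powr (- \<alpha>) \<le> D powr (\<delta> + \<alpha>) * \<sigma> powr (- \<delta> - \<alpha>)" by simp
        then have "t * (T powr (- \<delta>) * T powr (- \<alpha>)) \<le> t * (D powr (\<delta> + \<alpha>) * \<sigma> powr (- \<delta> - \<alpha>))"
          using t by (intro mult_left_mono) auto
        then show ?thesis by (simp add: P_def mult_ac)
      qed
      have low_stable: "ennreal (cl * P) \<le> stable_density g \<eta> t x y"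
      proof -
        define B where "B = K1 * (A * \<sigma>) powr (- \<delta>) * exp (- K2)"
        have B0: "B \<ge> 0" unfolding B_def using pos by simp
        have "ennreal (cl * P) = ennreal B * ennreal (\<epsilon> powr \<alpha> / 4 * t * \<sigma> powr (- \<alpha>))"
        proof -
          have "\<sigma> powr (- \<delta>) * \<sigma> powr (- \<alpha>) = \<sigma> powr (- \<delta> - \<alpha>)" by (simp add: powr_add[symmetric])
          then have "cl * P = B * (\<epsilon> powr \<alpha> / 4 * t * \<sigma> powr (- \<alpha>))"
            unfolding cl_def P_def B_def using eA(3) \<sigma> by (simp add: powr_mult mult_ac)
          then show ?thesis by (simp only: ennreal_mult'[OF B0])
        qed
        also have "\<dots> \<le> ennreal B * emeasure (subordinator_law (\<eta> t)) {\<sigma>..A * \<sigma>}"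
          by (intro mult_left_mono emeasure_window_ge[OF alpha t dens[OF t] eA(1-3) \<sigma> t\<sigma> eA(4)]) simp
        also have "\<dots> \<le> stable_density g \<eta> t x y"
          unfolding stab_eq
        proof (rule subordinate_ge[OF alpha t dens[OF t]])
          fix s :: real assume s: "s > 0" "s \<in> {\<sigma>..A * \<sigma>}"
          have "\<rho> / s \<le> 1" using s unfolding \<sigma>_def by (simp add: divide_le_eq)
          then have "(\<rho> / s) powr \<gamma> \<le> 1 powr \<gamma>" using pos \<rho> s by (intro powr_mono2) auto
          then have "exp (- K2) \<le> exp (- K2 * (\<rho> / s) powr \<gamma>)" using pos by simp
          moreover have "(A * \<sigma>) powr (- \<delta>) \<le> s powr (- \<delta>)" using s \<delta> by (intro powr_mono2') auto
          ultimately have "B \<le> K1 * s powr (- \<delta>) * exp (- K2 * (\<rho> / s) powr \<gamma>)"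
            unfolding B_def using pos by (intro mult_mono) auto
          also have "\<dots> \<le> g s x y" using lower[OF s(1) xU] by (simp add: \<delta>_def \<rho>_def)
          finally show "ennreal B \<le> ennreal (g s x y)" by (rule ennreal_leI)
        qed simp
        finally show ?thesis .
      qed
      have "reflected_stable_density F g \<eta> (int M) t x y
          \<le> ennreal C * (\<integral>\<^sup>+s. ennreal (f s) \<partial>subordinator_law (\<eta> t))
            + ennreal (C3 * T powr (- \<delta>)) * emeasure (subordinator_law (\<eta> t)) {T..}"
        unfolding refl_eq by (rule subordinate_le[OF alpha t dens[OF t]]) (use G1 G2 in auto)
      also have "\<dots> \<le> ennreal C * ennreal (C4 * P) + ennreal (C3 * T powr (- \<delta>)) * ennreal (2 * t * T powr (- \<alpha>))"
        by (intro add_mono mult_left_mono int_f emeasure_tail_le[OF alpha t dens[OF t] T]) auto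
      also have "\<dots> = ennreal (C * (C4 * P) + C3 * T powr (- \<delta>) * (2 * t * T powr (- \<alpha>)))"
      proof -
        have "0 \<le> C * (C4 * P)" "0 \<le> C3 * T powr (- \<delta>) * (2 * t * T powr (- \<alpha>))"
          using C C3 C4 P t by simp_all
        moreover have "ennreal C * ennreal (C4 * P) = ennreal (C * (C4 * P))"
          using C by (intro ennreal_mult'[symmetric]) simp
        moreover have "ennreal (C3 * T powr (- \<delta>)) * ennreal (2 * t * T powr (- \<alpha>))
            = ennreal (C3 * T powr (- \<delta>) * (2 * t * T powr (- \<alpha>)))"
          using C3 by (intro ennreal_mult'[symmetric]) simp
        ultimately show ?thesis by (simp only: ennreal_plus)
      qed
      also have "\<dots> \<le> ennreal (B2 * (cl * P))"
      proof (rule ennreal_leI)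
        have "C3 * T powr (- \<delta>) * (2 * t * T powr (- \<alpha>)) = 2 * C3 * (t * (T powr (- \<delta>) * T powr (- \<alpha>)))"
          by (simp add: mult_ac)
        also have "\<dots> \<le> 2 * C3 * (D powr (\<delta> + \<alpha>) * P)" using TP C3 by (intro mult_left_mono) auto
        finally have "C * (C4 * P) + C3 * T powr (- \<delta>) * (2 * t * T powr (- \<alpha>))
            \<le> (C * C4 + 2 * C3 * D powr (\<delta> + \<alpha>)) * P" by (simp add: algebra_simps)
        also have "\<dots> = B2 * (cl * P)" unfolding B2_def using cl by simp
        finally show "C * (C4 * P) + C3 * T powr (- \<delta>) * (2 * t * T powr (- \<alpha>)) \<le> B2 * (cl * P)" .
      qed
      also have "\<dots> = ennreal B2 * ennreal (cl * P)" using B2 by (intro ennreal_mult') simp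
      also have "\<dots> \<le> ennreal B2 * stable_density g \<eta> t x y" by (intro mult_left_mono low_stable) simp
      finally show "reflected_stable_density F g \<eta> (int M) t x y \<le> ennreal B2 * stable_density g \<eta> t x y" .
    next
      assume "L powr (\<alpha> * real M * dw) \<le> t"
      then have tT: "T powr \<alpha> \<le> t" unfolding T\<alpha> .
      have t: "t > 0" using tT T by (metis less_le_trans powr_gt_zero less_irrefl)
      have "ennreal (B3 * T powr (- \<delta>)) = ennreal (c' * T powr (- \<delta>)) * ennreal (1 - exp (1/2 - (1/2) powr \<alpha>))"
        using c' by (simp add: B3_def ennreal_mult'[symmetric] mult_ac)
      also have "\<dots> \<le> ennreal (c' * T powr (- \<delta>)) * emeasure (subordinator_law (\<eta> t)) {T..}"
        by (intro mult_left_mono emeasure_large_ge[OF alpha t dens[OF t] T tT]) simp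
      also have "\<dots> \<le> reflected_stable_density F g \<eta> (int M) t x y"
        unfolding refl_eq by (rule subordinate_ge[OF alpha t dens[OF t]]) (use G3 in auto)
      finally show "ennreal (B3 * L powr (- real M * d)) \<le> reflected_stable_density F g \<eta> (int M) t x y"
        unfolding T\<delta> .
      have "reflected_stable_density F g \<eta> (int M) t x y
          \<le> ennreal C * (\<integral>\<^sup>+s. ennreal (f s) \<partial>subordinator_law (\<eta> t))
            + ennreal (C3 * T powr (- \<delta>)) * emeasure (subordinator_law (\<eta> t)) {T..}"
        unfolding refl_eq by (rule subordinate_le[OF alpha t dens[OF t]]) (use G1 G2 in auto)
      also have "\<dots> \<le> ennreal C * ennreal (C1 * T powr (- \<delta>)) + ennreal (C3 * T powr (- \<delta>)) * 1"
      proof (intro add_mono mult_left_mono)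
        have "t powr (- \<delta> / \<alpha>) \<le> (T powr \<alpha>) powr (- \<delta> / \<alpha>)"
          using tT T \<delta> alpha by (intro powr_mono2') auto
        also have "\<dots> = T powr (- \<delta>)" using alpha by (simp add: powr_powr)
        finally have "C1 * t powr (- \<delta> / \<alpha>) \<le> C1 * T powr (- \<delta>)" using C1 by simp
        then show "(\<integral>\<^sup>+s. ennreal (f s) \<partial>subordinator_law (\<eta> t)) \<le> ennreal (C1 * T powr (- \<delta>))"
          using int_f0[OF t] by (meson ennreal_leI order_trans)
        show "emeasure (subordinator_law (\<eta> t)) {T..} \<le> 1"
          by (rule prob_space.emeasure_le_1[OF prob_space_law[OF alpha t dens[OF t]]])
      qed auto
      also have "\<dots> = ennreal (B4 * T powr (- \<delta>))"
      proof -
        have "ennreal C * ennreal (C1 * T powr (- \<delta>)) = ennreal (C * (C1 * T powr (- \<delta>)))"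
          using C by (intro ennreal_mult'[symmetric]) simp
        then show ?thesis using C C1 C3 by (simp add: B4_def distrib_right ennreal_plus mult.assoc)
      qed
      finally show "reflected_stable_density F g \<eta> (int M) t x y \<le> ennreal (B4 * L powr (- real M * d))"
        unfolding T\<delta> .
    }
  qed (use B2 B3 B4 in auto)
qed

end

theorem theorem3p1:
  fixes F :: similitudes
    and \<Omega> :: "'w measure"
    and P :: "real^2 \<Rightarrow> 'w measure"
    and Z :: "real \<Rightarrow> 'w \<Rightarrow> real^2"
    and g :: "real \<Rightarrow> real^2 \<Rightarrow> real^2 \<Rightarrow> real"
    and \<eta> :: "real \<Rightarrow> real \<Rightarrow> real"
    and \<alpha> dw dJ :: real
  assumes "simple_nested_fractal F"
    and "good_labeling_property F"
    and "fractal_brownian_motion F \<Omega> P Z g dw dJ"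
    and "0 < \<alpha>" and "\<alpha> < 1"
    and "\<And>t. t > 0 \<Longrightarrow> stable_subordinator_density \<alpha> t (\<eta> t)"
  shows "\<exists>B1 B2 B3 B4 :: real. B1 > 0 \<and> B2 > 0 \<and> B3 > 0 \<and> B4 > 0 \<and>
    (\<forall>M :: nat. \<forall>x \<in> fractal F (int M). \<forall>y \<in> fractal F (int M). \<forall>t :: real.
      (0 < t \<and> t < scaling F powr (\<alpha> * real M * dw) \<longrightarrow>
         ennreal B1 * stable_density g \<eta> t x y
           \<le> reflected_stable_density F g \<eta> (int M) t x y \<and>
         reflected_stable_density F g \<eta> (int M) t x y
           \<le> ennreal B2 * stable_density g \<eta> t x y) \<and>
      (t \<ge> scaling F powr (\<alpha> * real M * dw) \<longrightarrow>
         ennreal (B3 * scaling F powr (- real M * fractal_dim F))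
           \<le> reflected_stable_density F g \<eta> (int M) t x y \<and>
         reflected_stable_density F g \<eta> (int M) t x y
           \<le> ennreal (B4 * scaling F powr (- real M * fractal_dim F))))"
proof -
  interpret simple_nested_fractal F by fact
  interpret fractal_brownian_motion F \<Omega> P Z g dw dJ by fact
  obtain K1 K2 K3 K4 where K: "K1 > 0" "K2 > 0" "K3 > 0" "K4 > 0"
    "\<forall>t>0. \<forall>x\<in>unbounded_fractal F. \<forall>y\<in>unbounded_fractal F.
         K1 * t powr (- fractal_dim F / dw) *
           exp (- K2 * (norm (x - y) powr dw / t) powr (1 / (dJ - 1))) \<le> g t x y \<and>
         g t x y \<le> K3 * t powr (- fractal_dim F / dw) *
           exp (- K4 * (norm (x - y) powr dw / t) powr (1 / (dJ - 1)))"
    using density_bounds by (elim exE conjE)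
  have "1 / (dJ - 1) > 0" using dJ_gt_1 by simp
  from reflected_stable_density_bounds[OF assms(2) dw_pos this K(1-4) _ _ assms(4,5,6)] K(5)
  show ?thesis by blast
qed

end
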